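(* Let $R$ be a polynomial ring over a field $K$, let $M$ be a finitely generated graded $R$-module, and let $d_1,\dots,d_m\ge 1$ be integers with $m\le\dim R$. If $f_1,\dots,f_m$ is a generic sequence of homogeneous forms with $\deg f_i=d_i$ and $I=(f_1,\dots,f_m)$, then $$\operatorname{reg}(IM)\le \operatorname{reg}(M)+\operatorname{reg}(I).$$ Here "generic" means: there is a non-empty Zariski open subset $U$ of the affine space $R_{d_1}\times\cdots\times R_{d_m}$ (the non-vanishing locus of some non-zero polynomial in the coefficients), depending on $M$ and $d_1,\dots,d_m$, such that the inequality holds for all $(f_1,\dots,f_m)\in U$.
   Context: $K$ is a field and $R$ is a polynomial ring over $K$ in finitely many variables with the standard grading; $R_d$ is the space of forms of degree $d$. For a finitely generated graded $R$-module $M$ and $i\ge 0$ let $t_i(M)=\max\{j : \operatorname{Tor}_i^R(M,K)_j\neq 0\}$, with $t_i(M)=-\infty$ if $\operatorname{Tor}_i^R(M,K)=0$. The Castelnuovo-Mumford regularity of $M$ is $\operatorname{reg}(M)=\sup\{t_i(M)-i : i\ge 0\}$ (so $\operatorname{reg}(0)=-\infty$). *)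

theory Defs
  imports
    "HOL-Library.Poly_Mapping"
    "HOL-Library.Extended_Real"
    "HOL-Library.Cardinality"
    "Jordan_Normal_Form.Matrix"
begin

text \<open>
  The polynomial ring over the field \<open>'k\<close> with one variable for every element of \<open>'n\<close>:
  finitely supported maps from exponent vectors to coefficients, with convolution product.
  For a finite type \<open>'n\<close> this is \<open>K[x\<^sub>1,\<dots>,x\<^sub>n]\<close>, of Krull dimension \<open>CARD('n)\<close>.
\<close>

type_synonym ('n, 'k) mpoly = "('n \<Rightarrow>\<^sub>0 nat) \<Rightarrow>\<^sub>0 'k"

definition mdeg :: "('n \<Rightarrow>\<^sub>0 nat) \<Rightarrow> nat"
  where "mdeg t = (\<Sum>x \<in> Poly_Mapping.keys t. Poly_Mapping.lookup t x)"

text \<open>The standard grading, indexed by \<open>int\<close>; components of negative degree are \<open>{0}\<close>.\<close>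

definition forms :: "int \<Rightarrow> ('n, 'k::zero) mpoly set"
  where "forms j = {p. \<forall>t \<in> Poly_Mapping.keys p. int (mdeg t) = j}"

text \<open>The residue map \<open>R \<rightarrow> R/\<mm> = K\<close> modulo the ideal \<open>\<mm>\<close> generated by the variables.\<close>

definition const_coeff :: "('n, 'k::zero) mpoly \<Rightarrow> 'k"
  where "const_coeff p = Poly_Mapping.lookup p 0"

definition mpoly_eval :: "('x \<Rightarrow> 'k) \<Rightarrow> ('x, 'k::comm_semiring_1) mpoly \<Rightarrow> 'k"
  where "mpoly_eval v P =
    (\<Sum>t \<in> Poly_Mapping.keys P.
       Poly_Mapping.lookup P t * (\<Prod>x \<in> Poly_Mapping.keys t. v x ^ Poly_Mapping.lookup t x))"

definition mpoly_vars :: "('x, 'k::zero) mpoly \<Rightarrow> 'x set"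
  where "mpoly_vars P = (\<Union>t \<in> Poly_Mapping.keys P. Poly_Mapping.keys t)"

text \<open>The name \<open>module\<close> alone would refer to the record-based notion of HOL-Algebra.\<close>

locale graded_module = Modules.module scale
  for scale :: "('n::finite, 'k::field) mpoly \<Rightarrow> 'm::ab_group_add \<Rightarrow> 'm" +
  fixes gr :: "int \<Rightarrow> 'm set"
  assumes gr_zero: "0 \<in> gr j"
    and gr_diff: "x \<in> gr j \<Longrightarrow> y \<in> gr j \<Longrightarrow> x - y \<in> gr j"
    and gr_scale: "p \<in> forms i \<Longrightarrow> x \<in> gr j \<Longrightarrow> scale p x \<in> gr (i + j)"
    and gr_direct_sum:
      "\<exists>!c. (\<forall>j. c j \<in> gr j) \<and> finite {j. c j \<noteq> 0} \<and> x = (\<Sum>j \<in> {j. c j \<noteq> 0}. c j)"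

definition ideal_times_module ::
    "('r::comm_ring_1 \<Rightarrow> 'm::ab_group_add \<Rightarrow> 'm) \<Rightarrow> 'r set \<Rightarrow> 'm set \<Rightarrow> 'm set"
  where "ideal_times_module scale I N =
    Modules.module.span scale {scale p x | p x. p \<in> I \<and> x \<in> N}"

text \<open>
  A graded free resolution \<open>\<dots> \<rightarrow> F 2 \<rightarrow> F 1 \<rightarrow> F 0 \<rightarrow> N \<rightarrow> 0\<close> of a graded submodule \<open>N\<close>, where \<open>F i\<close>
  is the direct sum of the \<open>R(- a i k)\<close> for \<open>k < b i\<close>. The basis element number \<open>k\<close> of \<open>F i\<close> has degree \<open>a i k\<close>; the matrix \<open>D i\<close> represents the
  differential \<open>F (i + 1) \<rightarrow> F i\<close>, and \<open>e k\<close> is the image in \<open>N\<close> of the basis element number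
  \<open>k\<close> of \<open>F 0\<close>. The conditions on \<open>e\<close> and on the entries of \<open>D\<close> say that all these maps are
  homogeneous of degree 0.
\<close>

definition augmentation ::
    "('r \<Rightarrow> 'm::ab_group_add \<Rightarrow> 'm) \<Rightarrow> (nat \<Rightarrow> 'm) \<Rightarrow> 'r vec \<Rightarrow> 'm"
  where "augmentation scale e v = (\<Sum>k < dim_vec v. scale (v $ k) (e k))"

definition graded_free_resolution ::
    "(('n::finite, 'k::field) mpoly \<Rightarrow> 'm::ab_group_add \<Rightarrow> 'm) \<Rightarrow> (int \<Rightarrow> 'm set) \<Rightarrow> 'm set \<Rightarrow>
     (nat \<Rightarrow> nat) \<Rightarrow> (nat \<Rightarrow> nat \<Rightarrow> int) \<Rightarrow> (nat \<Rightarrow> ('n, 'k) mpoly mat) \<Rightarrow> (nat \<Rightarrow> 'm) \<Rightarrow> bool"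
  where "graded_free_resolution scale gr N b a D e \<longleftrightarrow>
    (\<forall>i. D i \<in> carrier_mat (b i) (b (Suc i))) \<and>
    (\<forall>i. \<forall>l < b i. \<forall>k < b (Suc i). D i $$ (l, k) \<in> forms (a (Suc i) k - a i l)) \<and>
    (\<forall>k < b 0. e k \<in> gr (a 0 k)) \<and>
    augmentation scale e ` carrier_vec (b 0) = N \<and>
    {v \<in> carrier_vec (b 0). augmentation scale e v = 0}
      = (\<lambda>w. D 0 *\<^sub>v w) ` carrier_vec (b 1) \<and>
    (\<forall>i. {v \<in> carrier_vec (b (Suc i)). D i *\<^sub>v v = 0\<^sub>v (b i)}
      = (\<lambda>w. D (Suc i) *\<^sub>v w) ` carrier_vec (b (Suc (Suc i))))"

text \<open>
  The complex \<open>F \<otimes> K\<close>: in homological degree \<open>i\<close> it is \<open>K ^ b i\<close>, and its differentials are the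
  matrices \<open>D i\<close> reduced modulo \<open>\<mm>\<close>. The three sets below are its component of internal
  degree \<open>j\<close> and the cycles and boundaries therein.
\<close>

definition tensor_K_comp ::
    "(nat \<Rightarrow> nat) \<Rightarrow> (nat \<Rightarrow> nat \<Rightarrow> int) \<Rightarrow> nat \<Rightarrow> int \<Rightarrow> 'k::zero vec set"
  where "tensor_K_comp b a i j =
    {v \<in> carrier_vec (b i). \<forall>k < b i. v $ k \<noteq> 0 \<longrightarrow> a i k = j}"

definition tensor_K_cycles ::
    "(nat \<Rightarrow> nat) \<Rightarrow> (nat \<Rightarrow> nat \<Rightarrow> int) \<Rightarrow> (nat \<Rightarrow> ('n, 'k::field) mpoly mat) \<Rightarrow>
     nat \<Rightarrow> int \<Rightarrow> 'k vec set"
  where "tensor_K_cycles b a D i j =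
    (case i of
       0 \<Rightarrow> tensor_K_comp b a 0 j
     | Suc i' \<Rightarrow>
         {v \<in> tensor_K_comp b a (Suc i') j. map_mat const_coeff (D i') *\<^sub>v v = 0\<^sub>v (b i')})"

definition tensor_K_boundaries ::
    "(nat \<Rightarrow> nat) \<Rightarrow> (nat \<Rightarrow> nat \<Rightarrow> int) \<Rightarrow> (nat \<Rightarrow> ('n, 'k::field) mpoly mat) \<Rightarrow>
     nat \<Rightarrow> int \<Rightarrow> 'k vec set"
  where "tensor_K_boundaries b a D i j =
    (\<lambda>w. map_mat const_coeff (D i) *\<^sub>v w) ` tensor_K_comp b a (Suc i) j"

text \<open>
  \<open>Tor\<^sub>i(N, K)\<^sub>j \<noteq> 0\<close>, for a finitely generated graded submodule \<open>N\<close>. Such an \<open>N\<close> has a graded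
  free resolution of finite rank because \<open>R\<close> is Noetherian, and the homology of \<open>F \<otimes> K\<close> does not
  depend on the choice of the resolution \<open>F\<close>.
\<close>

definition Tor_K_nonzero ::
    "(('n::finite, 'k::field) mpoly \<Rightarrow> 'm::ab_group_add \<Rightarrow> 'm) \<Rightarrow> (int \<Rightarrow> 'm set) \<Rightarrow> 'm set \<Rightarrow>
     nat \<Rightarrow> int \<Rightarrow> bool"
  where "Tor_K_nonzero scale gr N i j \<longleftrightarrow>
    (\<exists>b a D e. graded_free_resolution scale gr N b a D e \<and>
       \<not> tensor_K_cycles b a D i j \<subseteq> tensor_K_boundaries b a D i j)"

text \<open>Note that the supremum of the empty set is \<open>-\<infinity>\<close> in \<^typ>\<open>ereal\<close>.\<close>

definition tor_top_degree ::
    "(('n::finite, 'k::field) mpoly \<Rightarrow> 'm::ab_group_add \<Rightarrow> 'm) \<Rightarrow> (int \<Rightarrow> 'm set) \<Rightarrow> 'm set \<Rightarrow>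
     nat \<Rightarrow> ereal"
  where "tor_top_degree scale gr N i =
    (SUP j \<in> {j. Tor_K_nonzero scale gr N i j}. ereal (real_of_int j))"

definition regularity ::
    "(('n::finite, 'k::field) mpoly \<Rightarrow> 'm::ab_group_add \<Rightarrow> 'm) \<Rightarrow> (int \<Rightarrow> 'm set) \<Rightarrow> 'm set \<Rightarrow>
     ereal"
  where "regularity scale gr N = (SUP i. tor_top_degree scale gr N i - ereal (real i))"

text \<open>
  A point of the product of the spaces of forms of degree \<open>d i\<close>, \<open>i < m\<close>, is given by a sequence
  \<open>f\<close> of which only the first \<open>m\<close> entries matter. Its affine coordinates are indexed by the pairs \<open>(i, t)\<close> with \<open>i < m\<close> and \<open>t\<close> an exponent vector
  of degree \<open>d i\<close>. Polynomials in other variables are excluded: such a polynomial can be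
  non-zero and still vanish at every point.
\<close>

definition form_coords :: "nat \<Rightarrow> (nat \<Rightarrow> nat) \<Rightarrow> (nat \<times> ('n \<Rightarrow>\<^sub>0 nat)) set"
  where "form_coords m d = {(i, t). i < m \<and> mdeg t = d i}"

definition nonvanishing_locus ::
    "nat \<Rightarrow> (nat \<Rightarrow> nat) \<Rightarrow> (nat \<times> ('n \<Rightarrow>\<^sub>0 nat), 'k::field) mpoly \<Rightarrow> (nat \<Rightarrow> ('n, 'k) mpoly) set"
  where "nonvanishing_locus m d P =
    {f. (\<forall>i < m. f i \<in> forms (int (d i))) \<and>
        mpoly_eval (\<lambda>(i, t). Poly_Mapping.lookup (f i) t) P \<noteq> 0}"

end

theory Submission
  imports Defs "HOL-Library.Function_Algebras" "Jordan_Normal_Form.Determinant"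
begin

text \<open>
  Let \<open>n\<close> be the number of variables and \<open>B\<^sub>i = (f\<^sub>0, \<dots>, f\<^bsub>i-1\<^esub>) M\<close>, so that \<open>B\<^sub>m = I M\<close>. A form \<open>f\<close> is
  filter-regular on \<open>N\<close> if the kernel of multiplication by \<open>f\<close> on \<open>N\<close> vanishes in high degrees.

  Upper bound. The long exact sequence of \<open>0 \<rightarrow> I M \<rightarrow> M \<rightarrow> M/I M \<rightarrow> 0\<close> (\<open>koszul_exact_submodule\<close>) gives
  \<open>reg (I M) \<le> max (reg M) (reg (M/I M) + 1)\<close>. If every \<open>f\<^sub>i\<close> is filter-regular on \<open>M/B\<^sub>i\<close>, then adding
  it to the ideal raises the regularity of the quotient by at most \<open>d\<^sub>i - 1\<close> (\<open>reg_le_adjoin\<close>), whence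
  \<open>reg (I M) \<le> reg M + \<Sum> (d\<^sub>i - 1) + 1\<close>. Lower bound. If the \<open>f\<^sub>i\<close> are also filter-regular on the
  quotients of the polynomial ring, then they form a regular sequence, because \<open>m \<le> n\<close>; and for a
  complete intersection \<open>Tor\<^bsub>m-1\<^esub>(I, K)\<close> does not vanish in degree \<open>\<Sum> d\<^sub>i\<close> (\<open>ideal_not_acyclic\<close>), whence
  \<open>reg I \<ge> \<Sum> (d\<^sub>i - 1) + 1\<close>. The theorem is the sum of the two bounds.

  It remains to see that filter-regularity holds on a nonempty open set. It is a condition in
  infinitely many degrees. The Bayer--Stillman criterion (\<open>reg_le_of_adjoin\<close>,
  \<open>reg_le_seqsub_criterion\<close>) reduces it to one degree for each form, once the sequence is continued
  by fixed forms until the quotient vanishes in high degrees. These finitely many conditions follow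
  from the exactness of complexes of finite-dimensional vector spaces whose maps depend polynomially
  on the coefficients of the forms, and this is an open condition (\<open>exactness_is_open\<close>,
  \<open>filter_regular_is_open\<close>). A point of the open set is given by powers of the linear forms
  \<open>\<ell>\<^sub>c = \<Sum>\<^sub>x c ^ idx x \<cdot> x\<close>: over an infinite field all but finitely many of them are filter-regular on a given
  module (\<open>lin_generically_injective\<close>), and any \<open>n\<close> of them span the space of linear forms
  (\<open>var_eq_sum_lin\<close>), so that their powers cut out a quotient vanishing in high degrees
  (\<open>powers_cofinite\<close>). Over a finite field there are nonzero polynomials with empty nonvanishing
  locus.

  All homological arguments use Koszul homology of subquotients of one module. It agrees with the
  homology of \<open>F \<otimes> K\<close> for every graded free resolution \<open>F\<close> by dimension shifting
  (\<open>tensor_K_exact_iff\<close>). Resolutions exist by Hilbert's basis theorem (\<open>hilbert_basis\<close>), which also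
  drives the Noetherian induction behind the choice of the linear forms.
\<close>

section \<open>Polynomials and their homogeneous parts\<close>

definition var :: "'n \<Rightarrow> ('n, 'k::comm_semiring_1) mpoly"
  where "var x = Poly_Mapping.single (Poly_Mapping.single x 1) 1"

definition cst :: "'k \<Rightarrow> ('n, 'k::comm_semiring_1) mpoly"
  where "cst c = Poly_Mapping.single 0 c"

definition hpart :: "int \<Rightarrow> ('n, 'k::zero) mpoly \<Rightarrow> ('n, 'k) mpoly"
  where "hpart j p = Poly_Mapping.mapp (\<lambda>t c. if int (mdeg t) = j then c else 0) p"

lemma mdeg_zero [simp]: "mdeg 0 = 0"
  by (simp add: mdeg_def)

lemma mdeg_eq_sum: "mdeg t = (\<Sum>x\<in>UNIV. Poly_Mapping.lookup t x)" for t :: "'n::finite \<Rightarrow>\<^sub>0 nat"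
  unfolding mdeg_def by (rule sum.mono_neutral_left) (auto simp: in_keys_iff)

lemma mdeg_add [simp]: "mdeg (s + t) = mdeg s + mdeg t" for t :: "'n::finite \<Rightarrow>\<^sub>0 nat"
  by (simp add: mdeg_eq_sum lookup_add sum.distrib)

lemma mdeg_single [simp]: "mdeg (Poly_Mapping.single x n) = n"
  by (simp add: mdeg_def)

lemma mdeg_eq_0_iff [simp]: "mdeg t = 0 \<longleftrightarrow> t = 0" for t :: "'n::finite \<Rightarrow>\<^sub>0 nat"
  by (auto simp: mdeg_eq_sum intro: poly_mapping_eqI)

lemma finite_mdeg_eq: "finite {t :: 'n::finite \<Rightarrow>\<^sub>0 nat. mdeg t = d}"
proof -
  have "Poly_Mapping.lookup ` {t :: 'n \<Rightarrow>\<^sub>0 nat. mdeg t = d} \<subseteq> Pi\<^sub>E UNIV (\<lambda>_. {..d})"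
  proof (intro subsetI PiE_I)
    fix g x
    assume "g \<in> Poly_Mapping.lookup ` {t :: 'n \<Rightarrow>\<^sub>0 nat. mdeg t = d}"
    then obtain t where "g = Poly_Mapping.lookup t" "mdeg t = d" by auto
    then show "g x \<in> {..d}"
      using member_le_sum[of x UNIV "Poly_Mapping.lookup t"] by (simp add: mdeg_eq_sum)
  qed simp
  then have "finite (Poly_Mapping.lookup ` {t :: 'n \<Rightarrow>\<^sub>0 nat. mdeg t = d})"
    by (rule finite_subset) (rule finite_PiE, simp_all)
  then show ?thesis
    by (rule finite_imageD) (rule inj_onI, simp only: lookup_inject)
qed

lemma sum_lookup [simp]: "Poly_Mapping.lookup (sum f A) t = (\<Sum>a\<in>A. Poly_Mapping.lookup (f a) t)"
  by (rule lookup_sum)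

lemma mpoly_eq_sum_single: "p = (\<Sum>t\<in>Poly_Mapping.keys p. Poly_Mapping.single t (Poly_Mapping.lookup p t))"
  by (rule poly_mapping_eqI) (simp add: lookup_single when_def in_keys_iff sum.delta' flip: )

lemma lookup_hpart: "Poly_Mapping.lookup (hpart j p) t = (if int (mdeg t) = j then Poly_Mapping.lookup p t else 0)"
  by (simp add: hpart_def lookup_mapp when_def in_keys_iff)

lemma forms_iff: "p \<in> forms j \<longleftrightarrow> (\<forall>t. Poly_Mapping.lookup p t \<noteq> 0 \<longrightarrow> int (mdeg t) = j)"
  by (auto simp: forms_def in_keys_iff)

lemma forms_zero [simp, intro]: "0 \<in> forms j"
  by (simp add: forms_iff)

lemma forms_add: "p \<in> forms j \<Longrightarrow> q \<in> forms j \<Longrightarrow> p + q \<in> forms j"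
  for p :: "('n, 'k::comm_monoid_add) mpoly"
  unfolding forms_iff lookup_add by (metis add_0)

lemma forms_diff: "p \<in> forms j \<Longrightarrow> q \<in> forms j \<Longrightarrow> p - q \<in> forms j"
  for p :: "('n, 'k::ab_group_add) mpoly"
  unfolding forms_iff lookup_minus by (metis diff_zero)

lemma forms_sum: "(\<And>i. i \<in> A \<Longrightarrow> p i \<in> forms j) \<Longrightarrow> sum p A \<in> forms j"
  for p :: "'i \<Rightarrow> ('n, 'k::comm_monoid_add) mpoly"
  by (induction A rule: infinite_finite_induct) (auto intro: forms_add)

lemma forms_mult: "p \<in> forms i \<Longrightarrow> q \<in> forms j \<Longrightarrow> p * q \<in> forms (i + j)"
  for p :: "('n::finite, 'k::comm_semiring_1) mpoly"
  using keys_mult[of p q] by (fastforce simp: forms_def)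

lemma var_forms [simp, intro]: "var x \<in> forms 1"
  by (auto simp: var_def forms_iff lookup_single when_def)

lemma cst_forms [simp, intro]: "cst c \<in> forms 0"
  by (auto simp: cst_def forms_iff lookup_single when_def)

lemma one_forms [simp, intro]: "1 \<in> forms 0"
  by (auto simp: forms_iff lookup_one when_def)

lemma forms_negative: "j < 0 \<Longrightarrow> p \<in> forms j \<Longrightarrow> p = 0"
  by (force simp: forms_iff intro: poly_mapping_eqI)

lemma hpart_forms [simp, intro]: "hpart j p \<in> forms j"
  by (auto simp: forms_iff lookup_hpart)

lemma hpart_of_forms: "p \<in> forms i \<Longrightarrow> hpart j p = (if i = j then p else 0)"
  by (rule poly_mapping_eqI) (auto simp: forms_iff lookup_hpart)

lemma hpart_add: "hpart j (p + q) = hpart j p + hpart j q"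
  for p :: "('n, 'k::comm_monoid_add) mpoly"
  by (rule poly_mapping_eqI) (auto simp: lookup_hpart lookup_add)

lemma hpart_zero [simp]: "hpart j 0 = 0"
  by (rule poly_mapping_eqI) (auto simp: lookup_hpart)

lemma hpart_sum: "hpart j (sum f A) = (\<Sum>a\<in>A. hpart j (f a))"
  for f :: "'i \<Rightarrow> ('n, 'k::comm_monoid_add) mpoly"
  by (induction A rule: infinite_finite_induct) (simp_all add: hpart_add)

definition degs :: "('n, 'k::zero) mpoly \<Rightarrow> int set"
  where "degs p = (\<lambda>t. int (mdeg t)) ` Poly_Mapping.keys p"

lemma finite_degs [simp]: "finite (degs p)"
  by (simp add: degs_def)

lemma hpart_eq_0: "j \<notin> degs p \<Longrightarrow> hpart j p = 0"
  by (rule poly_mapping_eqI) (auto simp: degs_def lookup_hpart in_keys_iff)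

lemma mpoly_eq_sum_hpart: "finite J \<Longrightarrow> degs p \<subseteq> J \<Longrightarrow> p = (\<Sum>j\<in>J. hpart j p)"
  for p :: "('n, 'k::comm_monoid_add) mpoly"
  by (rule poly_mapping_eqI) (auto simp: lookup_hpart degs_def in_keys_iff image_subset_iff sum.delta')

lemma cst_0 [simp]: "cst 0 = 0"
  and cst_1 [simp]: "cst 1 = 1"
  by (simp_all add: cst_def)

lemma cst_add: "cst (a + b) = cst a + cst b"
  by (simp add: cst_def single_add)

lemma cst_sum: "cst (sum f A) = (\<Sum>a\<in>A. cst (f a))"
  by (induction A rule: infinite_finite_induct) (simp_all add: cst_add)

lemma cst_mult: "cst (a * b) = cst a * cst b"
  by (simp add: cst_def mult_single)

lemma single_var_mult:
  "Poly_Mapping.single (t + Poly_Mapping.single x 1) c = var x * Poly_Mapping.single t c"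
  by (simp add: var_def mult_single add.commute)

text \<open>The polynomial ring is generated by the constants and the variables: an additive property
  that survives multiplication by a variable holds everywhere once it holds for constants.\<close>

lemma mpoly_induct [case_names cst var add]:
  fixes p :: "('n::finite, 'k::comm_semiring_1) mpoly"
  assumes cst: "\<And>c. P (cst c)"
    and var: "\<And>x p. P p \<Longrightarrow> P (var x * p)"
    and add: "\<And>p q. P p \<Longrightarrow> P q \<Longrightarrow> P (p + q)"
  shows "P p"
proof -
  have mono: "P (Poly_Mapping.single t c)" if "mdeg t = n" for t c n
    using that
  proof (induction n arbitrary: t)
    case 0
    then show ?case
      using cst[of c] by (simp add: cst_def)
  next
    case (Suc n)
    then have "t \<noteq> 0" by auto
    then obtain x where x: "Poly_Mapping.lookup t x \<noteq> 0"
      by (metis lookup_zero poly_mapping_eqI)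
    have t: "t = (t - Poly_Mapping.single x 1) + Poly_Mapping.single x 1"
      using x by (intro poly_mapping_eqI) (auto simp: lookup_add lookup_minus lookup_single when_def)
    then have "mdeg t = mdeg (t - Poly_Mapping.single x 1) + 1"
      by (metis mdeg_add mdeg_single)
    with Suc have "P (Poly_Mapping.single (t - Poly_Mapping.single x 1) c)"
      by simp
    from var[OF this, of x] show ?case
      using t single_var_mult by metis
  qed
  have zero: "P 0"
    using cst[of 0] by simp
  have "P (\<Sum>t\<in>A. Poly_Mapping.single t (Poly_Mapping.lookup p t))" if "finite A" for A
    using that by (induction A) (auto intro: zero add mono)
  then show ?thesis
    by (subst mpoly_eq_sum_single) simp
qed

text \<open>Forms of positive degree lie in the ideal of the variables, with homogeneous coefficients.
  This makes them act as zero on Koszul homology.\<close>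

lemma form_in_irrelevant_ideal:
  fixes p :: "('n::finite, 'k::comm_ring_1) mpoly"
  shows "\<exists>g. p = cst (const_coeff p) + (\<Sum>x\<in>UNIV. var x * g x)"
proof (induction p rule: mpoly_induct)
  case (cst c)
  show ?case
    by (rule exI[of _ "\<lambda>_. 0"]) (simp add: const_coeff_def cst_def)
next
  case (var y p)
  have "const_coeff (var y * p) = 0"
  proof -
    have "p \<in> forms j \<Longrightarrow> j \<ge> 0 \<Longrightarrow> const_coeff (var y * p) = 0" for j and p :: "('n, 'k) mpoly"
      using forms_mult[OF var_forms[of y], of p j] by (auto simp: const_coeff_def forms_iff)
    note hom = this
    have "var y * p = (\<Sum>j\<in>degs p. var y * hpart j p)"
      by (subst (1) mpoly_eq_sum_hpart[of "degs p" p]) (auto simp: sum_distrib_left)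
    then have "const_coeff (var y * p) = (\<Sum>j\<in>degs p. const_coeff (var y * hpart j p))"
      by (simp add: const_coeff_def)
    also have "\<dots> = 0"
      by (intro sum.neutral ballI hom[OF hpart_forms]) (auto simp: degs_def)
    finally show ?thesis .
  qed
  then show ?case
    by (intro exI[of _ "\<lambda>x. if x = y then p else 0"]) (simp add: if_distrib cong: if_cong)
next
  case (add p q)
  then obtain g h where "p = cst (const_coeff p) + (\<Sum>x\<in>UNIV. var x * g x)"
    and "q = cst (const_coeff q) + (\<Sum>x\<in>UNIV. var x * h x)"
    by auto
  then have "p + q = (cst (const_coeff p) + (\<Sum>x\<in>UNIV. var x * g x)) +
      (cst (const_coeff q) + (\<Sum>x\<in>UNIV. var x * h x))"
    by (rule arg_cong2)
  also have "\<dots> = cst (const_coeff p + const_coeff q) + (\<Sum>x\<in>UNIV. var x * (g x + h x))"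
    by (simp add: cst_add algebra_simps sum.distrib)
  also have "const_coeff p + const_coeff q = const_coeff (p + q)"
    by (simp add: const_coeff_def lookup_add)
  finally show ?case
    by (intro exI[of _ "\<lambda>x. g x + h x"])
qed

lemma hpart_var_mult: "hpart j (var x * p) = var x * hpart (j - 1) p"
  for p :: "('n::finite, 'k::comm_ring_1) mpoly"
proof -
  have "hpart j (var x * p) = hpart j (\<Sum>i\<in>degs p. var x * hpart i p)"
    by (subst (1) mpoly_eq_sum_hpart[of "degs p" p]) (auto simp: sum_distrib_left)
  also have "\<dots> = (\<Sum>i\<in>degs p. if 1 + i = j then var x * hpart i p else 0)"
    by (simp add: hpart_sum hpart_of_forms[OF forms_mult[OF var_forms hpart_forms]])
  also have "\<dots> = (\<Sum>i\<in>degs p. if j - 1 = i then var x * hpart i p else 0)"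
    by (rule sum.cong) auto
  also have "\<dots> = var x * hpart (j - 1) p"
    by (auto simp: hpart_eq_0)
  finally show ?thesis .
qed

lemma form_eq_sum_var:
  fixes p :: "('n::finite, 'k::comm_ring_1) mpoly"
  assumes "p \<in> forms d" "d \<ge> 1"
  obtains g where "p = (\<Sum>x\<in>UNIV. var x * g x)" "\<And>x. g x \<in> forms (d - 1)"
proof -
  obtain g where g: "p = cst (const_coeff p) + (\<Sum>x\<in>UNIV. var x * g x)"
    using form_in_irrelevant_ideal by blast
  have "p = hpart d p"
    using assms by (simp add: hpart_of_forms)
  also have "\<dots> = (\<Sum>x\<in>UNIV. var x * hpart (d - 1) (g x))"
    using assms by (subst g) (simp add: hpart_add hpart_sum hpart_var_mult hpart_of_forms[OF cst_forms])
  finally show thesis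
    by (intro that) auto
qed

lemma const_coeff_zero [simp]: "const_coeff 0 = 0"
  and const_coeff_add: "const_coeff (p + q) = const_coeff p + const_coeff q"
  for p q :: "('n, 'k::comm_monoid_add) mpoly"
  by (simp_all add: const_coeff_def lookup_add)

lemma const_coeff_sum: "const_coeff (sum f A) = (\<Sum>a\<in>A. const_coeff (f a))"
  by (simp add: const_coeff_def)

lemma const_coeff_cst [simp]: "const_coeff (cst c) = c"
  by (simp add: const_coeff_def cst_def)

lemma const_coeff_var_mult [simp]: "const_coeff (var y * p) = 0"
  for p :: "('n::finite, 'k::comm_ring_1) mpoly"
proof -
  have "hpart 0 (var y * p) = 0"
    by (simp add: hpart_var_mult forms_negative[OF _ hpart_forms])
  from arg_cong[OF this, of const_coeff] show ?thesis
    by (simp add: const_coeff_def lookup_hpart)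
qed

lemma const_coeff_forms: "p \<in> forms j \<Longrightarrow> j \<noteq> 0 \<Longrightarrow> const_coeff p = 0"
  by (auto simp: const_coeff_def forms_iff)

section \<open>The Koszul complex of commuting operators\<close>

text \<open>The signs of the Koszul differential require a linear order on the variables; the numbering
  is also used as the exponent in the linear forms \<open>\<Sum>\<^sub>x c ^ idx x \<cdot> x\<close> below.\<close>

definition idx :: "'n::finite \<Rightarrow> nat"
  where "idx = (SOME h. bij_betw h UNIV {..<CARD('n)})"

lemma idx_bij: "bij_betw (idx :: 'n \<Rightarrow> nat) UNIV {..<CARD('n::finite)}"
proof -
  have "\<exists>h :: 'n \<Rightarrow> nat. bij_betw h UNIV {..<CARD('n)}"
    using ex_bij_betw_finite_nat[of "UNIV :: 'n set"] by (simp add: atLeast0LessThan)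
  then show ?thesis
    unfolding idx_def by (rule someI_ex)
qed

lemma idx_inject [simp]: "idx x = idx y \<longleftrightarrow> x = y"
  using idx_bij by (auto simp: bij_betw_def inj_on_def)

lemma idx_less: "idx (x :: 'n) < CARD('n::finite)"
  using idx_bij by (auto simp: bij_betw_def)

definition ksign :: "'n::finite \<Rightarrow> 'n set \<Rightarrow> 'a::ab_group_add \<Rightarrow> 'a"
  where "ksign x S u = (if even (card {y \<in> S. idx y < idx x}) then u else - u)"

lemma ksign_zero [simp]: "ksign x S 0 = 0"
  and ksign_empty [simp]: "ksign x {} u = u"
  and ksign_ksign [simp]: "ksign x S (ksign x S u) = u"
  and ksign_commute: "ksign x S (ksign y T u) = ksign y T (ksign x S u)"
  and ksign_uminus: "ksign x S (- u) = - ksign x S u"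
  and ksign_add: "ksign x S (u + v) = ksign x S u + ksign x S v"
  and ksign_diff: "ksign x S (u - v) = ksign x S u - ksign x S v"
  by (simp_all add: ksign_def)

lemma ksign_sum: "ksign x S (sum f A) = (\<Sum>a\<in>A. ksign x S (f a))"
  by (simp add: ksign_def sum_negf)

lemma ksign_insert: "y \<notin> S \<Longrightarrow> ksign x (insert y S) u = (if idx y < idx x then - ksign x S u else ksign x S u)"
proof -
  assume "y \<notin> S"
  moreover have "{z \<in> insert y S. idx z < idx x} =
      (if idx y < idx x then insert y {z \<in> S. idx z < idx x} else {z \<in> S. idx z < idx x})"
    by auto
  ultimately show ?thesis
    by (simp add: ksign_def)
qed

lemma ksign_insert_self [simp]: "ksign x (insert x S) u = ksign x S u"
  by (cases "x \<in> S") (simp_all add: insert_absorb ksign_insert)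

lemma ksign_remove_self [simp]: "ksign x (S - {x}) u = ksign x S u"
  by (cases "x \<in> S") (metis ksign_insert_self insert_Diff, simp)

lemma ksign_anticommute:
  assumes "x \<notin> S" "y \<notin> S" "x \<noteq> y"
  shows "ksign x S (ksign y (insert x S) u) = - ksign y S (ksign x (insert y S) u)"
proof -
  have "idx x < idx y \<longleftrightarrow> \<not> idx y < idx x"
    using assms(3) idx_inject[of x y] by linarith
  with assms show ?thesis
    by (simp add: ksign_insert ksign_uminus ksign_commute[of x S y S])
qed

text \<open>Chains are functions on sets of variables: the value at \<open>S\<close> is the coefficient of the
  exterior monomial \<open>\<And>\<^bsub>x\<in>S\<^esub> e\<^sub>x\<close>.\<close>

definition bd :: "('n::finite \<Rightarrow> 'a \<Rightarrow> 'a) \<Rightarrow> ('n set \<Rightarrow> 'a::ab_group_add) \<Rightarrow> 'n set \<Rightarrow> 'a"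
  where "bd X u = (\<lambda>S. \<Sum>x\<in>-S. ksign x S (X x (u (insert x S))))"

definition kchains :: "(int \<Rightarrow> 'a set) \<Rightarrow> int \<Rightarrow> ('n set \<Rightarrow> 'a) set"
  where "kchains A j = {u. \<forall>S. u S \<in> A (j - int (card S))}"

definition in_degree :: "nat \<Rightarrow> ('n set \<Rightarrow> 'a::zero) \<Rightarrow> bool"
  where "in_degree i u \<longleftrightarrow> (\<forall>S. card S \<noteq> i \<longrightarrow> u S = 0)"

text \<open>Vanishing of the component of internal degree \<open>j\<close> of the \<open>i\<close>-th Koszul homology of the
  quotient \<open>A/C\<close> of two families of homogeneous components. Working with subquotients of one
  ambient group avoids quotient types.\<close>

definition koszul_exact ::
    "('n::finite \<Rightarrow> 'a \<Rightarrow> 'a) \<Rightarrow> (int \<Rightarrow> 'a set) \<Rightarrow> (int \<Rightarrow> 'a::ab_group_add set) \<Rightarrow> nat \<Rightarrow> int \<Rightarrow> bool"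
  where "koszul_exact X A C i j \<longleftrightarrow>
    (\<forall>u \<in> kchains A j. in_degree i u \<longrightarrow> bd X u \<in> kchains C j \<longrightarrow>
      (\<exists>w \<in> kchains A j. in_degree (Suc i) w \<and> u - bd X w \<in> kchains C j))"

lemma koszul_exactD:
  assumes "koszul_exact X A C i j" "u \<in> kchains A j" "in_degree i u" "bd X u \<in> kchains C j"
  obtains w where "w \<in> kchains A j" "in_degree (Suc i) w" "u - bd X w \<in> kchains C j"
  using assms by (auto simp: koszul_exact_def)

definition graded_sub :: "('n \<Rightarrow> 'a \<Rightarrow> 'a) \<Rightarrow> (int \<Rightarrow> 'a::ab_group_add set) \<Rightarrow> bool"
  where "graded_sub X A \<longleftrightarrow>
    (\<forall>j. 0 \<in> A j \<and> (\<forall>u\<in>A j. \<forall>v\<in>A j. u - v \<in> A j) \<and> (\<forall>x. \<forall>u\<in>A j. X x u \<in> A (j + 1)))"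

lemma graded_subD:
  assumes "graded_sub X A"
  shows "0 \<in> A j" "u \<in> A j \<Longrightarrow> v \<in> A j \<Longrightarrow> u - v \<in> A j" "u \<in> A j \<Longrightarrow> X x u \<in> A (j + 1)"
    "u \<in> A j \<Longrightarrow> - u \<in> A j" "u \<in> A j \<Longrightarrow> v \<in> A j \<Longrightarrow> u + v \<in> A j"
proof -
  show 0: "0 \<in> A j" for j
    using assms by (simp add: graded_sub_def)
  show diff: "u \<in> A j \<Longrightarrow> v \<in> A j \<Longrightarrow> u - v \<in> A j" for u v j
    using assms by (simp add: graded_sub_def)
  show "u \<in> A j \<Longrightarrow> X x u \<in> A (j + 1)"
    using assms by (simp add: graded_sub_def)
  show "u \<in> A j \<Longrightarrow> - u \<in> A j" for u
    using diff[OF 0] by (metis diff_0)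
  then show "u \<in> A j \<Longrightarrow> v \<in> A j \<Longrightarrow> u + v \<in> A j"
    using diff by (metis diff_minus_eq_add)
qed

lemma graded_sub_sum: "graded_sub X A \<Longrightarrow> (\<And>i. i \<in> I \<Longrightarrow> f i \<in> A j) \<Longrightarrow> sum f I \<in> A j"
  by (induction I rule: infinite_finite_induct) (auto intro: graded_subD)

lemma graded_sub_ksign: "graded_sub X A \<Longrightarrow> u \<in> A j \<Longrightarrow> ksign x S u \<in> A j"
  by (auto simp: ksign_def intro: graded_subD)

lemma kchains_diff: "graded_sub X A \<Longrightarrow> u \<in> kchains A j \<Longrightarrow> v \<in> kchains A j \<Longrightarrow> u - v \<in> kchains A j"
  and kchains_add: "graded_sub X A \<Longrightarrow> u \<in> kchains A j \<Longrightarrow> v \<in> kchains A j \<Longrightarrow> u + v \<in> kchains A j"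
  and kchains_uminus: "graded_sub X A \<Longrightarrow> u \<in> kchains A j \<Longrightarrow> - u \<in> kchains A j"
  and kchains_zero: "graded_sub X A \<Longrightarrow> 0 \<in> kchains A j"
  by (simp_all add: kchains_def graded_subD)

lemma kchains_mono: "(\<And>j. A j \<subseteq> B j) \<Longrightarrow> u \<in> kchains A j \<Longrightarrow> u \<in> kchains B j"
  by (auto simp: kchains_def)

lemma in_degree_diff: "in_degree i u \<Longrightarrow> in_degree i v \<Longrightarrow> in_degree i (u - v)"
  and in_degree_add: "in_degree i u \<Longrightarrow> in_degree i v \<Longrightarrow> in_degree i (u + v)"
  for u v :: "'n set \<Rightarrow> 'a::ab_group_add"
  by (simp_all add: in_degree_def)

lemma bd_in_degree_0: "(\<And>x. X x 0 = 0) \<Longrightarrow> in_degree 0 (u :: 'n::finite set \<Rightarrow> 'a::ab_group_add) \<Longrightarrow> bd X u = 0"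
proof -
  assume "\<And>x. X x 0 = 0" "in_degree 0 u"
  moreover have "card (insert x S) \<noteq> 0" for x :: 'n and S
    by simp
  ultimately show ?thesis
    unfolding bd_def in_degree_def by (intro ext) (simp del: card_0_eq)
qed

text \<open>The induction removes one index at a time and never divides by 2, so that the characteristic of
  the field does not matter.\<close>

lemma sum_antisymmetric_eq_0:
  fixes g :: "'i \<Rightarrow> 'i \<Rightarrow> 'a::ab_group_add"
  assumes "finite A" "\<And>x y. x \<in> A \<Longrightarrow> y \<in> A \<Longrightarrow> x \<noteq> y \<Longrightarrow> g x y = - g y x"
  shows "(\<Sum>x\<in>A. \<Sum>y\<in>A - {x}. g x y) = 0"
  using assms
proof (induction A)
  case (insert a A)
  have "(\<Sum>y\<in>insert a A - {x}. g x y) = g x a + (\<Sum>y\<in>A - {x}. g x y)" if "x \<in> A" for x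
  proof -
    have "insert a A - {x} = insert a (A - {x})" using insert.hyps that by auto
    with insert.hyps show ?thesis by simp
  qed
  then have "(\<Sum>x\<in>insert a A. \<Sum>y\<in>insert a A - {x}. g x y)
      = (\<Sum>y\<in>A. g a y) + (\<Sum>x\<in>A. g x a) + (\<Sum>x\<in>A. \<Sum>y\<in>A - {x}. g x y)"
    using insert.hyps by (simp add: sum.distrib)
  moreover have "(\<Sum>x\<in>A. \<Sum>y\<in>A - {x}. g x y) = 0"
    by (rule insert.IH) (rule insert.prems, auto)
  moreover have "(\<Sum>x\<in>A. g x a) = - (\<Sum>y\<in>A. g a y)"
    unfolding sum_negf[symmetric] using insert.hyps by (intro sum.cong insert.prems) auto
  ultimately show ?case
    by simp
qed simp

lemma sum_fun_apply: "(\<Sum>i\<in>I. f i) x = (\<Sum>i\<in>I. f i x)"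
  for f :: "'i \<Rightarrow> 'b \<Rightarrow> 'a::comm_monoid_add"
  by (induction I rule: infinite_finite_induct) simp_all

locale koszul_ops =
  fixes X :: "'n::finite \<Rightarrow> 'a::ab_group_add \<Rightarrow> 'a"
  assumes X_add: "X x (u + v) = X x u + X x v"
    and X_commute: "X x (X y u) = X y (X x u)"
begin

lemma X_zero [simp]: "X x 0 = 0"
  using X_add[of x 0 0] by simp

lemma X_uminus: "X x (- u) = - X x u"
  using X_add[of x u "- u"] by (simp add: eq_neg_iff_add_eq_0 add.commute)

lemma X_diff: "X x (u - v) = X x u - X x v"
  using X_add[of x u "- v"] by (simp add: X_uminus)

lemma X_sum: "X x (sum f A) = (\<Sum>a\<in>A. X x (f a))"
  by (induction A rule: infinite_finite_induct) (simp_all add: X_add)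

lemma X_ksign: "X x (ksign y S u) = ksign y S (X x u)"
  by (simp add: ksign_def X_uminus)

lemma bd_add: "bd X (u + v) = bd X u + bd X v"
  by (rule ext) (simp add: bd_def X_add ksign_add sum.distrib)

lemma bd_diff: "bd X (u - v) = bd X u - bd X v"
  by (rule ext) (simp add: bd_def X_diff ksign_diff sum_subtractf)

lemma bd_zero [simp]: "bd X 0 = 0"
  by (rule ext) (simp add: bd_def)

lemma bd_sum: "bd X (sum f A) = (\<Sum>a\<in>A. bd X (f a))"
  by (induction A rule: infinite_finite_induct)
    (simp_all only: sum.infinite sum.empty sum.insert bd_zero bd_add not_False_eq_True)

lemma bd_bd [simp]: "bd X (bd X u) = 0"
proof
  fix S :: "'n set"
  define g where "g x y = ksign x S (ksign y (insert x S) (X x (X y (u (insert y (insert x S))))))" for x y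
  have "bd X (bd X u) S = (\<Sum>x\<in>-S. \<Sum>y\<in>-insert x S. g x y)"
    by (simp add: bd_def X_sum ksign_sum X_ksign g_def)
  also have "\<dots> = (\<Sum>x\<in>-S. \<Sum>y\<in>-S - {x}. g x y)"
    by (intro sum.cong) auto
  also have "\<dots> = 0"
  proof (rule sum_antisymmetric_eq_0)
    fix x y assume "x \<in> - S" "y \<in> - S" "x \<noteq> y"
    then show "g x y = - g y x"
      unfolding g_def
      by (subst ksign_anticommute) (simp_all add: X_commute[of x y] insert_commute)
  qed simp
  finally show "bd X (bd X u) S = 0 S"
    by simp
qed

lemma in_degree_bd:
  assumes "in_degree (Suc i) u"
  shows "in_degree i (bd X u)"
  unfolding in_degree_def
proof (intro allI impI)
  fix S :: "'n set" assume S: "card S \<noteq> i"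
  then have "u (insert x S) = 0" if "x \<in> - S" for x
    using assms that by (simp add: in_degree_def)
  then show "bd X u S = 0"
    by (simp add: bd_def)
qed

lemma bd_chains:
  assumes A: "graded_sub X A" and u: "u \<in> kchains A j"
  shows "bd X u \<in> kchains A j"
  unfolding kchains_def bd_def
proof (intro CollectI allI graded_sub_sum[OF A] graded_sub_ksign[OF A])
  fix S and x :: 'n assume "x \<in> - S"
  then have "u (insert x S) \<in> A (j - int (card S) - 1)"
    using u by (simp add: kchains_def) (metis card_insert_disjoint diff_diff_eq finite of_nat_Suc add.commute)
  from graded_subD(3)[OF A this, of x]
  show "X x (u (insert x S)) \<in> A (j - int (card S))"
    by simp
qed

text \<open>For \<open>\<delta> = id\<close> this says that \<open>e\<^sub>x \<and> _\<close> is a null-homotopy of multiplication by \<open>x\<close>. For a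
  division operator \<open>\<delta>\<close> on a polynomial ring it contracts the part of the complex whose
  multidegree involves \<open>x\<close>.\<close>

definition cone_op :: "('a \<Rightarrow> 'a) \<Rightarrow> 'n \<Rightarrow> ('n set \<Rightarrow> 'a) \<Rightarrow> 'n set \<Rightarrow> 'a"
  where "cone_op \<delta> x u = (\<lambda>S. if x \<in> S then ksign x S (\<delta> (u (S - {x}))) else 0)"

lemma cone_op_homotopy:
  assumes \<delta>: "\<And>u v. \<delta> (u + v) = \<delta> u + \<delta> v" and comm: "\<And>y u. y \<noteq> x \<Longrightarrow> \<delta> (X y u) = X y (\<delta> u)"
  shows "bd X (cone_op \<delta> x u) S + cone_op \<delta> x (bd X u) S = (if x \<in> S then \<delta> (X x (u S)) else X x (\<delta> (u S)))"
proof -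
  have \<delta>0: "\<delta> 0 = 0"
    using \<delta>[of 0 0] by simp
  have \<delta>m: "\<delta> (- u) = - \<delta> u" for u
    using \<delta>[of u "- u"] by (simp add: \<delta>0 eq_neg_iff_add_eq_0 add.commute)
  have \<delta>s: "\<delta> (sum f A) = (\<Sum>a\<in>A. \<delta> (f a))" for A and f :: "'n \<Rightarrow> 'a"
    by (induction A rule: infinite_finite_induct) (simp_all add: \<delta>0 \<delta>)
  have \<delta>k: "\<delta> (ksign y T u) = ksign y T (\<delta> u)" for y T u
    by (simp add: ksign_def \<delta>m)
  show ?thesis
  proof (cases "x \<in> S")
    case False
    have "bd X (cone_op \<delta> x u) S = (\<Sum>y\<in>-S. if y = x then X x (\<delta> (u S)) else 0)"
      unfolding bd_def cone_op_def using False
      by (intro sum.cong) (auto simp: X_ksign)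
    then show ?thesis
      using False by (simp add: cone_op_def)
  next
    case True
    define T where "T = S - {x}"
    have T: "S = insert x T" "x \<notin> T"
      using True by (auto simp: T_def)
    have eq: "insert y S - {x} = insert y T" if "y \<notin> S" for y
      using that T by auto
    have "bd X (cone_op \<delta> x u) S = (\<Sum>y\<in>-S. ksign y S (ksign x (insert y S) (X y (\<delta> (u (insert y T))))))"
      unfolding bd_def cone_op_def using True
      by (intro sum.cong) (auto simp: X_ksign eq)
    also have "\<dots> = (\<Sum>y\<in>-S. - ksign x S (ksign y T (X y (\<delta> (u (insert y T))))))"
    proof (rule sum.cong[OF refl])
      fix y assume y: "y \<in> - S"
      have "ksign y (insert x T) (ksign x (insert y (insert x T)) w) = - ksign x (insert x T) (ksign y T w)" for w :: 'a
      proof -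
        have "x \<noteq> y" "y \<notin> T"
          using y T by auto
        moreover from this have "idx x < idx y \<longleftrightarrow> \<not> idx y < idx x"
          using idx_inject[of x y] by linarith
        ultimately show ?thesis
          using T by (simp add: ksign_insert ksign_uminus insert_commute[of y x] ksign_commute[of x T y T])
      qed
      then show "ksign y S (ksign x (insert y S) (X y (\<delta> (u (insert y T))))) = - ksign x S (ksign y T (X y (\<delta> (u (insert y T)))))"
        by (simp add: T(1))
    qed
    finally have 1: "bd X (cone_op \<delta> x u) S = - (\<Sum>y\<in>-S. ksign x S (ksign y T (X y (\<delta> (u (insert y T))))))"
      by (simp add: sum_negf)
    have "- T = insert x (- S)" "x \<notin> - S"
      using T by auto
    then have "bd X u T = ksign x S (X x (u S)) + (\<Sum>y\<in>-S. ksign y T (X y (u (insert y T))))"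
      by (simp add: bd_def T(1))
    moreover have "cone_op \<delta> x (bd X u) S = ksign x S (\<delta> (bd X u T))"
      using True by (simp add: cone_op_def T_def)
    ultimately have "cone_op \<delta> x (bd X u) S
        = \<delta> (X x (u S)) + (\<Sum>y\<in>-S. ksign x S (ksign y T (\<delta> (X y (u (insert y T))))))"
      by (simp add: \<delta>s \<delta>k ksign_sum ksign_add \<delta>)
    also have "(\<Sum>y\<in>-S. ksign x S (ksign y T (\<delta> (X y (u (insert y T))))))
        = (\<Sum>y\<in>-S. ksign x S (ksign y T (X y (\<delta> (u (insert y T))))))"
      using True by (intro sum.cong refl) (metis ComplD comm)
    finally show ?thesis
      using 1 True by simp
  qed
qed

lemma in_degree_cone_op:
  assumes "\<delta> 0 = 0" "in_degree i u"
  shows "in_degree (Suc i) (cone_op \<delta> x u)"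
  unfolding in_degree_def cone_op_def
proof (intro allI impI)
  fix S :: "'n set" assume "card S \<noteq> Suc i"
  then have "x \<in> S \<Longrightarrow> card (S - {x}) \<noteq> i"
    by (metis card.remove finite)
  then show "(if x \<in> S then ksign x S (\<delta> (u (S - {x}))) else 0) = 0"
    using assms by (simp add: in_degree_def)
qed

lemma kchains_cone_op:
  assumes A: "graded_sub X A" and \<delta>: "\<And>i u. u \<in> A i \<Longrightarrow> \<delta> u \<in> A (i + e - 1)" and u: "u \<in> kchains A j"
  shows "cone_op \<delta> x u \<in> kchains A (j + e)"
  unfolding kchains_def cone_op_def
proof (intro CollectI allI)
  fix S :: "'n set"
  show "(if x \<in> S then ksign x S (\<delta> (u (S - {x}))) else 0) \<in> A (j + e - int (card S))"
  proof (cases "x \<in> S")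
    case True
    then have "int (card S) = 1 + int (card (S - {x}))"
      by (metis card.remove finite of_nat_Suc)
    moreover have "u (S - {x}) \<in> A (j - int (card (S - {x})))"
      using u by (simp add: kchains_def)
    ultimately have "\<delta> (u (S - {x})) \<in> A (j + e - int (card S))"
      using \<delta>[of "u (S - {x})" "j - int (card (S - {x}))"] by (simp add: algebra_simps)
    then show ?thesis
      using True graded_sub_ksign[OF A] by simp
  qed (simp add: graded_subD(1)[OF A])
qed

text \<open>The contractions for the individual variables are applied one after the other. What is left
  of a cycle lives in multidegree 0, hence in homological degree 0.\<close>

lemma koszul_exact_if_divisible:
  assumes A: "graded_sub X A"
    and \<delta>_add: "\<And>x u v. \<delta> x (u + v) = \<delta> x u + \<delta> x v"
    and \<delta>_comm: "\<And>x y u. y \<noteq> x \<Longrightarrow> \<delta> x (X y u) = X y (\<delta> x u)"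
    and \<delta>_X: "\<And>x u. \<delta> x (X x u) = u"
    and \<delta>_deg: "\<And>x i u. u \<in> A i \<Longrightarrow> \<delta> x u \<in> A (i - 1)"
  shows "koszul_exact X A (\<lambda>_. {0}) (Suc i) j"
  unfolding koszul_exact_def
proof (intro ballI impI)
  fix u assume u: "u \<in> kchains A j" "in_degree (Suc i) u" "bd X u \<in> kchains (\<lambda>_. {0}) j"
  then have bdu: "bd X u = 0"
    by (auto simp: kchains_def)
  have \<delta>0: "\<delta> x 0 = 0" for x
    using \<delta>_add[of x 0 0] by simp
  \<comment> \<open>Modulo boundaries, \<open>u\<close> can be made to vanish on all exterior monomials that involve a variable
    from \<open>V\<close>.\<close>
  have "\<exists>w. w \<in> kchains A j \<and> in_degree (Suc (Suc i)) w \<and> (\<forall>S. S \<inter> V \<noteq> {} \<longrightarrow> (u - bd X w) S = 0)"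
    if "finite V" for V
    using that
  proof (induction V)
    case empty
    show ?case
      by (intro exI[of _ 0] conjI) (rule kchains_zero[OF A], simp_all add: in_degree_def)
  next
    case (insert x V)
    then obtain w where w: "w \<in> kchains A j" "in_degree (Suc (Suc i)) w"
      and V: "\<And>S. S \<inter> V \<noteq> {} \<Longrightarrow> (u - bd X w) S = 0"
      by blast
    define r where "r = u - bd X w"
    have bdr: "bd X r = 0"
      by (simp add: r_def bd_diff bdu)
    have r: "r \<in> kchains A j" "in_degree (Suc i) r"
      using u w by (auto simp: r_def intro!: kchains_diff[OF A] bd_chains[OF A] in_degree_diff in_degree_bd)
    define z where "z = cone_op (\<delta> x) x r"
    have z: "z \<in> kchains A j" "in_degree (Suc (Suc i)) z"
      using kchains_cone_op[OF A _ r(1), of "\<delta> x" 0] \<delta>_deg in_degree_cone_op[OF _ r(2), of "\<delta> x"] \<delta>0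
      by (auto simp: z_def)
    have bdz: "bd X z S = (if x \<in> S then r S else X x (\<delta> x (r S)))" for S
    proof -
      have "cone_op (\<delta> x) x 0 S = 0"
        by (simp add: cone_op_def \<delta>0)
      then show ?thesis
        using cone_op_homotopy[of "\<delta> x" x r S, OF \<delta>_add \<delta>_comm] by (simp add: bdr z_def \<delta>_X)
    qed
    show ?case
    proof (intro exI conjI allI impI)
      show "w + z \<in> kchains A j" "in_degree (Suc (Suc i)) (w + z)"
        using w z by (auto intro: kchains_add[OF A] in_degree_add)
      fix S assume "S \<inter> insert x V \<noteq> {}"
      then consider "x \<in> S" | "S \<inter> V \<noteq> {}" by auto
      then have "r S - bd X z S = 0"
        by cases (use V[of S] in \<open>simp_all add: bdz r_def[symmetric] \<delta>0\<close>)
      then show "(u - bd X (w + z)) S = 0"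
        by (simp add: bd_add r_def algebra_simps)
    qed
  qed
  from this[of UNIV] obtain w where w: "w \<in> kchains A j" "in_degree (Suc (Suc i)) w"
    and V: "\<And>S. S \<noteq> {} \<Longrightarrow> (u - bd X w) S = 0"
    by auto
  have "in_degree (Suc i) (u - bd X w)"
    using u w by (auto intro!: in_degree_diff in_degree_bd)
  then have "(u - bd X w) {} = 0"
    unfolding in_degree_def by (metis card.empty nat.distinct(1))
  with V have "u - bd X w = 0"
    by (metis ext zero_fun_apply)
  with w show "\<exists>w\<in>kchains A j. in_degree (Suc (Suc i)) w \<and> u - bd X w \<in> kchains (\<lambda>_. {0}) j"
    by (intro bexI[of _ w]) (auto simp: kchains_def)
qed

text \<open>The next two lemmas are portions of the long exact sequence of
  \<open>0 \<rightarrow> B/C \<rightarrow> A/C \<rightarrow> A/B \<rightarrow> 0\<close>.\<close>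

lemma koszul_exact_submodule:
  assumes sub: "graded_sub X A" "graded_sub X B" "graded_sub X C"
    and CB: "\<And>j. C j \<subseteq> B j" and BA: "\<And>j. B j \<subseteq> A j"
    and AC: "koszul_exact X A C i j" and AB: "koszul_exact X A B (Suc i) j"
  shows "koszul_exact X B C i j"
  unfolding koszul_exact_def
proof (intro ballI impI)
  fix u assume u: "u \<in> kchains B j" "in_degree i u" "bd X u \<in> kchains C j"
  obtain w where w: "w \<in> kchains A j" "in_degree (Suc i) w" "u - bd X w \<in> kchains C j"
    using koszul_exactD[OF AC kchains_mono[OF BA u(1)] u(2,3)] by blast
  have "u - (u - bd X w) \<in> kchains B j"
    by (intro kchains_diff[OF sub(2)] u kchains_mono[OF CB w(3)])
  then obtain z where z: "z \<in> kchains A j" "in_degree (Suc (Suc i)) z" "w - bd X z \<in> kchains B j"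
    using koszul_exactD[OF AB w(1,2)] by auto
  show "\<exists>w\<in>kchains B j. in_degree (Suc i) w \<and> u - bd X w \<in> kchains C j"
    using z w by (intro bexI[of _ "w - bd X z"]) (auto simp: bd_diff intro: in_degree_diff in_degree_bd)
qed

lemma koszul_exact_quotient:
  assumes sub: "graded_sub X A" "graded_sub X B" "graded_sub X C"
    and CB: "\<And>j. C j \<subseteq> B j" and BA: "\<And>j. B j \<subseteq> A j"
    and AC: "koszul_exact X A C (Suc i) j" and BC: "koszul_exact X B C i j"
  shows "koszul_exact X A B (Suc i) j"
  unfolding koszul_exact_def
proof (intro ballI impI)
  fix u assume u: "u \<in> kchains A j" "in_degree (Suc i) u" "bd X u \<in> kchains B j"
  have "bd X (bd X u) \<in> kchains C j"
    by (simp add: kchains_zero[OF sub(3)])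
  then obtain w where w: "w \<in> kchains B j" "in_degree (Suc i) w" "bd X u - bd X w \<in> kchains C j"
    using koszul_exactD[OF BC u(3) in_degree_bd[OF u(2)]] by blast
  have "u - w \<in> kchains A j" "in_degree (Suc i) (u - w)" "bd X (u - w) \<in> kchains C j"
    using u w kchains_mono[OF BA w(1)] by (auto simp: bd_diff intro: kchains_diff[OF sub(1)] in_degree_diff)
  then obtain z where z: "z \<in> kchains A j" "in_degree (Suc (Suc i)) z" "u - w - bd X z \<in> kchains C j"
    using koszul_exactD[OF AC] by blast
  have "w + (u - w - bd X z) \<in> kchains B j"
    by (intro kchains_add[OF sub(2)] w kchains_mono[OF CB z(3)])
  then show "\<exists>w\<in>kchains A j. in_degree (Suc (Suc i)) w \<and> u - bd X w \<in> kchains B j"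
    using z by (intro bexI[of _ z]) (auto simp: algebra_simps)
qed

lemma koszul_exact_0_iff:
  assumes A: "graded_sub X A" and C: "graded_sub X C"
  shows "koszul_exact X A C 0 j \<longleftrightarrow>
    (\<forall>u\<in>A j. \<exists>v. (\<forall>x. v x \<in> A (j - 1)) \<and> u - (\<Sum>x\<in>UNIV. X x (v x)) \<in> C j)" (is "_ \<longleftrightarrow> ?R")
proof
  assume E: "koszul_exact X A C 0 j"
  show ?R
  proof
    fix u assume "u \<in> A j"
    then have c: "(\<lambda>S. if S = {} then u else 0) \<in> kchains A j" (is "?u \<in> _")
      by (auto simp: kchains_def graded_subD(1)[OF A])
    have d: "in_degree 0 ?u"
      by (simp add: in_degree_def)
    have "bd X ?u \<in> kchains C j"
      by (simp add: bd_in_degree_0[where X = X, OF X_zero d] kchains_zero[OF C])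
    then obtain w where w: "w \<in> kchains A j" "?u - bd X w \<in> kchains C j"
      using koszul_exactD[OF E c d] by blast
    have "w {x} \<in> A (j - 1)" for x
      using w(1) by (auto simp: kchains_def dest!: spec[of _ "{x}"])
    moreover have "u - (\<Sum>x\<in>UNIV. X x (w {x})) \<in> C j"
      using w(2) by (auto simp: kchains_def bd_def dest!: spec[of _ "{}"])
    ultimately show "\<exists>v. (\<forall>x. v x \<in> A (j - 1)) \<and> u - (\<Sum>x\<in>UNIV. X x (v x)) \<in> C j"
      by (intro exI[of _ "\<lambda>x. w {x}"]) auto
  qed
next
  assume R: ?R
  show "koszul_exact X A C 0 j"
    unfolding koszul_exact_def
  proof (intro ballI impI)
    fix u :: "'n set \<Rightarrow> 'a" assume u: "u \<in> kchains A j" "in_degree 0 u"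
    then have "u {} \<in> A j"
      by (auto simp: kchains_def dest!: spec[of _ "{}"])
    with R obtain v where v: "\<And>x. v x \<in> A (j - 1)" "u {} - (\<Sum>x\<in>UNIV. X x (v x)) \<in> C j"
      by blast
    define w where "w S = (if card S = 1 then v (the_elem S) else 0)" for S
    have wd: "in_degree (Suc 0) w"
      by (simp add: w_def in_degree_def)
    have "u - bd X w \<in> kchains C j"
      unfolding kchains_def
    proof (intro CollectI allI)
      fix S :: "'n set"
      show "(u - bd X w) S \<in> C (j - int (card S))"
      proof (cases "S = {}")
        case True
        then show ?thesis using v by (simp add: bd_def w_def)
      next
        case False
        then have "card S \<noteq> 0" by simp
        then have "(u - bd X w) S = 0"
          using u in_degree_bd[OF wd] by (simp add: in_degree_def del: card_0_eq)
        then show ?thesis by (simp add: graded_subD(1)[OF C])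
      qed
    qed
    moreover have "w \<in> kchains A j"
      using v by (auto simp: w_def kchains_def graded_subD(1)[OF A])
    ultimately show "\<exists>w\<in>kchains A j. in_degree (Suc 0) w \<and> u - bd X w \<in> kchains C j"
      using wd by blast
  qed
qed

end

text \<open>Koszul homology only depends on the quotient. This identifies a module with a free module modulo
  its syzygies.\<close>

lemma koszul_exact_iso:
  assumes X: "koszul_ops X" and Y: "koszul_ops Y"
    and A: "graded_sub X A"
    and \<pi>_add: "\<And>u v. \<pi> (u + v) = \<pi> u + \<pi> v" and \<pi>_X: "\<And>x u. \<pi> (X x u) = Y x (\<pi> u)"
    and surj: "\<And>j. \<pi> ` A j = N j" and ker: "\<And>j. Z j = {u \<in> A j. \<pi> u = 0}"
  shows "koszul_exact X A Z i j \<longleftrightarrow> koszul_exact Y N (\<lambda>_. {0}) i j"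
proof -
  interpret X: koszul_ops X by (rule X)
  interpret Y: koszul_ops Y by (rule Y)
  have \<pi>0 [simp]: "\<pi> 0 = 0"
    using \<pi>_add[of 0 0] by simp
  have \<pi>m: "\<pi> (- u) = - \<pi> u" for u
    using \<pi>_add[of u "- u"] by (simp add: eq_neg_iff_add_eq_0 add.commute)
  have \<pi>d: "\<pi> (u - v) = \<pi> u - \<pi> v" for u v
    using \<pi>_add[of u "- v"] by (simp add: \<pi>m)
  have \<pi>s: "\<pi> (sum f S) = (\<Sum>a\<in>S. \<pi> (f a))" for S and f :: "'a \<Rightarrow> 'b"
    by (induction S rule: infinite_finite_induct) (simp_all add: \<pi>_add)
  have \<pi>k: "\<pi> (ksign x S u) = ksign x S (\<pi> u)" for x S u
    by (simp add: ksign_def \<pi>m)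
  have \<pi>bd: "\<pi> (bd X u S) = bd Y (\<lambda>S. \<pi> (u S)) S" for u S
    by (simp add: bd_def \<pi>s \<pi>k \<pi>_X)
  have lift: "\<exists>u. u \<in> kchains A j \<and> in_degree i u \<and> (\<lambda>S. \<pi> (u S)) = v"
    if v: "v \<in> kchains N j" "in_degree i v" for v i
  proof -
    have "\<forall>S. \<exists>a. a \<in> A (j - int (card S)) \<and> \<pi> a = v S \<and> (card S \<noteq> i \<longrightarrow> a = 0)"
    proof
      fix S
      have "v S \<in> \<pi> ` A (j - int (card S))"
        using v surj by (simp add: kchains_def)
      then obtain a where "a \<in> A (j - int (card S))" "\<pi> a = v S" by auto
      then show "\<exists>a. a \<in> A (j - int (card S)) \<and> \<pi> a = v S \<and> (card S \<noteq> i \<longrightarrow> a = 0)"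
        using v(2) graded_subD(1)[OF A] by (intro exI[of _ "if card S \<noteq> i then 0 else a"]) (auto simp: in_degree_def)
    qed
    then obtain u where "\<forall>S. u S \<in> A (j - int (card S)) \<and> \<pi> (u S) = v S \<and> (card S \<noteq> i \<longrightarrow> u S = 0)"
      by metis
    then show ?thesis
      by (intro exI[of _ u]) (auto simp: kchains_def in_degree_def)
  qed
  have push: "(\<lambda>S. \<pi> (u S)) \<in> kchains N j \<and> in_degree i (\<lambda>S. \<pi> (u S))"
    if "u \<in> kchains A j" "in_degree i u" for u i
    using that by (auto simp: kchains_def in_degree_def surj[symmetric])
  have Zc: "u \<in> kchains Z j \<longleftrightarrow> (\<lambda>S. \<pi> (u S)) \<in> kchains (\<lambda>_. {0}) j" if "u \<in> kchains A j" for u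
    using that ker by (auto simp: kchains_def)
  have bdA: "bd X u \<in> kchains A j" if "u \<in> kchains A j" for u
    using X.bd_chains[OF A that] .
  show ?thesis
  proof
    assume E: "koszul_exact X A Z i j"
    show "koszul_exact Y N (\<lambda>_. {0}) i j"
      unfolding koszul_exact_def
    proof (intro ballI impI)
      fix v assume v: "v \<in> kchains N j" "in_degree i v" "bd Y v \<in> kchains (\<lambda>_. {0}) j"
      obtain u where u: "u \<in> kchains A j" "in_degree i u" and uv: "(\<lambda>S. \<pi> (u S)) = v"
        using lift v by blast
      have "bd X u \<in> kchains Z j"
        using v(3) Zc[OF bdA[OF u(1)]] by (simp add: \<pi>bd uv)
      then obtain w where w: "w \<in> kchains A j" "in_degree (Suc i) w" "u - bd X w \<in> kchains Z j"
        using koszul_exactD[OF E u] by blast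
      then have "(\<lambda>S. \<pi> ((u - bd X w) S)) \<in> kchains (\<lambda>_. {0}) j"
        using Zc[OF kchains_diff[OF A u(1) bdA[OF w(1)]]] by simp
      then have "v - bd Y (\<lambda>S. \<pi> (w S)) \<in> kchains (\<lambda>_. {0}) j"
        by (simp add: \<pi>d \<pi>bd uv[symmetric] fun_diff_def)
      then show "\<exists>w\<in>kchains N j. in_degree (Suc i) w \<and> v - bd Y w \<in> kchains (\<lambda>_. {0}) j"
        using push[OF w(1,2)] by blast
    qed
  next
    assume E: "koszul_exact Y N (\<lambda>_. {0}) i j"
    show "koszul_exact X A Z i j"
      unfolding koszul_exact_def
    proof (intro ballI impI)
      fix u assume u: "u \<in> kchains A j" "in_degree i u" "bd X u \<in> kchains Z j"
      then have "bd Y (\<lambda>S. \<pi> (u S)) \<in> kchains (\<lambda>_. {0}) j"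
        using Zc[OF bdA[OF u(1)]] by (simp add: \<pi>bd)
      then obtain v where v: "v \<in> kchains N j" "in_degree (Suc i) v"
        and uv: "(\<lambda>S. \<pi> (u S)) - bd Y v \<in> kchains (\<lambda>_. {0}) j"
        using koszul_exactD[OF E] push[OF u(1,2)] by blast
      obtain w where w: "w \<in> kchains A j" "in_degree (Suc i) w" and wv: "(\<lambda>S. \<pi> (w S)) = v"
        using lift v by blast
      have "(\<lambda>S. \<pi> ((u - bd X w) S)) \<in> kchains (\<lambda>_. {0}) j"
        using uv by (simp add: \<pi>d \<pi>bd wv fun_diff_def)
      then have "u - bd X w \<in> kchains Z j"
        using Zc[OF kchains_diff[OF A u(1) bdA[OF w(1)]]] by simp
      with w show "\<exists>w\<in>kchains A j. in_degree (Suc i) w \<and> u - bd X w \<in> kchains Z j"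
        by blast
    qed
  qed
qed

section \<open>Koszul homology of quotients by a sequence of forms\<close>

text \<open>The module is not required to be the direct sum of its homogeneous components, so that free
  modules can be modelled by functions into the polynomial ring.\<close>

locale pregraded_module = Modules.module scale
  for scale :: "('n::finite, 'k::field) mpoly \<Rightarrow> 'm::ab_group_add \<Rightarrow> 'm" +
  fixes gr :: "int \<Rightarrow> 'm set"
  assumes gr_zero: "0 \<in> gr j"
    and gr_diff: "x \<in> gr j \<Longrightarrow> y \<in> gr j \<Longrightarrow> x - y \<in> gr j"
    and gr_scale: "p \<in> forms i \<Longrightarrow> x \<in> gr j \<Longrightarrow> scale p x \<in> gr (i + j)"
begin

abbreviation X :: "'n \<Rightarrow> 'm \<Rightarrow> 'm"
  where "X x \<equiv> scale (var x)"

sublocale koszul_ops X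
  by standard (simp_all add: scale_right_distrib mult.commute)

definition submod :: "(int \<Rightarrow> 'm set) \<Rightarrow> bool"
  where "submod B \<longleftrightarrow> (\<forall>j. B j \<subseteq> gr j \<and> 0 \<in> B j \<and> (\<forall>u\<in>B j. \<forall>v\<in>B j. u - v \<in> B j)) \<and>
    (\<forall>i j. \<forall>p\<in>forms i. \<forall>u\<in>B j. scale p u \<in> B (i + j))"

lemma submodD:
  assumes "submod B"
  shows "graded_sub X B" "u \<in> B j \<Longrightarrow> u \<in> gr j" "p \<in> forms i \<Longrightarrow> u \<in> B j \<Longrightarrow> scale p u \<in> B (i + j)"
proof -
  show "p \<in> forms i \<Longrightarrow> u \<in> B j \<Longrightarrow> scale p u \<in> B (i + j)" for p i u j
    using assms by (auto simp: submod_def)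
  have "X x u \<in> B (j + 1)" if "u \<in> B j" for x u j
  proof -
    have "X x u \<in> B (1 + j)"
      using assms that var_forms by (auto simp: submod_def)
    then show ?thesis
      by (simp add: add.commute)
  qed
  then show "graded_sub X B"
    using assms by (auto simp: submod_def graded_sub_def)
  show "u \<in> B j \<Longrightarrow> u \<in> gr j"
    using assms by (auto simp: submod_def)
qed

lemma submod_gr: "submod gr"
  by (auto simp: submod_def gr_zero gr_diff gr_scale)

lemma submod_zero: "submod (\<lambda>_. {0})"
  by (auto simp: submod_def gr_zero)

lemmas submod_graded_sub = submodD(1)
lemmas gr_sub = submodD(1)[OF submod_gr]

abbreviation acyclic_mod :: "(int \<Rightarrow> 'm set) \<Rightarrow> nat \<Rightarrow> int \<Rightarrow> bool"
  where "acyclic_mod B \<equiv> koszul_exact X gr B"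

definition adjoin :: "('n, 'k) mpoly \<Rightarrow> int \<Rightarrow> (int \<Rightarrow> 'm set) \<Rightarrow> int \<Rightarrow> 'm set"
  where "adjoin f d B j = {scale f a + b | a b. a \<in> gr (j - d) \<and> b \<in> B j}"

lemma adjoin_subset: "B j \<subseteq> adjoin f d B j"
proof
  fix b assume "b \<in> B j"
  then show "b \<in> adjoin f d B j"
    unfolding adjoin_def by (intro CollectI exI[of _ 0] exI[of _ b]) (simp add: gr_zero)
qed

lemma kchains_adjoin_mono: "u \<in> kchains B j \<Longrightarrow> u \<in> kchains (adjoin f d B) j"
  unfolding kchains_def using subsetD[OF adjoin_subset] by blast

lemma submod_adjoin:
  assumes B: "submod B" and f: "f \<in> forms d"
  shows "submod (adjoin f d B)"
  unfolding submod_def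
proof (intro conjI allI ballI subsetI)
  note b = submod_graded_sub[OF B]
  fix j
  show "0 \<in> adjoin f d B j"
    using adjoin_subset[of B j f d] graded_subD(1)[OF b] by blast
  show "u \<in> gr j" if "u \<in> adjoin f d B j" for u
    using that gr_scale[OF f] submodD(2)[OF B]
    by (auto simp: adjoin_def intro!: graded_subD(5)[OF gr_sub]) (metis add.commute diff_add_cancel)
  show "u - v \<in> adjoin f d B j" if "u \<in> adjoin f d B j" "v \<in> adjoin f d B j" for u v
  proof -
    obtain a b a' b' where "u = scale f a + b" "v = scale f a' + b'"
      "a \<in> gr (j - d)" "a' \<in> gr (j - d)" "b \<in> B j" "b' \<in> B j"
      using \<open>u \<in> _\<close> \<open>v \<in> _\<close> by (auto simp: adjoin_def)
    then show ?thesis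
      unfolding adjoin_def using gr_diff graded_subD(2)[OF b]
      by (intro CollectI exI[of _ "a - a'"] exI[of _ "b - b'"]) (simp add: scale_right_diff_distrib)
  qed
  show "scale p u \<in> adjoin f d B (i + j)" if "p \<in> forms i" "u \<in> adjoin f d B j" for p u i
  proof -
    obtain a b where "u = scale f a + b" "a \<in> gr (j - d)" "b \<in> B j"
      using \<open>u \<in> _\<close> by (auto simp: adjoin_def)
    moreover from this have "scale p a \<in> gr (i + j - d)" "scale p b \<in> B (i + j)"
      using gr_scale[OF that(1), of a "j - d"] submodD(3)[OF B that(1), of b j] by (simp_all add: algebra_simps)
    moreover from calculation have "scale p u = scale f (scale p a) + scale p b"
      by (simp add: scale_right_distrib mult.commute)
    ultimately show ?thesis
      unfolding adjoin_def by blast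
  qed
qed

definition inj_mod :: "('n, 'k) mpoly \<Rightarrow> int \<Rightarrow> (int \<Rightarrow> 'm set) \<Rightarrow> int \<Rightarrow> bool"
  where "inj_mod f d B j \<longleftrightarrow> (\<forall>u\<in>gr j. scale f u \<in> B (j + d) \<longrightarrow> u \<in> B j)"

lemma scale_ksign: "scale p (ksign x S u) = ksign x S (scale p u)"
  by (simp add: ksign_def)

lemma bd_scale: "bd X (\<lambda>S. scale p (u S)) = (\<lambda>S. scale p (bd X u S))"
  by (rule ext) (simp add: bd_def scale_sum_right scale_ksign mult.commute)

lemma kchains_scale:
  assumes "submod B" "p \<in> forms i" "u \<in> kchains B j"
  shows "(\<lambda>S. scale p (u S)) \<in> kchains B (j + i)"
  unfolding kchains_def
proof (intro CollectI allI)
  fix S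
  have "u S \<in> B (j - int (card S))"
    using assms(3) by (simp add: kchains_def)
  from submodD(3)[OF assms(1,2) this] show "scale p (u S) \<in> B (j + i - int (card S))"
    by (simp add: algebra_simps)
qed

lemma in_degree_scale: "in_degree i u \<Longrightarrow> in_degree i (\<lambda>S. scale p (u S))"
  by (simp add: in_degree_def)

lemma kchains_adjoinE:
  assumes B: "submod B" and y: "y \<in> kchains (adjoin f d B) j" "in_degree i y"
  obtains a b where "a \<in> kchains gr (j - d)" "in_degree i a" "b \<in> kchains B j" "in_degree i b"
    "y = (\<lambda>S. scale f (a S)) + b"
proof -
  have "\<forall>S. \<exists>a b. a \<in> gr (j - d - int (card S)) \<and> b \<in> B (j - int (card S)) \<and> y S = scale f a + b \<and>
    (card S \<noteq> i \<longrightarrow> a = 0 \<and> b = 0)"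
  proof
    fix S
    show "\<exists>a b. a \<in> gr (j - d - int (card S)) \<and> b \<in> B (j - int (card S)) \<and> y S = scale f a + b \<and>
      (card S \<noteq> i \<longrightarrow> a = 0 \<and> b = 0)"
    proof (cases "card S = i")
      case True
      have "y S \<in> adjoin f d B (j - int (card S))"
        using y(1) by (simp add: kchains_def)
      then show ?thesis
        using True by (auto simp: adjoin_def algebra_simps)
    next
      case False
      then show ?thesis
        using y(2) graded_subD(1)[OF submod_graded_sub[OF B]]
        by (intro exI[of _ 0]) (simp add: in_degree_def gr_zero)
    qed
  qed
  then obtain a b where "\<forall>S. a S \<in> gr (j - d - int (card S)) \<and> b S \<in> B (j - int (card S)) \<and>
      y S = scale f (a S) + b S \<and> (card S \<noteq> i \<longrightarrow> a S = 0 \<and> b S = 0)"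
    by metis
  then show thesis
    by (intro that[of a b]) (auto simp: kchains_def in_degree_def)
qed

lemma kchains_adjoinI:
  assumes "a \<in> kchains gr (j - d)" "b \<in> kchains B j"
  shows "(\<lambda>S. scale f (a S)) + b \<in> kchains (adjoin f d B) j"
  using assms by (force simp: kchains_def adjoin_def algebra_simps)

lemma inj_mod_kchains:
  assumes B: "submod B" and inj: "inj_mod f d B (j - int i)"
    and u: "u \<in> kchains gr j" "in_degree i u" and fu: "(\<lambda>S. scale f (u S)) \<in> kchains B (j + d)"
  shows "u \<in> kchains B j"
  unfolding kchains_def
proof (intro CollectI allI)
  fix S
  show "u S \<in> B (j - int (card S))"
  proof (cases "card S = i")
    case True
    then have "u S \<in> gr (j - int i)" "scale f (u S) \<in> B (j - int i + d)"
      using u(1) fu by (auto simp: kchains_def algebra_simps)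
    then show ?thesis
      using inj True by (simp add: inj_mod_def)
  next
    case False
    then show ?thesis
      using u(2) graded_subD(1)[OF submod_graded_sub[OF B]] by (simp add: in_degree_def)
  qed
qed

text \<open>With \<open>N = M/B\<close> and \<open>T\<close> the kernel of \<open>f\<close> on \<open>N\<close>, the homology of \<open>N/fN\<close> is controlled by
  that of \<open>N\<close> in the same and in the preceding homological degree, provided \<open>T\<close> vanishes in one
  degree.\<close>

lemma acyclic_adjoin:
  assumes B: "submod B" and f: "f \<in> forms d"
    and inj: "i > 0 \<Longrightarrow> inj_mod f d B (j - d - int i + 1)"
    and 1: "acyclic_mod B i (j - d)" and 2: "acyclic_mod B (Suc i) j"
  shows "acyclic_mod (adjoin f d B) (Suc i) j"
  unfolding koszul_exact_def
proof (intro ballI impI)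
  note b = submod_graded_sub[OF B]
  fix u assume u: "u \<in> kchains gr j" "in_degree (Suc i) u" "bd X u \<in> kchains (adjoin f d B) j"
  obtain a c where a: "a \<in> kchains gr (j - d)" "in_degree i a" and c: "c \<in> kchains B j" "in_degree i c"
    and bdu: "bd X u = (\<lambda>S. scale f (a S)) + c"
    using kchains_adjoinE[OF B u(3) in_degree_bd[OF u(2)]] by blast
  have "bd X ((\<lambda>S. scale f (a S)) + c) = 0"
    using bdu bd_bd by metis
  then have eq: "(\<lambda>S. scale f (bd X a S)) = - bd X c"
    by (simp add: bd_add bd_scale eq_neg_iff_add_eq_0)
  have bda: "bd X a \<in> kchains B (j - d)"
  proof (cases i)
    case 0
    then have "bd X a = 0"
      using bd_in_degree_0[where X = X, OF X_zero] a(2) by simp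
    then show ?thesis
      by (simp only: kchains_zero[OF b])
  next
    case (Suc i')
    show ?thesis
    proof (rule inj_mod_kchains[OF B])
      show "inj_mod f d B (j - d - int i')"
        using inj Suc by (simp add: algebra_simps)
      show "bd X a \<in> kchains gr (j - d)" "in_degree i' (bd X a)"
        using a Suc bd_chains[OF gr_sub] in_degree_bd by blast+
      show "(\<lambda>S. scale f (bd X a S)) \<in> kchains B (j - d + d)"
        unfolding eq using kchains_uminus[OF b bd_chains[OF b c(1)]] by simp
    qed
  qed
  then obtain a' where a': "a' \<in> kchains gr (j - d)" "in_degree (Suc i) a'" "a - bd X a' \<in> kchains B (j - d)"
    using koszul_exactD[OF 1 a] by blast
  define v where "v = u - (\<lambda>S. scale f (a' S))"
  have "(\<lambda>S. scale f (a' S)) \<in> kchains gr (j - d + d)"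
    by (rule kchains_scale[OF submod_gr f a'(1)])
  then have v: "v \<in> kchains gr j" "in_degree (Suc i) v"
    unfolding v_def using u(1,2) a'(2) by (auto intro!: kchains_diff[OF gr_sub] in_degree_diff in_degree_scale)
  have "bd X v = (\<lambda>S. scale f ((a - bd X a') S)) + c"
    unfolding v_def bd_diff bdu bd_scale by (rule ext) (simp add: scale_right_diff_distrib)
  moreover have "(\<lambda>S. scale f ((a - bd X a') S)) \<in> kchains B (j - d + d)"
    by (rule kchains_scale[OF B f a'(3)])
  ultimately have "bd X v \<in> kchains B j"
    using c by (auto intro: kchains_add[OF b])
  then obtain w where w: "w \<in> kchains gr j" "in_degree (Suc (Suc i)) w" "v - bd X w \<in> kchains B j"
    using koszul_exactD[OF 2 v] by blast
  have "u - bd X w = (\<lambda>S. scale f (a' S)) + (v - bd X w)"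
    by (simp add: v_def)
  with kchains_adjoinI[OF a'(1) w(3), of f] have "u - bd X w \<in> kchains (adjoin f d B) j"
    by (simp only:)
  then show "\<exists>w\<in>kchains gr j. in_degree (Suc (Suc i)) w \<and> u - bd X w \<in> kchains (adjoin f d B) j"
    using w by blast
qed

lemma acyclic_adjoin_0:
  assumes "acyclic_mod B 0 j" "submod B"
  shows "acyclic_mod (adjoin f d B) 0 j"
  unfolding koszul_exact_def
proof (intro ballI impI)
  fix u :: "'n set \<Rightarrow> 'm" assume u: "u \<in> kchains gr j" "in_degree 0 u"
  have "bd X u \<in> kchains B j"
    using kchains_zero[OF submod_graded_sub[OF assms(2)]] bd_in_degree_0[where X = X, OF X_zero u(2)] by (simp only:)
  then obtain w where w: "w \<in> kchains gr j" "in_degree (Suc 0) w" "u - bd X w \<in> kchains B j"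
    using koszul_exactD[OF assms(1) u] by blast
  then show "\<exists>w\<in>kchains gr j. in_degree (Suc 0) w \<and> u - bd X w \<in> kchains (adjoin f d B) j"
    using kchains_adjoin_mono by blast
qed

text \<open>A form of positive degree is a combination of the variables, each of which acts on the
  Koszul complex by a null-homotopic map.\<close>

lemma scale_null_homotopic:
  assumes B: "submod B" and f: "f \<in> forms d" "d \<ge> 1"
    and u: "u \<in> kchains gr j" "in_degree i u" "bd X u \<in> kchains B j"
  obtains w where "w \<in> kchains gr (j + d)" "in_degree (Suc i) w"
    "(\<lambda>S. scale f (u S)) - bd X w \<in> kchains B (j + d)"
proof -
  obtain g where fg: "f = (\<Sum>x\<in>UNIV. var x * g x)" and g: "\<And>x. g x \<in> forms (d - 1)"
    using form_eq_sum_var[OF f] by blast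
  define h where "h x = cone_op id x u" for x :: 'n
  define h' where "h' x = cone_op id x (bd X u)" for x :: 'n
  have h: "h x \<in> kchains gr (j + 1)" "in_degree (Suc i) (h x)" for x
    unfolding h_def using kchains_cone_op[OF gr_sub _ u(1), of id 1] in_degree_cone_op[OF _ u(2), of id] by auto
  have h': "h' x \<in> kchains B (j + 1)" for x
    unfolding h'_def using kchains_cone_op[OF submod_graded_sub[OF B] _ u(3), of id 1] by auto
  have hom: "bd X (h x) S + h' x S = scale (var x) (u S)" for x S
    unfolding h_def h'_def by (subst cone_op_homotopy) auto
  define w where "w = (\<lambda>S. \<Sum>x\<in>UNIV. scale (g x) (h x S))"
  have w_eq: "w = (\<Sum>x\<in>UNIV. (\<lambda>S. scale (g x) (h x S)))"
    by (rule ext) (simp add: w_def sum_fun_apply)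
  have bdw: "bd X w S = (\<Sum>x\<in>UNIV. scale (g x) (bd X (h x) S))" for S
    unfolding w_eq bd_sum by (simp add: bd_scale sum_fun_apply)
  show thesis
  proof (rule that)
    have "scale (g x) (h x S) \<in> gr (j + d - int (card S))" for x S
      using kchains_scale[OF submod_gr g h(1), of x x] by (simp add: kchains_def)
    then show "w \<in> kchains gr (j + d)"
      unfolding kchains_def w_def by (auto intro: graded_sub_sum[OF gr_sub])
    show "in_degree (Suc i) w"
      using h(2) by (simp add: in_degree_def w_def)
    have "(\<lambda>S. scale f (u S)) - bd X w = (\<lambda>S. \<Sum>x\<in>UNIV. scale (g x) (h' x S))"
    proof (rule ext)
      fix S
      have "scale f (u S) = (\<Sum>x\<in>UNIV. scale (g x) (scale (var x) (u S)))"
        by (simp add: fg scale_sum_left mult.commute)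
      also have "\<dots> = (\<Sum>x\<in>UNIV. scale (g x) (bd X (h x) S)) + (\<Sum>x\<in>UNIV. scale (g x) (h' x S))"
        by (simp add: hom[symmetric] scale_right_distrib sum.distrib del: scale_scale)
      finally show "((\<lambda>S. scale f (u S)) - bd X w) S = (\<Sum>x\<in>UNIV. scale (g x) (h' x S))"
        by (simp add: bdw)
    qed
    moreover have "scale (g x) (h' x S) \<in> B (j + d - int (card S))" for x S
      using kchains_scale[OF B g h', of x x] by (simp add: kchains_def)
    ultimately show "(\<lambda>S. scale f (u S)) - bd X w \<in> kchains B (j + d)"
      by (auto simp: kchains_def intro: graded_sub_sum[OF submod_graded_sub[OF B]])
  qed
qed

text \<open>Since \<open>f\<close> acts as zero on the homology of \<open>N\<close>, the connecting map
  \<open>H\<^bsub>i+1\<^esub>(N/fN)\<^bsub>j+d\<^esub> \<rightarrow> H\<^sub>i(N)\<^sub>j\<close> is onto when \<open>T\<close> vanishes in the relevant degree.\<close>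

lemma acyclic_of_adjoin:
  assumes B: "submod B" and f: "f \<in> forms d" "d \<ge> 1"
    and inj: "inj_mod f d B (j - int i)" and N': "acyclic_mod (adjoin f d B) (Suc i) (j + d)"
  shows "acyclic_mod B i j"
  unfolding koszul_exact_def
proof (intro ballI impI)
  note b = submod_graded_sub[OF B] and b' = submod_graded_sub[OF submod_adjoin[OF B f(1)]]
  fix u assume u: "u \<in> kchains gr j" "in_degree i u" "bd X u \<in> kchains B j"
  obtain w where w: "w \<in> kchains gr (j + d)" "in_degree (Suc i) w"
    and fu: "(\<lambda>S. scale f (u S)) - bd X w \<in> kchains B (j + d)"
    using scale_null_homotopic[OF B f u] by blast
  have "(\<lambda>S. scale f (u S)) + 0 \<in> kchains (adjoin f d B) (j + d)"
    by (rule kchains_adjoinI) (simp_all add: u kchains_zero[OF b])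
  then have "(\<lambda>S. scale f (u S)) + 0 - ((\<lambda>S. scale f (u S)) - bd X w) \<in> kchains (adjoin f d B) (j + d)"
    by (rule kchains_diff[OF b']) (rule kchains_adjoin_mono[OF fu])
  then have "bd X w \<in> kchains (adjoin f d B) (j + d)"
    by simp
  then obtain z where z: "z \<in> kchains gr (j + d)" "in_degree (Suc (Suc i)) z"
    "w - bd X z \<in> kchains (adjoin f d B) (j + d)"
    using koszul_exactD[OF N' w] by blast
  have "in_degree (Suc i) (w - bd X z)"
    using w z by (auto intro: in_degree_diff in_degree_bd)
  then obtain a c where a: "a \<in> kchains gr (j + d - d)" "in_degree (Suc i) a" and c: "c \<in> kchains B (j + d)"
    and wz: "w - bd X z = (\<lambda>S. scale f (a S)) + c"
    using kchains_adjoinE[OF B z(3)] by blast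
  have "bd X w = bd X (w - bd X z)"
    by (simp add: bd_diff)
  also have "\<dots> = (\<lambda>S. scale f (bd X a S)) + bd X c"
    by (simp add: wz bd_add bd_scale)
  finally have "(\<lambda>S. scale f ((u - bd X a) S)) = ((\<lambda>S. scale f (u S)) - bd X w) + bd X c"
    by (simp add: fun_eq_iff scale_right_diff_distrib)
  then have "(\<lambda>S. scale f ((u - bd X a) S)) \<in> kchains B (j + d)"
    using kchains_add[OF b fu bd_chains[OF b c]] by (simp only:)
  moreover have "u - bd X a \<in> kchains gr j" "in_degree i (u - bd X a)"
    using u a by (auto intro!: kchains_diff[OF gr_sub] bd_chains[OF gr_sub] in_degree_diff in_degree_bd)
  ultimately have "u - bd X a \<in> kchains B j"
    using inj_mod_kchains[OF B inj] by blast
  then show "\<exists>w\<in>kchains gr j. in_degree (Suc i) w \<and> u - bd X w \<in> kchains B j"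
    using a by auto
qed

text \<open>The step of the Bayer--Stillman criterion: injectivity of \<open>f\<close> propagates to the next degree.
  An element \<open>u\<close> killed by \<open>f\<close> is \<open>\<Sum>\<^sub>x x v\<^sub>x\<close>, so \<open>(f v\<^sub>x)\<^sub>x\<close> is a cycle; the three vanishing
  assumptions make \<open>v\<close> a boundary up to elements killed by \<open>f\<close> in the previous degree.\<close>

lemma inj_mod_Suc:
  assumes B: "submod B" and f: "f \<in> forms d"
    and inj: "inj_mod f d B j" and 0: "acyclic_mod B 0 (j + 1)"
    and 1: "acyclic_mod B 1 (j + 1 + d)" and 2: "acyclic_mod (adjoin f d B) 2 (j + 1 + d)"
  shows "inj_mod f d B (j + 1)"
  unfolding inj_mod_def
proof (intro ballI impI)
  note b = submod_graded_sub[OF B] and b' = submod_graded_sub[OF submod_adjoin[OF B f]]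
  fix u assume u: "u \<in> gr (j + 1)" and fu: "scale f u \<in> B (j + 1 + d)"
  define c where "c S = (if S = {} then u else 0)" for S :: "'n set"
  have c: "c \<in> kchains gr (j + 1)" "in_degree 0 c"
    using u by (auto simp: c_def kchains_def gr_zero in_degree_def)
  have "bd X c \<in> kchains B (j + 1)"
    using kchains_zero[OF b] bd_in_degree_0[where X = X, OF X_zero c(2)] by (simp only:)
  then obtain v where v: "v \<in> kchains gr (j + 1)" "in_degree (Suc 0) v" and cv: "c - bd X v \<in> kchains B (j + 1)"
    using koszul_exactD[OF 0 c] by blast
  define fv where "fv = (\<lambda>S. scale f (v S))"
  have fv: "fv \<in> kchains gr (j + 1 + d)" "in_degree 1 fv"
    unfolding fv_def using kchains_scale[OF submod_gr f v(1)] in_degree_scale[OF v(2)] by auto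
  have fc: "(\<lambda>S. scale f (c S)) \<in> kchains B (j + 1 + d)"
    using fu graded_subD(1)[OF b] by (auto simp: kchains_def c_def)
  have "bd X fv = (\<lambda>S. scale f (c S)) - (\<lambda>S. scale f ((c - bd X v) S))"
    unfolding fv_def bd_scale by (rule ext) (simp add: scale_right_diff_distrib)
  then have "bd X fv \<in> kchains B (j + 1 + d)"
    using kchains_diff[OF b fc kchains_scale[OF B f cv]] by (simp only:)
  then obtain w where w: "w \<in> kchains gr (j + 1 + d)" "in_degree 2 w" and fvw: "fv - bd X w \<in> kchains B (j + 1 + d)"
    using koszul_exactD[OF 1 fv] by (metis Suc_1)
  have "fv + 0 \<in> kchains (adjoin f d B) (j + 1 + d)"
    unfolding fv_def by (rule kchains_adjoinI) (simp_all add: v kchains_zero[OF b])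
  then have "fv + 0 - (fv - bd X w) \<in> kchains (adjoin f d B) (j + 1 + d)"
    by (rule kchains_diff[OF b']) (rule kchains_adjoin_mono[OF fvw])
  then have "bd X w \<in> kchains (adjoin f d B) (j + 1 + d)"
    by simp
  then obtain z where z: "z \<in> kchains gr (j + 1 + d)" "in_degree (Suc 2) z"
    "w - bd X z \<in> kchains (adjoin f d B) (j + 1 + d)"
    using koszul_exactD[OF 2 w] by blast
  have "in_degree 2 (w - bd X z)"
    using w(2) in_degree_bd[OF z(2)] by (rule in_degree_diff)
  then obtain a e where a: "a \<in> kchains gr (j + 1 + d - d)" "in_degree 2 a" and e: "e \<in> kchains B (j + 1 + d)"
    and wz: "w - bd X z = (\<lambda>S. scale f (a S)) + e"
    using kchains_adjoinE[OF B z(3)] by blast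
  have "bd X w = bd X (w - bd X z)"
    by (simp add: bd_diff)
  also have "\<dots> = (\<lambda>S. scale f (bd X a S)) + bd X e"
    by (simp add: wz bd_add bd_scale)
  finally have "(\<lambda>S. scale f ((v - bd X a) S)) = (fv - bd X w) + bd X e"
    by (simp add: fun_eq_iff scale_right_diff_distrib fv_def)
  then have "(\<lambda>S. scale f ((v - bd X a) S)) \<in> kchains B (j + 1 + d)"
    using kchains_add[OF b fvw bd_chains[OF b e]] by (simp only:)
  moreover have "v - bd X a \<in> kchains gr (j + 1)" "in_degree 1 (v - bd X a)"
    using v a in_degree_bd[of 1 a]
    by (auto intro!: kchains_diff[OF gr_sub] bd_chains[OF gr_sub] in_degree_diff simp: numeral_2_eq_2)
  moreover have "inj_mod f d B (j + 1 - int 1)"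
    using inj by simp
  ultimately have "v - bd X a \<in> kchains B (j + 1)"
    using inj_mod_kchains[OF B] by blast
  from bd_chains[OF b this] have "bd X v \<in> kchains B (j + 1)"
    by (simp add: bd_diff)
  from kchains_add[OF b cv this] have "c \<in> kchains B (j + 1)"
    by simp
  then show "u \<in> B (j + 1)"
    by (auto simp: kchains_def c_def dest: spec[of _ "{}"])
qed

text \<open>Top Koszul homology is the socle: an element of \<open>T\<close> is killed by the variables if \<open>T\<close>
  vanishes in the next degree.\<close>

lemma inj_mod_pred:
  assumes B: "submod B"
    and inj: "inj_mod f d B (j + 1)" and top: "acyclic_mod B CARD('n) (j + int CARD('n))"
  shows "inj_mod f d B j"
  unfolding inj_mod_def
proof (intro ballI impI)
  note b = submod_graded_sub[OF B]
  fix u assume u: "u \<in> gr j" and fu: "scale f u \<in> B (j + d)"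
  define n where "n = CARD('n)"
  define c where "c S = (if S = UNIV then u else 0)" for S :: "'n set"
  have card_UNIV: "card S = n \<longleftrightarrow> S = UNIV" for S :: "'n set"
    unfolding n_def using card_subset_eq[of UNIV S] by auto
  have c: "c \<in> kchains gr (j + int n)" "in_degree n c"
    using u by (auto simp: c_def kchains_def gr_zero in_degree_def card_UNIV n_def)
  have Xu: "X x u \<in> B (j + 1)" for x
  proof -
    have "scale f (X x u) = X x (scale f u)"
      by (simp add: mult.commute)
    then show ?thesis
      using inj graded_subD(3)[OF gr_sub u] graded_subD(3)[OF b fu, of x]
      by (simp add: inj_mod_def algebra_simps)
  qed
  have "bd X c \<in> kchains B (j + int n)"
    unfolding kchains_def
  proof (intro CollectI allI)
    fix S :: "'n set"
    show "bd X c S \<in> B (j + int n - int (card S))"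
    proof (cases "\<exists>x. x \<notin> S \<and> insert x S = UNIV")
      case True
      then obtain x where x: "x \<notin> S" "insert x S = UNIV" by blast
      then have S: "- S = {x}" by auto
      have "n = Suc (card S)"
        using x by (metis card_insert_disjoint finite n_def)
      then show ?thesis
        using x S Xu by (simp add: bd_def c_def graded_sub_ksign[OF b] algebra_simps)
    next
      case False
      then show ?thesis
        by (auto simp: bd_def c_def graded_subD(1)[OF b] intro!: graded_sub_sum[OF b])
    qed
  qed
  then obtain w where w: "in_degree (Suc n) w" "c - bd X w \<in> kchains B (j + int n)"
    using koszul_exactD[OF top[folded n_def] c] by blast
  have "bd X w UNIV = 0"
    by (simp add: bd_def)
  with w(2) show "u \<in> B j"
    by (auto simp: kchains_def c_def n_def dest: spec[of _ UNIV])
qed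

definition reg_le :: "(int \<Rightarrow> 'm set) \<Rightarrow> int \<Rightarrow> bool"
  where "reg_le B s \<longleftrightarrow> (\<forall>i j. j - int i > s \<longrightarrow> acyclic_mod B i j)"

text \<open>The kernel \<open>T\<close> vanishes in high degrees; since the top Koszul homology of \<open>N\<close> vanishes above
  \<open>s + n\<close>, it has no socle above degree \<open>s\<close>, and descending induction shows that it is zero there.
  This is all that the bound for \<open>N/fN\<close> needs.\<close>

lemma reg_le_adjoin:
  assumes B: "submod B" and f: "f \<in> forms d" "d \<ge> 1"
    and reg: "reg_le B s" and fin: "\<forall>j\<ge>J. inj_mod f d B j"
  shows "\<forall>j>s. inj_mod f d B j" and "reg_le (adjoin f d B) (s + d - 1)"
proof -
  have "inj_mod f d B j" if "j > s" for j
  proof -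
    have "inj_mod f d B (j + int k) \<Longrightarrow> inj_mod f d B j" for k
    proof (induction k)
      case (Suc k)
      have "j + int (Suc k) = j + int k + 1"
        by simp
      moreover have "acyclic_mod B CARD('n) (j + int k + int CARD('n))"
        using reg that by (simp add: reg_le_def)
      ultimately have "inj_mod f d B (j + int k)"
        using inj_mod_pred[OF B] Suc.prems by metis
      then show ?case
        by (rule Suc.IH)
    qed simp
    moreover have "inj_mod f d B (j + int (nat (J - j)))"
      by (rule fin[rule_format]) simp
    ultimately show ?thesis
      by blast
  qed
  then show inj: "\<forall>j>s. inj_mod f d B j" by blast
  show "reg_le (adjoin f d B) (s + d - 1)"
    unfolding reg_le_def
  proof (intro allI impI)
    fix i j assume ij: "j - int i > s + d - 1"
    show "acyclic_mod (adjoin f d B) i j"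
    proof (cases i)
      case 0
      then show ?thesis
        using acyclic_adjoin_0[OF _ B] reg ij f(2) by (simp add: reg_le_def)
    next
      case (Suc i')
      then show ?thesis
        using ij reg inj f(2) by (auto simp: reg_le_def intro!: acyclic_adjoin[OF B f(1)])
    qed
  qed
qed

text \<open>The converse passage, from \<open>N/fN\<close> back to \<open>N\<close>. A single degree in which \<open>T\<close> vanishes is
  enough, because injectivity propagates upwards.\<close>

lemma reg_le_of_adjoin:
  assumes B: "submod B" and f: "f \<in> forms d" "d \<ge> 1"
    and reg: "reg_le (adjoin f d B) (s + d - 1)" and inj: "inj_mod f d B (s + 1)"
    and gens: "\<And>j. j > s \<Longrightarrow> acyclic_mod B 0 j" and rels: "\<And>j. j > s + 1 \<Longrightarrow> acyclic_mod B 1 j"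
  shows "\<forall>j>s. inj_mod f d B j" and "reg_le B s"
proof -
  have *: "inj_mod f d B (s + 1 + int k)" for k
  proof (induction k)
    case (Suc k)
    have "inj_mod f d B (s + 1 + int k + 1)"
      using Suc.IH reg f(2) by (intro inj_mod_Suc[OF B f(1)] gens rels) (auto simp: reg_le_def)
    then show ?case
      by (simp add: algebra_simps)
  qed (simp add: inj)
  show **: "\<forall>j>s. inj_mod f d B j"
  proof (intro allI impI)
    fix j assume "j > s"
    then show "inj_mod f d B j"
      using *[of "nat (j - s - 1)"] by simp
  qed
  show "reg_le B s"
    unfolding reg_le_def using reg ** by (auto simp: reg_le_def intro!: acyclic_of_adjoin[OF B f])
qed

text \<open>The submodule \<open>(f\<^sub>0, \<dots>, f\<^bsub>i-1\<^esub>) M\<close>.\<close>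

primrec seqsub :: "(nat \<Rightarrow> ('n, 'k) mpoly) \<Rightarrow> (nat \<Rightarrow> nat) \<Rightarrow> nat \<Rightarrow> int \<Rightarrow> 'm set"
  where "seqsub f d 0 = (\<lambda>_. {0})"
  | "seqsub f d (Suc i) = adjoin (f i) (int (d i)) (seqsub f d i)"

lemma submod_seqsub: "(\<And>k. k < i \<Longrightarrow> f k \<in> forms (int (d k))) \<Longrightarrow> submod (seqsub f d i)"
  by (induction i) (auto intro: submod_zero submod_adjoin)

lemma seqsub_iff:
  "u \<in> seqsub f d i j \<longleftrightarrow> (\<exists>v. (\<forall>k<i. v k \<in> gr (j - int (d k))) \<and> u = (\<Sum>k<i. scale (f k) (v k)))"
proof (induction i arbitrary: u)
  case (Suc i)
  show ?case
  proof
    assume "u \<in> seqsub f d (Suc i) j"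
    then obtain a v where "a \<in> gr (j - int (d i))" "\<forall>k<i. v k \<in> gr (j - int (d k))"
      "u = scale (f i) a + (\<Sum>k<i. scale (f k) (v k))"
      using Suc.IH by (auto simp: adjoin_def)
    then show "\<exists>v. (\<forall>k<Suc i. v k \<in> gr (j - int (d k))) \<and> u = (\<Sum>k<Suc i. scale (f k) (v k))"
      by (intro exI[of _ "v(i := a)"]) (auto simp: less_Suc_eq add.commute)
  next
    assume "\<exists>v. (\<forall>k<Suc i. v k \<in> gr (j - int (d k))) \<and> u = (\<Sum>k<Suc i. scale (f k) (v k))"
    then obtain v where "\<forall>k<Suc i. v k \<in> gr (j - int (d k))" "u = (\<Sum>k<Suc i. scale (f k) (v k))"
      by blast
    then have "u = scale (f i) (v i) + (\<Sum>k<i. scale (f k) (v k))" "v i \<in> gr (j - int (d i))"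
      by (auto simp: add.commute)
    moreover have "(\<Sum>k<i. scale (f k) (v k)) \<in> seqsub f d i j"
      unfolding Suc.IH using \<open>\<forall>k<Suc i. _ k\<close> by (intro exI[of _ v]) simp
    ultimately show "u \<in> seqsub f d (Suc i) j"
      unfolding seqsub.simps adjoin_def by blast
  qed
qed simp

text \<open>The bound for the regularity of \<open>M/B\<^sub>i\<close> when \<open>M\<close> is \<open>r\<close>-regular.\<close>

definition shift :: "int \<Rightarrow> (nat \<Rightarrow> nat) \<Rightarrow> nat \<Rightarrow> int"
  where "shift r d i = r + (\<Sum>k<i. int (d k) - 1)"

lemma shift_0 [simp]: "shift r d 0 = r"
  and shift_Suc [simp]: "shift r d (Suc i) = shift r d i + int (d i) - 1"
  by (simp_all add: shift_def)

theorem reg_le_seqsub: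
  assumes f: "\<And>k. k < e \<Longrightarrow> f k \<in> forms (int (d k))" and d: "\<And>k. k < e \<Longrightarrow> d k \<ge> 1"
    and reg: "reg_le (\<lambda>_. {0}) r"
    and fin: "\<And>i. i < e \<Longrightarrow> \<exists>J. \<forall>j\<ge>J. inj_mod (f i) (int (d i)) (seqsub f d i) j"
  shows "i \<le> e \<Longrightarrow> reg_le (seqsub f d i) (shift r d i)"
    and "i < e \<Longrightarrow> j > shift r d i \<Longrightarrow> inj_mod (f i) (int (d i)) (seqsub f d i) j"
proof -
  show reg': "i \<le> e \<Longrightarrow> reg_le (seqsub f d i) (shift r d i)" for i
  proof (induction i)
    case (Suc i)
    then show ?case
      using reg_le_adjoin(2)[of "seqsub f d i" "f i" "int (d i)"] submod_seqsub[of i f d] f d fin[of i] by auto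
  qed (simp add: reg)
  show "i < e \<Longrightarrow> j > shift r d i \<Longrightarrow> inj_mod (f i) (int (d i)) (seqsub f d i) j"
    using reg_le_adjoin(1)[of "seqsub f d i" "f i" "int (d i)"] submod_seqsub[of i f d] f d fin[of i] reg'[of i] by auto
qed

text \<open>The conditions on \<open>f\<close> only involve single degrees, which is what makes them open conditions on
  the coefficients of the forms. The degrees of generators and relations are bounded going up the
  sequence from \<open>M\<close>; the bounds for all other homology go down from the last quotient, which vanishes
  in high degrees.\<close>

theorem reg_le_seqsub_criterion:
  assumes f: "\<And>k. k < e \<Longrightarrow> f k \<in> forms (int (d k))" and d: "\<And>k. k < e \<Longrightarrow> d k \<ge> 1"
    and reg: "reg_le (\<lambda>_. {0}) r"
    and inj: "\<And>i. i < e \<Longrightarrow> inj_mod (f i) (int (d i)) (seqsub f d i) (shift r d i + 1)"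
    and last: "gr (shift r d e + 1) \<subseteq> seqsub f d e (shift r d e + 1)"
  shows "i \<le> e \<Longrightarrow> reg_le (seqsub f d i) (shift r d i)"
    and "i < e \<Longrightarrow> j > shift r d i \<Longrightarrow> inj_mod (f i) (int (d i)) (seqsub f d i) j"
proof -
  have sub: "submod (seqsub f d i)" if "i \<le> e" for i
    using submod_seqsub[of i f d] f that by auto
  have gens: "acyclic_mod (seqsub f d i) 0 j" if "i \<le> e" "j > shift r d i" for i j
    using that
  proof (induction i arbitrary: j)
    case 0
    then show ?case using reg by (simp add: reg_le_def)
  next
    case (Suc i)
    then show ?case
      using d[of i] sub[of i] by (auto intro!: acyclic_adjoin_0)
  qed
  have rels: "acyclic_mod (seqsub f d i) 1 j" if "i \<le> e" "j > shift r d i + 1" for i j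
    using that
  proof (induction i arbitrary: j)
    case 0
    then show ?case using reg by (simp add: reg_le_def)
  next
    case (Suc i)
    then show ?case
      using d[of i] f[of i] sub[of i] gens[of i] by (auto intro!: acyclic_adjoin)
  qed
  have full: "gr (shift r d e + 1 + int k) \<subseteq> seqsub f d e (shift r d e + 1 + int k)" for k
  proof (induction k)
    case (Suc k)
    let ?j = "shift r d e + 1 + int k"
    note b = submod_graded_sub[OF sub[OF order_refl]]
    show ?case
    proof
      fix u assume "u \<in> gr (shift r d e + 1 + int (Suc k))"
      moreover have "acyclic_mod (seqsub f d e) 0 (?j + 1)"
        by (rule gens) auto
      ultimately obtain v where v: "\<And>x. v x \<in> gr ?j" "u - (\<Sum>x\<in>UNIV. X x (v x)) \<in> seqsub f d e (?j + 1)"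
        unfolding koszul_exact_0_iff[OF gr_sub b] by (auto simp: algebra_simps)
      have "(\<Sum>x\<in>UNIV. X x (v x)) \<in> seqsub f d e (?j + 1)"
        using v(1) Suc.IH by (intro graded_sub_sum[OF b] graded_subD(3)[OF b]) auto
      from graded_subD(5)[OF b v(2) this] show "u \<in> seqsub f d e (shift r d e + 1 + int (Suc k))"
        by (simp add: algebra_simps)
    qed
  qed (simp add: last)
  have "reg_le (seqsub f d e) (shift r d e)"
    unfolding reg_le_def koszul_exact_def
  proof (intro allI impI ballI)
    fix i j and u :: "'n set \<Rightarrow> 'm" assume ij: "j - int i > shift r d e" and u: "u \<in> kchains gr j" "in_degree i u"
    note b = submod_graded_sub[OF sub[OF order_refl]]
    have "u \<in> kchains (seqsub f d e) j"
      unfolding kchains_def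
    proof (intro CollectI allI)
      fix S
      show "u S \<in> seqsub f d e (j - int (card S))"
      proof (cases "card S = i")
        case True
        then show ?thesis
          using u(1) full[of "nat (j - int i - shift r d e - 1)"] ij by (auto simp: kchains_def)
      next
        case False
        then show ?thesis
          using u(2) graded_subD(1)[OF b] by (simp add: in_degree_def)
      qed
    qed
    then show "\<exists>w\<in>kchains gr j. in_degree (Suc i) w \<and> u - bd X w \<in> kchains (seqsub f d e) j"
      by (intro bexI[of _ 0] conjI) (simp_all add: in_degree_def kchains_zero[OF gr_sub])
  qed
  note base = this
  show reg': "i \<le> e \<Longrightarrow> reg_le (seqsub f d i) (shift r d i)" for i
  proof (induction i rule: inc_induct)
    case base
    show ?case by fact
  next
    case (step i)
    then show ?case
      using f[of i] d[of i] sub[of i] inj[of i] gens[of i] rels[of i]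
      by (intro reg_le_of_adjoin(2)[of "seqsub f d i" "f i" "int (d i)"]) auto
  qed
  show "i < e \<Longrightarrow> j > shift r d i \<Longrightarrow> inj_mod (f i) (int (d i)) (seqsub f d i) j"
    using f[of i] d[of i] sub[of i] inj[of i] gens[of i] rels[of i] reg'[of "Suc i"]
      reg_le_of_adjoin(1)[of "seqsub f d i" "f i" "int (d i)" "shift r d i"] by auto
qed

text \<open>In sufficiently high degree, the relations of a filter-regular sequence are generated by the
  trivial ones \<open>f\<^sub>l \<cdot> e\<^sub>k - f\<^sub>k \<cdot> e\<^sub>l\<close>.\<close>

lemma relations_trivial:
  assumes f: "\<And>k. k < e \<Longrightarrow> f k \<in> forms (int (d k))" and d: "\<And>k. k < e \<Longrightarrow> d k \<ge> 1"
    and inj: "\<And>i j. i < e \<Longrightarrow> j > shift r d i \<Longrightarrow> inj_mod (f i) (int (d i)) (seqsub f d i) j"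
    and "i \<le> e" "j > shift r d i + 1" "\<And>k. k < i \<Longrightarrow> v k \<in> gr (j - int (d k))" "(\<Sum>k<i. scale (f k) (v k)) = 0"
  shows "\<exists>w. (\<forall>k<i. \<forall>l<i. w k l \<in> gr (j - int (d k) - int (d l))) \<and>
    (\<forall>k<i. v k = (\<Sum>l<i. scale (f l) (w k l - w l k)))"
  using assms(4-)
proof (induction i arbitrary: v)
  case (Suc i)
  have di: "d i \<ge> 1"
    using d Suc by auto
  have vi: "v i \<in> gr (j - int (d i))"
    using Suc by auto
  have "scale (f i) (v i) = (\<Sum>k<i. scale (f k) (- v k))"
    using Suc.prems(4) by (simp add: sum_negf eq_neg_iff_add_eq_0 add.commute)
  moreover have "- v k \<in> gr (j - int (d k))" if "k < i" for k
    using Suc.prems(3)[of k] that graded_subD(4)[OF gr_sub] by auto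
  ultimately have "scale (f i) (v i) \<in> seqsub f d i j"
    unfolding seqsub_iff by (intro exI[of _ "\<lambda>k. - v k"]) simp
  then have "v i \<in> seqsub f d i (j - int (d i))"
    using inj[of i "j - int (d i)"] Suc.prems vi by (simp add: inj_mod_def)
  then obtain u where u: "\<And>k. k < i \<Longrightarrow> u k \<in> gr (j - int (d i) - int (d k))"
    and viu: "v i = (\<Sum>k<i. scale (f k) (u k))"
    unfolding seqsub_iff by blast
  \<comment> \<open>Writing the last coefficient \<open>v i\<close> as \<open>\<Sum>\<^sub>k f\<^sub>k u\<^sub>k\<close> and subtracting trivial relations leaves a relation
    among the first \<open>i\<close> forms.\<close>
  define v' where "v' k = v k + scale (f i) (u k)" for k
  have "v' k \<in> gr (j - int (d k))" if "k < i" for k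
  proof -
    have "scale (f i) (u k) \<in> gr (int (d i) + (j - int (d i) - int (d k)))"
      using gr_scale[OF f[of i] u[OF that]] Suc.prems by simp
    then show ?thesis
      unfolding v'_def using Suc.prems(3)[of k] that by (intro graded_subD(5)[OF gr_sub]) auto
  qed
  moreover have "(\<Sum>k<i. scale (f k) (v' k)) = 0"
    using Suc.prems(4) by (simp add: v'_def viu scale_right_distrib sum.distrib scale_sum_right mult.commute)
  moreover have "i \<le> e" "j > shift r d i + 1"
    using Suc.prems di by auto
  ultimately obtain w where w: "\<forall>k<i. \<forall>l<i. w k l \<in> gr (j - int (d k) - int (d l))"
    and vw: "\<forall>k<i. v' k = (\<Sum>l<i. scale (f l) (w k l - w l k))"
    using Suc.IH[of v'] by blast
  define w' where "w' k l = (if k = i then (if l = i then 0 else u l) else if l = i then 0 else w k l)" for k l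
  show ?case
  proof (intro exI[of _ w'] conjI allI impI)
    fix k l assume "k < Suc i" "l < Suc i"
    then show "w' k l \<in> gr (j - int (d k) - int (d l))"
      using u w by (auto simp: w'_def gr_zero)
  next
    fix k assume k: "k < Suc i"
    show "v k = (\<Sum>l<Suc i. scale (f l) (w' k l - w' l k))"
    proof (cases "k = i")
      case True
      have "(\<Sum>l<i. scale (f l) (w' i l - w' l i)) = (\<Sum>l<i. scale (f l) (u l))"
        by (rule sum.cong) (auto simp: w'_def)
      with True show ?thesis by (simp add: viu w'_def)
    next
      case False
      then have "(\<Sum>l<i. scale (f l) (w' k l - w' l k)) = (\<Sum>l<i. scale (f l) (w k l - w l k))"
        by (intro sum.cong) (auto simp: w'_def)
      then show ?thesis
        using False k vw[rule_format, of k] by (simp add: w'_def v'_def eq_diff_eq)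
    qed
  qed
qed auto

text \<open>The coefficient of \<open>f\<^sub>i\<close> in a trivial relation lies in \<open>B\<^sub>i\<close>.\<close>

lemma inj_mod_if_relations_trivial:
  assumes rel: "\<And>v. (\<And>k. k < Suc i \<Longrightarrow> v k \<in> gr (j + int (d i) - int (d k))) \<Longrightarrow> (\<Sum>k<Suc i. scale (f k) (v k)) = 0 \<Longrightarrow>
      \<exists>w. (\<forall>k<Suc i. \<forall>l<Suc i. w k l \<in> gr (j + int (d i) - int (d k) - int (d l))) \<and>
        (\<forall>k<Suc i. v k = (\<Sum>l<Suc i. scale (f l) (w k l - w l k)))"
  shows "inj_mod (f i) (int (d i)) (seqsub f d i) j"
  unfolding inj_mod_def
proof (intro ballI impI)
  fix u assume u: "u \<in> gr j" and "scale (f i) u \<in> seqsub f d i (j + int (d i))"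
  then obtain v where v: "\<And>k. k < i \<Longrightarrow> v k \<in> gr (j + int (d i) - int (d k))"
    and uv: "scale (f i) u = (\<Sum>k<i. scale (f k) (v k))"
    unfolding seqsub_iff by blast
  define v' where "v' k = (if k = i then u else - v k)" for k
  have "v' k \<in> gr (j + int (d i) - int (d k))" if "k < Suc i" for k
    using that u v by (auto simp: v'_def less_Suc_eq intro: graded_subD(4)[OF gr_sub])
  moreover have "(\<Sum>k<Suc i. scale (f k) (v' k)) = 0"
  proof -
    have "(\<Sum>k<i. scale (f k) (v' k)) = - (\<Sum>k<i. scale (f k) (v k))"
      unfolding sum_negf[symmetric] by (rule sum.cong) (auto simp: v'_def)
    then show ?thesis
      by (simp add: v'_def uv)
  qed
  ultimately obtain w where w: "\<forall>k<Suc i. \<forall>l<Suc i. w k l \<in> gr (j + int (d i) - int (d k) - int (d l))"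
    and vw: "\<forall>k<Suc i. v' k = (\<Sum>l<Suc i. scale (f l) (w k l - w l k))"
    using rel[of v'] by blast
  have "u = (\<Sum>l<i. scale (f l) (w i l - w l i))"
    using vw by (auto simp: v'_def dest!: spec[of _ i])
  moreover have "w i l - w l i \<in> gr (j - int (d l))" if "l < i" for l
    using w[rule_format, of i l] w[rule_format, of l i] that
    by (intro gr_diff) (simp_all add: algebra_simps)
  ultimately show "u \<in> seqsub f d i j"
    unfolding seqsub_iff by (intro exI[of _ "\<lambda>l. w i l - w l i"]) auto
qed

end

section \<open>Free modules and regular sequences of forms\<close>

definition div_var :: "'n \<Rightarrow> ('n, 'k::zero) mpoly \<Rightarrow> ('n, 'k) mpoly"
  where "div_var x p = Poly_Mapping.map_key (\<lambda>t. t + Poly_Mapping.single x 1) p"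

lemma lookup_div_var: "Poly_Mapping.lookup (div_var x p) t = Poly_Mapping.lookup p (t + Poly_Mapping.single x 1)"
proof -
  have "inj (\<lambda>t. t + Poly_Mapping.single x (1 :: nat))"
    by (auto simp: inj_on_def)
  then show ?thesis
    by (simp add: div_var_def map_key.rep_eq)
qed

lemma lookup_var_mult:
  fixes p :: "('n, 'k::comm_semiring_1) mpoly"
  shows "Poly_Mapping.lookup (var x * p) t =
    (if Poly_Mapping.lookup t x = 0 then 0 else Poly_Mapping.lookup p (t - Poly_Mapping.single x 1))"
proof -
  have "var x * p = (\<Sum>s\<in>Poly_Mapping.keys p. Poly_Mapping.single (s + Poly_Mapping.single x 1) (Poly_Mapping.lookup p s))"
    using arg_cong[OF mpoly_eq_sum_single[of p], of "(*) (var x)"]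
    by (simp only: sum_distrib_left single_var_mult)
  then have *: "Poly_Mapping.lookup (var x * p) t =
      (\<Sum>s\<in>Poly_Mapping.keys p. if s + Poly_Mapping.single x 1 = t then Poly_Mapping.lookup p s else 0)"
    by (simp add: lookup_single when_def)
  show ?thesis
  proof (cases "Poly_Mapping.lookup t x = 0")
    case True
    then have "s + Poly_Mapping.single x 1 \<noteq> t" for s
      by (auto simp: lookup_add)
    with True show ?thesis
      by (simp add: *)
  next
    case False
    then have "t = (t - Poly_Mapping.single x 1) + Poly_Mapping.single x 1"
      by (intro poly_mapping_eqI) (auto simp: lookup_add lookup_minus lookup_single when_def)
    then have "s + Poly_Mapping.single x 1 = t \<longleftrightarrow> t - Poly_Mapping.single x 1 = s" for s
      by (metis add_right_cancel)
    with False show ?thesis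
      by (auto simp: * in_keys_iff)
  qed
qed

lemma div_var_add: "div_var x (p + q) = div_var x p + div_var x q"
  for p q :: "('n, 'k::comm_monoid_add) mpoly"
  by (rule poly_mapping_eqI) (simp add: lookup_div_var lookup_add)

lemma div_var_var_mult: "div_var x (var x * p) = p"
  for p :: "('n, 'k::comm_semiring_1) mpoly"
  by (rule poly_mapping_eqI) (simp add: lookup_div_var lookup_var_mult lookup_add)

lemma div_var_commute:
  fixes p :: "('n, 'k::comm_semiring_1) mpoly"
  assumes "y \<noteq> x"
  shows "div_var x (var y * p) = var y * div_var x p"
proof (rule poly_mapping_eqI)
  fix t :: "'n \<Rightarrow>\<^sub>0 nat"
  have "Poly_Mapping.lookup t y \<noteq> 0 \<Longrightarrow>
      t + Poly_Mapping.single x 1 - Poly_Mapping.single y 1 = t - Poly_Mapping.single y 1 + Poly_Mapping.single x 1"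
    using assms by (intro poly_mapping_eqI) (auto simp: lookup_add lookup_minus lookup_single when_def)
  then show "Poly_Mapping.lookup (div_var x (var y * p)) t = Poly_Mapping.lookup (var y * div_var x p) t"
    using assms by (simp add: lookup_div_var lookup_var_mult lookup_add lookup_single when_def)
qed

lemma div_var_forms: "p \<in> forms j \<Longrightarrow> div_var x p \<in> forms (j - 1)"
  for p :: "('n::finite, 'k::zero) mpoly"
  by (fastforce simp: forms_iff lookup_div_var)

interpretation poly: pregraded_module "(*) :: ('n::finite, 'k::field) mpoly \<Rightarrow> _" forms
  by standard (auto simp: algebra_simps intro: forms_diff forms_mult)

lemma koszul_exact_poly:
  "koszul_exact (\<lambda>x. (*) (var x)) forms (\<lambda>_. {0 :: ('n::finite, 'k::field) mpoly}) (Suc i) j"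
  by (rule poly.koszul_exact_if_divisible[where \<delta> = div_var])
    (simp_all add: poly.gr_sub div_var_add div_var_commute div_var_var_mult div_var_forms)

text \<open>The free module \<open>\<Oplus>\<^bsub>k<b\<^esub> R(-a\<^sub>k)\<close>; its elements are functions vanishing from \<open>b\<close> on.\<close>

definition fscale :: "('n::finite, 'k::field) mpoly \<Rightarrow> (nat \<Rightarrow> ('n, 'k) mpoly) \<Rightarrow> nat \<Rightarrow> ('n, 'k) mpoly"
  where "fscale p v = (\<lambda>k. p * v k)"

definition free_gr :: "nat \<Rightarrow> (nat \<Rightarrow> int) \<Rightarrow> int \<Rightarrow> (nat \<Rightarrow> ('n, 'k::field) mpoly) set"
  where "free_gr b a j = {v. \<forall>k. v k \<in> forms (j - a k) \<and> (k \<ge> b \<longrightarrow> v k = 0)}"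

lemma fscale_apply [simp]: "fscale p v k = p * v k"
  by (simp add: fscale_def)

lemma pregraded_free: "pregraded_module fscale (free_gr b a :: int \<Rightarrow> (nat \<Rightarrow> ('n::finite, 'k::field) mpoly) set)"
proof (intro pregraded_module.intro Modules.module.intro pregraded_module_axioms.intro)
  fix p q :: "('n, 'k) mpoly" and u v :: "nat \<Rightarrow> ('n, 'k) mpoly" and i j
  show "fscale p (u + v) = fscale p u + fscale p v"
    by (rule ext) (simp add: distrib_left)
  show "fscale (p + q) u = fscale p u + fscale q u"
    by (rule ext) (simp add: distrib_right)
  show "fscale p (fscale q u) = fscale (p * q) u"
    by (rule ext) (simp only: fscale_apply mult.assoc)
  show "fscale 1 u = u"
    by (rule ext) simp
  show "0 \<in> free_gr b a j"
    by (simp add: free_gr_def)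
  show "u \<in> free_gr b a j \<Longrightarrow> v \<in> free_gr b a j \<Longrightarrow> u - v \<in> free_gr b a j"
    by (simp add: free_gr_def forms_diff)
  show "fscale p u \<in> free_gr b a (i + j)" if "p \<in> forms i" "u \<in> free_gr b a j"
    using forms_mult[OF that(1), of "u k" "j - a k" for k] that(2) by (simp add: free_gr_def add_diff_eq)
qed

lemma koszul_exact_free:
  "koszul_exact (\<lambda>x. fscale (var x)) (free_gr b a) (\<lambda>_. {0 :: nat \<Rightarrow> ('n::finite, 'k::field) mpoly}) (Suc i) j"
proof -
  interpret pregraded_module fscale "free_gr b a :: int \<Rightarrow> (nat \<Rightarrow> ('n::finite, 'k::field) mpoly) set"
    by (rule pregraded_free)
  have div0: "div_var x (0 :: ('n, 'k) mpoly) = 0" for x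
    by (rule poly_mapping_eqI) (simp add: lookup_div_var)
  show ?thesis
  proof (rule koszul_exact_if_divisible[where \<delta> = "\<lambda>x v k. div_var x (v k)"])
    show "graded_sub X (free_gr b a)"
      by (rule gr_sub)
    show "(\<lambda>k. div_var x (u k)) \<in> free_gr b a (i - 1)" if "u \<in> free_gr b a i"
      for i x and u :: "nat \<Rightarrow> ('n, 'k) mpoly"
      using that div_var_forms[of "u k" "i - a k" x for k] by (simp add: free_gr_def div0 algebra_simps)
  qed (auto simp: div_var_add div_var_commute div_var_var_mult fun_eq_iff)
qed

text \<open>A sequence of at most \<open>n\<close> forms of positive degree that is filter-regular on the polynomial
  ring is regular: the homology of \<open>R/(f\<^sub>0, \<dots>, f\<^bsub>i-1\<^esub>)\<close> vanishes above degree \<open>i\<close>, so there is no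
  socle as long as \<open>i < n\<close>.\<close>

lemma filter_regular_imp_regular:
  fixes f :: "nat \<Rightarrow> ('n::finite, 'k::field) mpoly"
  assumes f: "\<And>k. k < m \<Longrightarrow> f k \<in> forms (int (d k))" and m: "m \<le> CARD('n)"
    and fin: "\<And>i j. i < m \<Longrightarrow> j > poly.shift 0 d i \<Longrightarrow> poly.inj_mod (f i) (int (d i)) (poly.seqsub f d i) j"
  shows "i \<le> m \<Longrightarrow> q > i \<Longrightarrow> poly.acyclic_mod (poly.seqsub f d i) q j"
    and "i < m \<Longrightarrow> poly.inj_mod (f i) (int (d i)) (poly.seqsub f d i) j"
proof -
  have inj: "poly.inj_mod (f i) (int (d i)) (poly.seqsub f d i) j"
    if i: "i < m" and ac: "\<And>q j. q > i \<Longrightarrow> poly.acyclic_mod (poly.seqsub f d i) q j" for i j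
  proof -
    have sub: "poly.submod (poly.seqsub f d i)"
      using i f by (intro poly.submod_seqsub) auto
    have "poly.inj_mod (f i) (int (d i)) (poly.seqsub f d i) (j + int k) \<Longrightarrow>
        poly.inj_mod (f i) (int (d i)) (poly.seqsub f d i) j" for k
    proof (induction k)
      case (Suc k)
      have "j + int (Suc k) = j + int k + 1"
        by simp
      with Suc.prems have "poly.inj_mod (f i) (int (d i)) (poly.seqsub f d i) (j + int k + 1)"
        by (simp only:)
      moreover have "poly.acyclic_mod (poly.seqsub f d i) CARD('n) (j + int k + int CARD('n))"
        using i m by (intro ac) simp
      ultimately have "poly.inj_mod (f i) (int (d i)) (poly.seqsub f d i) (j + int k)"
        by (rule poly.inj_mod_pred[OF sub])
      then show ?case
        by (rule Suc.IH)
    qed simp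
    moreover have "poly.inj_mod (f i) (int (d i)) (poly.seqsub f d i) (j + int (nat (poly.shift 0 d i + 1 - j)))"
      by (rule fin[OF i]) simp
    ultimately show ?thesis
      by blast
  qed
  have ac: "\<And>q j. q > i \<Longrightarrow> poly.acyclic_mod (poly.seqsub f d i) q j" if "i \<le> m" for i
    using that
  proof (induction i)
    case 0
    then obtain q' where "q = Suc q'"
      by (cases q) auto
    then show ?case
      by (simp add: koszul_exact_poly)
  next
    case (Suc i)
    then have IH: "poly.acyclic_mod (poly.seqsub f d i) q j" if "q > i" for q j
      using that by simp
    obtain q' where q: "q = Suc q'" "q' > i"
      using Suc.prems by (cases q) auto
    have "poly.submod (poly.seqsub f d i)" "f i \<in> forms (int (d i))" "i < m"
      using Suc.prems f by (auto intro!: poly.submod_seqsub)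
    then show ?case
      using q IH inj[OF _ IH] by (auto intro!: poly.acyclic_adjoin)
  qed
  then show "i \<le> m \<Longrightarrow> q > i \<Longrightarrow> poly.acyclic_mod (poly.seqsub f d i) q j"
    by blast
  show "i < m \<Longrightarrow> poly.inj_mod (f i) (int (d i)) (poly.seqsub f d i) j"
    using inj ac by auto
qed

text \<open>The last module of the Koszul resolution of a complete intersection is generated in degree
  \<open>\<Sum> d\<^sub>k\<close>. The connecting maps carry this class down to the class of \<open>1\<close> in \<open>R/\<mm>\<close>.\<close>

lemma complete_intersection_not_acyclic:
  fixes f :: "nat \<Rightarrow> ('n::finite, 'k::field) mpoly"
  assumes f: "\<And>k. k < m \<Longrightarrow> f k \<in> forms (int (d k))" and d: "\<And>k. k < m \<Longrightarrow> d k \<ge> 1"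
    and inj: "\<And>i j. i < m \<Longrightarrow> poly.inj_mod (f i) (int (d i)) (poly.seqsub f d i) j"
  shows "\<not> poly.acyclic_mod (poly.seqsub f d m) m (\<Sum>k<m. int (d k))"
proof
  assume ac: "poly.acyclic_mod (poly.seqsub f d m) m (\<Sum>k<m. int (d k))"
  have "poly.acyclic_mod (poly.seqsub f d i) i (\<Sum>k<i. int (d k))" if "i \<le> m" for i
    using that
  proof (induction i rule: inc_induct)
    case base
    show ?case by (rule ac)
  next
    case (step i)
    have sub: "poly.submod (poly.seqsub f d i)"
      using step f by (intro poly.submod_seqsub) auto
    have di: "1 \<le> int (d i)"
      using d[of i] step by simp
    have "poly.acyclic_mod (poly.adjoin (f i) (int (d i)) (poly.seqsub f d i)) (Suc i) ((\<Sum>k<i. int (d k)) + int (d i))"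
      using step.IH by simp
    then show ?case
      by (rule poly.acyclic_of_adjoin[OF sub f[OF step.hyps(2)] di inj[OF step.hyps(2)]])
  qed
  from this[of 0] have "poly.acyclic_mod (\<lambda>_. {0 :: ('n, 'k) mpoly}) 0 0"
    by simp
  then have "\<forall>u\<in>forms 0. \<exists>v. (\<forall>x. v x \<in> forms (- 1)) \<and> u - (\<Sum>x\<in>UNIV. var x * v x) = (0 :: ('n, 'k) mpoly)"
    by (subst (asm) poly.koszul_exact_0_iff) (auto simp: poly.gr_sub poly.submod_graded_sub[OF poly.submod_zero])
  then obtain v where v: "\<And>x. v x \<in> forms (- 1)" "1 - (\<Sum>x\<in>UNIV. var x * v x) = (0 :: ('n, 'k) mpoly)"
    using one_forms by blast
  have "v x = 0" for x
    using v(1)[of x] by (intro forms_negative[of "- 1"]) auto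
  with v(2) show False
    by simp
qed

text \<open>The module \<open>R\<close> has no higher homology, so the class of the previous lemma comes from \<open>I\<close> under the
  connecting map of \<open>0 \<rightarrow> I \<rightarrow> R \<rightarrow> R/I \<rightarrow> 0\<close>.\<close>

lemma ideal_not_acyclic:
  fixes f :: "nat \<Rightarrow> ('n::finite, 'k::field) mpoly"
  assumes f: "\<And>k. k < Suc m \<Longrightarrow> f k \<in> forms (int (d k))" and d: "\<And>k. k < Suc m \<Longrightarrow> d k \<ge> 1"
    and m: "Suc m \<le> CARD('n)"
    and fin: "\<And>i j. i < Suc m \<Longrightarrow> j > poly.shift 0 d i \<Longrightarrow> poly.inj_mod (f i) (int (d i)) (poly.seqsub f d i) j"
  shows "\<not> koszul_exact (\<lambda>x. (*) (var x)) (poly.seqsub f d (Suc m)) (\<lambda>_. {0}) m (\<Sum>k<Suc m. int (d k))"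
proof
  assume ac: "koszul_exact (\<lambda>x. (*) (var x)) (poly.seqsub f d (Suc m)) (\<lambda>_. {0}) m (\<Sum>k<Suc m. int (d k))"
  have sub: "poly.submod (poly.seqsub f d (Suc m))"
    using f by (rule poly.submod_seqsub)
  have "poly.acyclic_mod (poly.seqsub f d (Suc m)) (Suc m) (\<Sum>k<Suc m. int (d k))"
  proof (rule poly.koszul_exact_quotient[OF poly.gr_sub poly.submod_graded_sub[OF sub]
        poly.submod_graded_sub[OF poly.submod_zero] _ _ koszul_exact_poly ac])
    show "{0} \<subseteq> poly.seqsub f d (Suc m) j" for j
      using graded_subD(1)[OF poly.submod_graded_sub[OF sub]] by simp
    show "poly.seqsub f d (Suc m) j \<subseteq> forms j" for j
      using poly.submodD(2)[OF sub] by blast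
  qed
  then show False
    using complete_intersection_not_acyclic[OF f d filter_regular_imp_regular(2)[OF f m fin]] by blast
qed

section \<open>The ascending chain condition\<close>

text \<open>Modules over a polynomial ring, seen as vector spaces with commuting operators. The set of
  operators varies in the induction that proves the basis theorem.\<close>

locale operator_space = vector_space \<kappa>
  for \<kappa> :: "'k::field \<Rightarrow> 'a::ab_group_add \<Rightarrow> 'a" +
  fixes X :: "'n \<Rightarrow> 'a \<Rightarrow> 'a"
  assumes op_add: "X x (u + v) = X x u + X x v"
    and op_scale: "X x (\<kappa> c u) = \<kappa> c (X x u)"
    and op_commute: "X x (X y u) = X y (X x u)"
begin

definition stable :: "'n set \<Rightarrow> 'a set \<Rightarrow> bool"
  where "stable S B \<longleftrightarrow> 0 \<in> B \<and> (\<forall>u\<in>B. \<forall>v\<in>B. u + v \<in> B) \<and> (\<forall>c. \<forall>u\<in>B. \<kappa> c u \<in> B) \<and>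
    (\<forall>x\<in>S. \<forall>u\<in>B. X x u \<in> B)"

lemma stableD:
  assumes "stable S B"
  shows "0 \<in> B" "u \<in> B \<Longrightarrow> v \<in> B \<Longrightarrow> u + v \<in> B" "u \<in> B \<Longrightarrow> \<kappa> c u \<in> B"
    "x \<in> S \<Longrightarrow> u \<in> B \<Longrightarrow> X x u \<in> B" "u \<in> B \<Longrightarrow> v \<in> B \<Longrightarrow> u - v \<in> B"
proof -
  show add: "u \<in> B \<Longrightarrow> v \<in> B \<Longrightarrow> u + v \<in> B" for u v
    using assms by (simp add: stable_def)
  show scale: "u \<in> B \<Longrightarrow> \<kappa> c u \<in> B" for c u
    using assms by (simp add: stable_def)
  show "0 \<in> B" "x \<in> S \<Longrightarrow> u \<in> B \<Longrightarrow> X x u \<in> B"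
    using assms by (simp_all add: stable_def)
  show "u - v \<in> B" if "u \<in> B" "v \<in> B"
    using add[OF that(1) scale[OF that(2), of "- 1"]] by simp
qed

lemma stable_sum: "stable S B \<Longrightarrow> (\<And>i. i \<in> I \<Longrightarrow> f i \<in> B) \<Longrightarrow> sum f I \<in> B"
  by (induction I rule: infinite_finite_induct) (auto intro: stableD)

definition acc :: "'n set \<Rightarrow> 'a set \<Rightarrow> bool"
  where "acc S M \<longleftrightarrow> (\<forall>F :: nat \<Rightarrow> 'a set. (\<forall>q. stable S (F q) \<and> F q \<subseteq> M \<and> F q \<subseteq> F (Suc q)) \<longrightarrow>
    (\<exists>n. \<forall>q\<ge>n. F q = F n))"

lemma accE:
  assumes "acc S M" "\<And>q. stable S (F q)" "\<And>q. F q \<subseteq> M" "\<And>q. F q \<subseteq> F (Suc q)"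
  obtains n where "\<And>q. q \<ge> n \<Longrightarrow> F q = F n"
  using assms unfolding acc_def by blast

definition generates :: "'n set \<Rightarrow> 'a set \<Rightarrow> 'a set \<Rightarrow> bool"
  where "generates S G M \<longleftrightarrow> (\<forall>N. stable S N \<longrightarrow> G \<subseteq> N \<longrightarrow> M \<subseteq> N)"

lemma op_zero [simp]: "X x 0 = 0"
  using op_add[of x 0 0] by simp

lemma op_pow:
  "(X x ^^ p) 0 = 0" "(X x ^^ p) (u + v) = (X x ^^ p) u + (X x ^^ p) v"
  "(X x ^^ p) (\<kappa> c u) = \<kappa> c ((X x ^^ p) u)" "(X x ^^ p) (X y u) = X y ((X x ^^ p) u)"
proof -
  show "(X x ^^ p) 0 = 0" "(X x ^^ p) (u + v) = (X x ^^ p) u + (X x ^^ p) v"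
    "(X x ^^ p) (\<kappa> c u) = \<kappa> c ((X x ^^ p) u)"
    by (induction p) (simp_all add: op_add op_scale)
  show "(X x ^^ p) (X y u) = X y ((X x ^^ p) u)"
    by (induction p) (simp_all add: op_commute[of x y])
qed

lemma acc_vector_space:
  assumes "finite G" "generates {} G M"
  shows "acc {} M"
  unfolding acc_def
proof (intro allI impI)
  fix F assume F: "\<forall>q. stable {} (F q) \<and> F q \<subseteq> M \<and> F q \<subseteq> F (Suc q)"
  have mono: "F q \<subseteq> F q'" if "q \<le> q'" for q q'
    by (rule lift_Suc_mono_le[OF _ that]) (use F in blast)
  obtain B where B: "B \<subseteq> (\<Union>q. F q)" "independent B" "(\<Union>q. F q) \<subseteq> span B"
    using maximal_independent_subset by blast
  have "stable {} (span G)"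
    by (auto simp: stable_def span_zero span_add span_scale)
  then have "M \<subseteq> span G"
    using assms(2) span_superset by (auto simp: generates_def)
  then have "B \<subseteq> span G"
    using B(1) F by blast
  then have "finite B"
    using independent_span_bound[OF assms(1) B(2)] by blast
  moreover have "\<exists>n. B' \<subseteq> F n" if "finite B'" "B' \<subseteq> (\<Union>q. F q)" for B'
    using that
  proof (induction B')
    case (insert y B')
    then obtain n q where "B' \<subseteq> F n" "y \<in> F q" by auto
    then have "insert y B' \<subseteq> F (max n q)"
      using mono[of n "max n q"] mono[of q "max n q"] by auto
    then show ?case ..
  qed simp
  ultimately obtain n where n: "B \<subseteq> F n"
    using B(1) by blast
  have "subspace (F n)"
    using F unfolding subspace_def stable_def by blast
  then have "span B \<subseteq> F n"
    using n span_minimal by blast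
  then have "F q = F n" if "q \<ge> n" for q
    using B(3) mono[OF that] by blast
  then show "\<exists>n. \<forall>q\<ge>n. F q = F n" by blast
qed

text \<open>Hilbert's basis theorem, by induction on the set of operators: to a submodule \<open>B\<close> one attaches
  its sets \<open>L\<^sub>p(B)\<close> of leading coefficients of elements of degree at most \<open>p\<close> in the operator \<open>k\<close>.\<close>

context
  fixes S :: "'n set" and k :: 'n and M\<^sub>0 :: "'a set"
  assumes M0: "stable S M\<^sub>0"
begin

text \<open>These are the analogues of the polynomials of degree less than \<open>p\<close> in the variable \<open>k\<close> with
  coefficients in \<open>M\<^sub>0\<close>.\<close>

primrec lower :: "nat \<Rightarrow> 'a set"
  where "lower 0 = {0}"
  | "lower (Suc p) = {(X k ^^ p) u + w | u w. u \<in> M\<^sub>0 \<and> w \<in> lower p}"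

definition lead :: "nat \<Rightarrow> 'a set \<Rightarrow> 'a set"
  where "lead p B = {u \<in> M\<^sub>0. \<exists>w\<in>lower p. (X k ^^ p) u + w \<in> B}"

lemma stable_lower: "stable S (lower p)"
proof (induction p)
  case 0
  then show ?case by (simp add: stable_def)
next
  case (Suc p)
  note m = stableD[OF M0] and w = stableD[OF Suc]
  show ?case
    unfolding stable_def
  proof (intro conjI ballI allI)
    show "0 \<in> lower (Suc p)"
      unfolding lower.simps by (intro CollectI exI[of _ 0]) (simp add: m w op_pow)
    fix u assume "u \<in> lower (Suc p)"
    then obtain a b where u: "u = (X k ^^ p) a + b" "a \<in> M\<^sub>0" "b \<in> lower p" by auto
    show "\<kappa> c u \<in> lower (Suc p)" for c
      unfolding lower.simps using u
      by (intro CollectI exI[of _ "\<kappa> c a"] exI[of _ "\<kappa> c b"]) (simp add: m w op_pow scale_right_distrib)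
    show "X x u \<in> lower (Suc p)" if "x \<in> S" for x
      unfolding lower.simps using u that
      by (intro CollectI exI[of _ "X x a"] exI[of _ "X x b"]) (simp add: m w op_pow op_add)
    fix v assume "v \<in> lower (Suc p)"
    then obtain a' b' where v: "v = (X k ^^ p) a' + b'" "a' \<in> M\<^sub>0" "b' \<in> lower p" by auto
    show "u + v \<in> lower (Suc p)"
      unfolding lower.simps using u v
      by (intro CollectI exI[of _ "a + a'"] exI[of _ "b + b'"]) (simp add: m w op_pow)
  qed
qed

lemma lower_Suc_subset: "lower p \<subseteq> lower (Suc p)"
proof
  fix w assume "w \<in> lower p"
  then show "w \<in> lower (Suc p)"
    unfolding lower.simps using stableD(1)[OF M0]
    by (intro CollectI exI[of _ 0] exI[of _ w]) (simp add: op_pow)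
qed

lemma lower_op: "w \<in> lower p \<Longrightarrow> X k w \<in> lower (Suc p)"
proof (induction p arbitrary: w)
  case 0
  then show ?case
    using stableD(1)[OF stable_lower, of "Suc 0"] by simp
next
  case (Suc p)
  then obtain a b where "w = (X k ^^ p) a + b" "a \<in> M\<^sub>0" "b \<in> lower p" by auto
  then have "X k w = (X k ^^ Suc p) a + X k b" "a \<in> M\<^sub>0" "X k b \<in> lower (Suc p)"
    using Suc.IH by (simp_all add: op_add)
  then show ?case
    unfolding lower.simps(2)[of "Suc p"] by blast
qed

lemma stable_lead:
  assumes B: "stable (insert k S) B"
  shows "stable S (lead p B)"
  unfolding stable_def
proof (intro conjI ballI allI)
  note m = stableD[OF M0] and w = stableD[OF stable_lower[of p]] and b = stableD[OF B]
  show "0 \<in> lead p B"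
    unfolding lead_def by (intro CollectI conjI bexI[of _ 0]) (simp_all add: m w b op_pow)
  fix u assume "u \<in> lead p B"
  then obtain r where u: "u \<in> M\<^sub>0" "r \<in> lower p" "(X k ^^ p) u + r \<in> B" by (auto simp: lead_def)
  show "\<kappa> c u \<in> lead p B" for c
    unfolding lead_def using b(3)[OF u(3), of c] u
    by (intro CollectI conjI bexI[of _ "\<kappa> c r"]) (simp_all add: m w op_pow scale_right_distrib)
  show "X x u \<in> lead p B" if "x \<in> S" for x
    unfolding lead_def using b(4)[OF _ u(3), of x] u that
    by (intro CollectI conjI bexI[of _ "X x r"]) (simp_all add: m w op_pow op_add)
  fix v assume "v \<in> lead p B"
  then obtain s where v: "v \<in> M\<^sub>0" "s \<in> lower p" "(X k ^^ p) v + s \<in> B" by (auto simp: lead_def)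
  show "u + v \<in> lead p B"
    unfolding lead_def using b(2)[OF u(3) v(3)] u v
    by (intro CollectI conjI bexI[of _ "r + s"]) (simp_all add: m w op_pow algebra_simps)
qed

lemma lead_Suc_subset:
  assumes B: "stable (insert k S) B"
  shows "lead p B \<subseteq> lead (Suc p) B"
proof
  fix u assume "u \<in> lead p B"
  then obtain w where u: "u \<in> M\<^sub>0" "w \<in> lower p" "(X k ^^ p) u + w \<in> B" by (auto simp: lead_def)
  then have "(X k ^^ Suc p) u + X k w \<in> B"
    using stableD(4)[OF B, of k "(X k ^^ p) u + w"] by (simp add: op_add)
  then show "u \<in> lead (Suc p) B"
    unfolding lead_def using u lower_op by blast
qed

text \<open>Subtracting an element of \<open>B\<close> with the same leading coefficient lowers the degree.\<close>

lemma lead_eq_imp_eq: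
  assumes "B \<subseteq> B'" and B: "stable (insert k S) B" and B': "stable (insert k S) B'"
    and eq: "\<And>p. lead p B' \<subseteq> lead p B" and "B' \<subseteq> (\<Union>p. lower p)"
  shows "B' \<subseteq> B"
proof -
  have "y \<in> lower p \<Longrightarrow> y \<in> B' \<Longrightarrow> y \<in> B" for y p
  proof (induction p arbitrary: y)
    case 0
    then show ?case using stableD(1)[OF B] by simp
  next
    case (Suc p)
    then obtain u w where y: "y = (X k ^^ p) u + w" "u \<in> M\<^sub>0" "w \<in> lower p" by auto
    then have "u \<in> lead p B"
      using Suc.prems eq by (auto simp: lead_def)
    then obtain w' where w': "w' \<in> lower p" "(X k ^^ p) u + w' \<in> B" by (auto simp: lead_def)
    have "w - w' = y - ((X k ^^ p) u + w')"
      by (simp add: y)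
    moreover have "y - ((X k ^^ p) u + w') \<in> B'"
      using stableD(5)[OF B' Suc.prems(2)] w'(2) assms(1) by blast
    ultimately have "w - w' \<in> B'"
      by (simp only:)
    then have "w - w' \<in> B"
      using Suc.IH stableD(5)[OF stable_lower y(3) w'(1)] by blast
    from stableD(2)[OF B w'(2) this] show ?case
      by (simp add: y)
  qed
  then show ?thesis
    using assms(5) by blast
qed

text \<open>The diagonal chain \<open>L\<^sub>q(F\<^sub>q)\<close> is constant from some \<open>q\<^sub>0\<close> on, which takes care of all \<open>L\<^sub>p\<close> with
  \<open>p \<ge> q\<^sub>0\<close>. For the other values of \<open>p\<close> only finitely many chains \<open>L\<^sub>p(F\<^sub>q)\<close> are left.\<close>

lemma acc_insert:
  assumes acc: "acc S M\<^sub>0" and M: "M \<subseteq> (\<Union>p. lower p)"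
  shows "acc (insert k S) M"
  unfolding acc_def
proof (intro allI impI)
  fix F assume F: "\<forall>q. stable (insert k S) (F q) \<and> F q \<subseteq> M \<and> F q \<subseteq> F (Suc q)"
  have mono: "F q \<subseteq> F q'" if "q \<le> q'" for q q'
    by (rule lift_Suc_mono_le[OF _ that]) (use F in blast)
  have lead_mono: "lead p (F q) \<subseteq> lead p' (F q')" if "p \<le> p'" "q \<le> q'" for p p' q q'
  proof -
    have "lead p (F q) \<subseteq> lead p' (F q)"
      by (rule lift_Suc_mono_le[of "\<lambda>p. lead p (F q)", OF lead_Suc_subset that(1)]) (use F in blast)
    also have "\<dots> \<subseteq> lead p' (F q')"
      using mono[OF that(2)] by (auto simp: lead_def)
    finally show ?thesis .
  qed
  have st: "stable S (lead p (F q))" for p q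
    using F by (intro stable_lead) blast
  have sub: "lead p (F q) \<subseteq> M\<^sub>0" for p q
    by (auto simp: lead_def)
  have "lead q (F q) \<subseteq> lead (Suc q) (F (Suc q))" for q
    by (rule lead_mono) auto
  then obtain q0 where q0: "\<And>q. q \<ge> q0 \<Longrightarrow> lead q (F q) = lead q0 (F q0)"
    using accE[OF acc, of "\<lambda>q. lead q (F q)"] st sub by blast
  have "\<exists>n. \<forall>q\<ge>n. lead p (F q) = lead p (F n)" for p
    by (rule accE[OF acc, of "\<lambda>q. lead p (F q)"]) (use st sub lead_mono in \<open>auto\<close>)
  then obtain n where n: "\<And>p q. q \<ge> n p \<Longrightarrow> lead p (F q) = lead p (F (n p))"
    by metis
  define N where "N = Max (insert q0 (n ` {..<q0}))"
  have N: "q0 \<le> N" "p < q0 \<Longrightarrow> n p \<le> N" for p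
    by (auto simp: N_def)
  have "F q \<subseteq> F N" if q: "q \<ge> N" for q
  proof (rule lead_eq_imp_eq)
    show "F N \<subseteq> F q"
      using mono[OF q] .
    show "stable (insert k S) (F N)" "stable (insert k S) (F q)" "F q \<subseteq> (\<Union>p. lower p)"
      using F M by blast+
    show "lead p (F q) \<subseteq> lead p (F N)" for p
    proof (cases "p < q0")
      case True
      then show ?thesis
        using n[of p q] n[of p N] N q by force
    next
      case False
      have "lead p (F q) \<subseteq> lead (max p q) (F (max p q))"
        by (rule lead_mono) auto
      also have "\<dots> = lead q0 (F q0)"
        using False by (intro q0) auto
      also have "\<dots> \<subseteq> lead p (F N)"
        using False N by (intro lead_mono) auto
      finally show ?thesis .
    qed
  qed
  then show "\<exists>n. \<forall>q\<ge>n. F q = F n"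
    using mono by blast
qed

lemma stable_Union_lower: "stable (insert k S) (\<Union>p. lower p)"
  unfolding stable_def
proof (intro conjI ballI allI)
  have mono: "lower p \<subseteq> lower p'" if "p \<le> p'" for p p'
    by (rule lift_Suc_mono_le[of lower, OF lower_Suc_subset that])
  show "0 \<in> (\<Union>p. lower p)"
    using stableD(1)[OF stable_lower] by blast
  fix u assume "u \<in> (\<Union>p. lower p)"
  then obtain p where u: "u \<in> lower p" by blast
  show "\<kappa> c u \<in> (\<Union>p. lower p)" for c
    using stableD(3)[OF stable_lower u] by blast
  show "X x u \<in> (\<Union>p. lower p)" if "x \<in> insert k S" for x
    using that stableD(4)[OF stable_lower _ u] lower_op[OF u] by blast
  fix v assume "v \<in> (\<Union>p. lower p)"
  then obtain q where v: "v \<in> lower q" by blast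
  have "u + v \<in> lower (max p q)"
    using mono[of p "max p q"] mono[of q "max p q"] u v by (intro stableD(2)[OF stable_lower]) auto
  then show "u + v \<in> (\<Union>p. lower p)" by blast
qed

end

theorem hilbert_basis:
  assumes "finite S" "finite G" "generates S G M"
  shows "acc S M"
  using assms
proof (induction S arbitrary: M)
  case empty
  then show ?case using acc_vector_space by blast
next
  case (insert k S)
  define M0 where "M0 = \<Inter>{N. stable S N \<and> G \<subseteq> N}"
  have M0: "stable S M0" "G \<subseteq> M0" "generates S G M0"
    unfolding M0_def stable_def generates_def by blast+
  have "G \<subseteq> lower k M0 1"
    using M0(2) by (auto simp: lower.simps[OF M0(1)])
  then have "M \<subseteq> (\<Union>p. lower k M0 p)"
    using insert.prems(2) stable_Union_lower[OF M0(1), of k] unfolding generates_def by blast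
  then show ?case
    by (rule acc_insert[OF M0(1) insert.IH[OF insert.prems(1) M0(3)]])
qed

text \<open>A stable subset that is generated by a set is generated by a finite part of it.\<close>

lemma acc_finite_generators:
  assumes acc: "acc S M" and N: "N \<subseteq> M" "H \<subseteq> N" "stable S N" "generates S H N"
  obtains H' where "finite H'" "H' \<subseteq> H" "generates S H' N"
proof -
  define clos where "clos G = \<Inter>{N. stable S N \<and> G \<subseteq> N}" for G
  have clos: "stable S (clos G)" "G \<subseteq> clos G" "generates S G (clos G)" for G
    unfolding clos_def stable_def generates_def by blast+
  show thesis
  proof (rule ccontr)
    assume "\<not> thesis"
    then have no: "\<not> generates S H' N" if "finite H'" "H' \<subseteq> H" for H'
      using that \<open>\<And>H'. finite H' \<Longrightarrow> H' \<subseteq> H \<Longrightarrow> generates S H' N \<Longrightarrow> thesis\<close> by blast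
    have "\<exists>h. h \<in> H \<and> h \<notin> clos H'" if "finite H'" "H' \<subseteq> H" for H'
    proof (rule ccontr)
      assume "\<not> ?thesis"
      then have "N \<subseteq> clos H'"
        using N(4) clos(1) unfolding generates_def by blast
      then have "generates S H' N"
        using clos(3) unfolding generates_def by blast
      then show False
        using no that by blast
    qed
    then obtain h where h: "\<And>H'. finite H' \<Longrightarrow> H' \<subseteq> H \<Longrightarrow> h H' \<in> H \<and> h H' \<notin> clos H'"
      by metis
    define E where "E = rec_nat {} (\<lambda>_ E. insert (h E) E)"
    have E: "E 0 = {}" "E (Suc q) = insert (h (E q)) (E q)" for q
      by (simp_all add: E_def)
    have EH: "finite (E q) \<and> E q \<subseteq> H" for q
      by (induction q) (auto simp: E h)
    have EN: "clos (E q) \<subseteq> M" for q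
      using EH[of q] N clos(3)[of "E q"] unfolding generates_def by blast
    have mono: "clos (E q) \<subseteq> clos (E (Suc q))" for q
      by (auto simp: clos_def E)
    obtain n where n: "\<And>q. q \<ge> n \<Longrightarrow> clos (E q) = clos (E n)"
      using accE[OF acc, of "\<lambda>q. clos (E q)"] clos(1) EN mono by blast
    have "clos (E (Suc n)) = clos (E n)"
      by (rule n) simp
    moreover have "h (E n) \<in> clos (E (Suc n))"
      using clos(2)[of "E (Suc n)"] by (auto simp: E)
    ultimately show False
      using h EH by blast
  qed
qed

end

section \<open>Homogeneous components and finite generation\<close>

text \<open>A pregraded module together with a projection onto homogeneous components of the elements of
  a submodule \<open>C\<close>. Both a graded module and a free module of finite rank inside a module of
  functions are of this form.\<close>

locale decomposed_module = pregraded_module scale gr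
  for scale :: "('n::finite, 'k::field) mpoly \<Rightarrow> 'm::ab_group_add \<Rightarrow> 'm" and gr :: "int \<Rightarrow> 'm set" +
  fixes C :: "'m set" and comp :: "int \<Rightarrow> 'm \<Rightarrow> 'm"
  assumes gr_C: "u \<in> gr j \<Longrightarrow> u \<in> C"
    and C_diff: "u \<in> C \<Longrightarrow> v \<in> C \<Longrightarrow> u - v \<in> C"
    and C_scale: "u \<in> C \<Longrightarrow> scale p u \<in> C"
    and comp_gr: "u \<in> C \<Longrightarrow> comp j u \<in> gr j"
    and comp_diff: "u \<in> C \<Longrightarrow> v \<in> C \<Longrightarrow> comp j (u - v) = comp j u - comp j v"
    and comp_of_gr: "u \<in> gr i \<Longrightarrow> comp j u = (if i = j then u else 0)"
    and comp_exhaust: "u \<in> C \<Longrightarrow> \<exists>J. finite J \<and> (\<forall>j. j \<notin> J \<longrightarrow> comp j u = 0) \<and> u = (\<Sum>j\<in>J. comp j u)"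

sublocale pregraded_module \<subseteq> K: operator_space "\<lambda>c. scale (cst c)" X
  by unfold_locales (simp_all add: scale_right_distrib scale_left_distrib cst_add cst_mult mult.commute)

lemma (in pregraded_module) stable_scale:
  assumes B: "K.stable UNIV B" and u: "u \<in> B"
  shows "scale p u \<in> B"
proof (induction p rule: mpoly_induct)
  case (cst c)
  then show ?case using K.stableD(3)[OF B u] .
next
  case (var x p)
  then show ?case using K.stableD(4)[OF B UNIV_I var, of x] by simp
next
  case (add p q)
  then show ?case using K.stableD(2)[OF B] by (simp add: scale_left_distrib)
qed

lemma (in pregraded_module) acc_if_finitely_generated:
  assumes "finite G" "C \<subseteq> span G"
  shows "K.acc UNIV C"
proof (rule K.hilbert_basis[OF _ assms(1)])
  show "K.generates UNIV G C"
    unfolding K.generates_def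
  proof (intro allI impI)
    fix N assume N: "K.stable UNIV N" "G \<subseteq> N"
    have "subspace N"
      using K.stableD[OF N(1)] stable_scale[OF N(1)] by (intro subspaceI)
    then have "span G \<subseteq> N"
      using N(2) by (rule span_minimal[rotated])
    then show "C \<subseteq> N"
      using assms(2) by blast
  qed
qed simp

context decomposed_module
begin

lemma C_zero: "0 \<in> C"
  using gr_C gr_zero by blast

lemma C_add: "u \<in> C \<Longrightarrow> v \<in> C \<Longrightarrow> u + v \<in> C"
  using C_diff[of u "0 - v"] C_diff[OF C_zero] by simp

lemma comp_0: "comp j 0 = 0"
  using comp_diff[OF C_zero C_zero, of j] by simp

lemma comp_add: "u \<in> C \<Longrightarrow> v \<in> C \<Longrightarrow> comp j (u + v) = comp j u + comp j v"
  using comp_diff[of u "0 - v" j] comp_diff[OF C_zero, of v j] C_diff[OF C_zero, of v] by (simp add: comp_0)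

lemma C_sum: "(\<And>i. i \<in> I \<Longrightarrow> f i \<in> C) \<Longrightarrow> sum f I \<in> C"
  by (induction I rule: infinite_finite_induct) (auto intro: C_zero C_add)

lemma comp_sum: "(\<And>i. i \<in> I \<Longrightarrow> f i \<in> C) \<Longrightarrow> comp j (sum f I) = (\<Sum>i\<in>I. comp j (f i))"
  by (induction I rule: infinite_finite_induct) (auto simp: comp_0 comp_add C_sum)

lemma comp_scale:
  assumes u: "u \<in> C" and p: "p \<in> forms i"
  shows "comp j (scale p u) = scale p (comp (j - i) u)"
proof -
  obtain J where J: "finite J" "\<And>j. j \<notin> J \<Longrightarrow> comp j u = 0" "u = (\<Sum>j\<in>J. comp j u)"
    using comp_exhaust[OF u] by blast
  have mem: "scale p (comp l u) \<in> gr (i + l)" for l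
    by (rule gr_scale[OF p comp_gr[OF u]])
  have "scale p u = (\<Sum>l\<in>J. scale p (comp l u))"
    by (subst J(3)) (rule scale_sum_right)
  then have "comp j (scale p u) = (\<Sum>l\<in>J. comp j (scale p (comp l u)))"
    using gr_C[OF mem] by (simp add: comp_sum)
  also have "\<dots> = (\<Sum>l\<in>J. if j - i = l then scale p (comp l u) else 0)"
    by (rule sum.cong) (auto simp: comp_of_gr[OF mem])
  also have "\<dots> = scale p (comp (j - i) u)"
    using J(1,2) by auto
  finally show ?thesis .
qed

text \<open>The submodule of \<open>C\<close> with homogeneous components \<open>B\<close>. Ideals, products and images of free modules
  are subsets of the module, whereas Koszul homology is formed from families of components.\<close>

definition tot :: "(int \<Rightarrow> 'm set) \<Rightarrow> 'm set"
  where "tot B = {u \<in> C. \<forall>j. comp j u \<in> B j}"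

lemma tot_iff_gr:
  assumes B: "submod B" and u: "u \<in> gr j"
  shows "u \<in> tot B \<longleftrightarrow> u \<in> B j"
  using graded_subD(1)[OF submod_graded_sub[OF B]] gr_C[OF u] by (auto simp: tot_def comp_of_gr[OF u])

lemma stable_tot:
  assumes B: "submod B"
  shows "K.stable UNIV (tot B)"
  unfolding K.stable_def
proof (intro conjI ballI allI)
  note b = graded_subD[OF submod_graded_sub[OF B]]
  show "0 \<in> tot B"
    by (simp add: tot_def C_zero comp_0 b)
  fix u assume u: "u \<in> tot B"
  show "u + v \<in> tot B" if "v \<in> tot B" for v
    using u that b by (simp add: tot_def C_add comp_add)
  show "scale (cst c) u \<in> tot B" for c
    using u submodD(3)[OF B cst_forms, of "comp _ u" _ c] by (simp add: tot_def C_scale comp_scale[OF _ cst_forms])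
  show "X x u \<in> tot B" for x
    unfolding tot_def
  proof (intro CollectI conjI allI)
    show "X x u \<in> C" using u by (simp add: tot_def C_scale)
    fix j
    have "comp (j - 1) u \<in> B (j - 1)" "u \<in> C"
      using u by (auto simp: tot_def)
    then show "comp j (X x u) \<in> B j"
      using b(3)[of "comp (j - 1) u" "j - 1" x] by (simp add: comp_scale[OF _ var_forms])
  qed
qed

lemma submod_chain_stabilizes:
  assumes acc: "K.acc UNIV C" and B: "\<And>q. submod (B q)" and mono: "\<And>q j. B q j \<subseteq> B (Suc q) j"
  shows "\<exists>n. \<forall>q\<ge>n. B q = B n"
proof -
  have "tot (B q) \<subseteq> tot (B (Suc q))" "tot (B q) \<subseteq> C" for q
    using mono by (auto simp: tot_def)
  then obtain n where n: "\<And>q. q \<ge> n \<Longrightarrow> tot (B q) = tot (B n)"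
    using K.accE[OF acc, of "\<lambda>q. tot (B q)"] stable_tot[OF B] by blast
  have "B q j = B n j" if "q \<ge> n" for q j
    using n[OF that] tot_iff_gr[OF B] submodD(2)[OF B] by blast
  then show ?thesis by blast
qed

text \<open>The homogeneous elements generate, and by the chain condition finitely many of them do.\<close>

lemma submod_finite_generators:
  assumes acc: "K.acc UNIV C" and B: "submod B"
  obtains b :: nat and a g where "\<And>k. k < b \<Longrightarrow> g k \<in> B (a k)" "tot B = {\<Sum>k<b. scale (p k) (g k) | p. True}"
proof -
  have gen: "K.generates UNIV (\<Union>j. B j) (tot B)"
    unfolding K.generates_def
  proof (intro allI impI subsetI)
    fix N u assume N: "K.stable UNIV N" "(\<Union>j. B j) \<subseteq> N" and u: "u \<in> tot B"
    then obtain J where "finite J" "u = (\<Sum>j\<in>J. comp j u)"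
      using comp_exhaust[of u] by (auto simp: tot_def)
    moreover have "(\<Sum>j\<in>J. comp j u) \<in> N"
      using N u by (intro K.stable_sum[OF N(1)]) (auto simp: tot_def)
    ultimately show "u \<in> N" by simp
  qed
  have "(\<Union>j. B j) \<subseteq> tot B"
    using tot_iff_gr[OF B] submodD(2)[OF B] by blast
  moreover have "tot B \<subseteq> C"
    by (auto simp: tot_def)
  ultimately obtain H where H: "finite H" "H \<subseteq> (\<Union>j. B j)" "K.generates UNIV H (tot B)"
    using K.acc_finite_generators[OF acc _ _ stable_tot[OF B] gen] by metis
  obtain g where g: "g ` {..<card H} = H"
    using ex_bij_betw_nat_finite[OF H(1)] by (auto simp: bij_betw_def atLeast0LessThan)
  have "\<forall>k. \<exists>j. k < card H \<longrightarrow> g k \<in> B j"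
    using H(2) g by blast
  then obtain a where a: "\<And>k. k < card H \<Longrightarrow> g k \<in> B (a k)"
    by metis
  let ?L = "{\<Sum>k<card H. scale (p k) (g k) | p. True}"
  have "K.stable UNIV ?L"
    unfolding K.stable_def
  proof (intro conjI ballI allI)
    show "0 \<in> ?L"
      by (intro CollectI exI[of _ "\<lambda>_. 0"]) simp
    fix u assume "u \<in> ?L"
    then obtain p where u: "u = (\<Sum>k<card H. scale (p k) (g k))" by blast
    show "scale (cst c) u \<in> ?L" for c
      unfolding u by (intro CollectI exI[of _ "\<lambda>k. cst c * p k"]) (simp add: scale_sum_right)
    show "X x u \<in> ?L" for x
      unfolding u by (intro CollectI exI[of _ "\<lambda>k. var x * p k"]) (simp add: scale_sum_right)
    fix v assume "v \<in> ?L"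
    then obtain q where v: "v = (\<Sum>k<card H. scale (q k) (g k))" by blast
    show "u + v \<in> ?L"
      unfolding u v by (intro CollectI exI[of _ "\<lambda>k. p k + q k"]) (simp add: scale_left_distrib sum.distrib)
  qed
  moreover have "H \<subseteq> ?L"
  proof
    fix h assume "h \<in> H"
    then obtain k where k: "k < card H" "h = g k" using g by auto
    have "h = (\<Sum>l<card H. scale (if l = k then 1 else 0) (g l))"
      using k by (simp add: if_distrib[of "\<lambda>p. scale p _"] cong: if_cong)
    then show "h \<in> ?L"
      by (intro CollectI exI[of _ "\<lambda>l. if l = k then 1 else 0"]) simp
  qed
  ultimately have "tot B \<subseteq> ?L"
    using H(3) unfolding K.generates_def by blast
  moreover have "?L \<subseteq> tot B"
  proof
    fix u assume "u \<in> ?L"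
    then obtain p where u: "u = (\<Sum>k<card H. scale (p k) (g k))" by blast
    have "g k \<in> tot B" if "k < card H" for k
      using tot_iff_gr[OF B submodD(2)[OF B a[OF that]]] a[OF that] by blast
    then show "u \<in> tot B"
      unfolding u by (intro K.stable_sum[OF stable_tot[OF B]] stable_scale[OF stable_tot[OF B]]) simp
  qed
  ultimately show thesis
    using that[of "card H" g a] a by blast
qed

text \<open>Graded pieces of finitely generated modules are finite-dimensional, and they vanish in very
  negative degrees.\<close>

lemma gr_finite_dimensional:
  assumes acc: "K.acc UNIV C"
  shows "\<exists>G. finite G \<and> G \<subseteq> gr j \<and> gr j \<subseteq> K.span G" and "\<exists>L. \<forall>j<L. gr j = {0}"
proof -
  obtain b :: nat and a g where g: "\<And>k. k < b \<Longrightarrow> g k \<in> gr (a k)" and tot: "tot gr = {\<Sum>k<b. scale (p k) (g k) | p. True}"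
    by (rule submod_finite_generators[OF acc submod_gr]) (rule that)
  \<comment> \<open>A homogeneous element is a combination of the generators with homogeneous coefficients, as
    those parts of the coefficients that have the wrong degree cancel.\<close>
  have rep: "\<exists>p. (\<forall>k. p k \<in> forms (j - a k)) \<and> u = (\<Sum>k<b. scale (p k) (g k))" if u: "u \<in> gr j" for u j
  proof -
    have "u \<in> tot gr"
      using tot_iff_gr[OF submod_gr u] u by simp
    then obtain p where "u = (\<Sum>k<b. scale (p k) (g k))"
      using tot by blast
    also have "\<dots> = (\<Sum>k<b. \<Sum>i\<in>degs (p k). scale (hpart i (p k)) (g k))"
      by (intro sum.cong refl) (subst mpoly_eq_sum_hpart[OF finite_degs order_refl], simp add: scale_sum_left)
    finally have "comp j u = comp j (\<Sum>k<b. \<Sum>i\<in>degs (p k). scale (hpart i (p k)) (g k))"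
      by (rule arg_cong)
    also have "\<dots> = (\<Sum>k<b. comp j (\<Sum>i\<in>degs (p k). scale (hpart i (p k)) (g k)))"
      by (rule comp_sum) (simp add: C_sum C_scale gr_C[OF g])
    also have "\<dots> = (\<Sum>k<b. \<Sum>i\<in>degs (p k). comp j (scale (hpart i (p k)) (g k)))"
      by (intro sum.cong refl comp_sum) (simp add: C_scale gr_C[OF g])
    also have "\<dots> = (\<Sum>k<b. \<Sum>i\<in>degs (p k). if j - a k = i then scale (hpart i (p k)) (g k) else 0)"
    proof (intro sum.cong refl)
      fix k i assume "k \<in> {..<b}"
      then have "scale (hpart i (p k)) (g k) \<in> gr (i + a k)"
        using g by (intro gr_scale) auto
      from comp_of_gr[OF this] show "comp j (scale (hpart i (p k)) (g k)) = (if j - a k = i then scale (hpart i (p k)) (g k) else 0)"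
        by auto
    qed
    also have "\<dots> = (\<Sum>k<b. scale (hpart (j - a k) (p k)) (g k))"
      by (intro sum.cong refl) (auto simp: hpart_eq_0)
    finally show ?thesis
      using comp_of_gr[OF u, of j] by (intro exI[of _ "\<lambda>k. hpart (j - a k) (p k)"]) auto
  qed
  define G where "G = (\<lambda>(k, t). scale (Poly_Mapping.single t 1) (g k)) ` (SIGMA k:{..<b}. {t. int (mdeg t) = j - a k})"
  have fin: "finite {t :: 'n \<Rightarrow>\<^sub>0 nat. int (mdeg t) = i}" for i
    by (rule finite_subset[OF _ finite_mdeg_eq[of "nat i"]]) auto
  have "finite G"
    unfolding G_def by (intro finite_imageI finite_SigmaI fin) simp
  moreover have "G \<subseteq> gr j"
  proof
    fix u assume "u \<in> G"
    then obtain k t where u: "u = scale (Poly_Mapping.single t 1) (g k)" "k < b" "int (mdeg t) = j - a k"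
      by (auto simp: G_def)
    have "Poly_Mapping.single t (1 :: 'k) \<in> forms (j - a k)"
      using u(3) by (auto simp: forms_iff lookup_single when_def)
    from gr_scale[OF this g[OF u(2)]] show "u \<in> gr j"
      by (simp add: u)
  qed
  moreover have "gr j \<subseteq> K.span G"
  proof
    fix u assume "u \<in> gr j"
    then obtain p where p: "\<And>k. p k \<in> forms (j - a k)" "u = (\<Sum>k<b. scale (p k) (g k))"
      using rep by blast
    show "u \<in> K.span G"
      unfolding p(2)
    proof (rule K.span_sum)
      fix k assume k: "k \<in> {..<b}"
      have "scale (p k) (g k) = (\<Sum>t\<in>Poly_Mapping.keys (p k). scale (cst (Poly_Mapping.lookup (p k) t)) (scale (Poly_Mapping.single t 1) (g k)))"
        by (subst mpoly_eq_sum_single) (simp add: scale_sum_left cst_def mult_single)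
      also have "\<dots> \<in> K.span G"
      proof (intro K.span_sum K.span_scale K.span_base)
        fix t assume "t \<in> Poly_Mapping.keys (p k)"
        then have "int (mdeg t) = j - a k"
          using p(1)[of k] by (auto simp: forms_def)
        then show "scale (Poly_Mapping.single t 1) (g k) \<in> G"
          using k by (auto simp: G_def)
      qed
      finally show "scale (p k) (g k) \<in> K.span G" .
    qed
  qed
  ultimately show "\<exists>G. finite G \<and> G \<subseteq> gr j \<and> gr j \<subseteq> K.span G" by blast
  obtain L where L: "\<And>k. k < b \<Longrightarrow> L \<le> a k"
    using that[of "Min (a ` {..<b})"] by auto
  have "gr j = {0}" if "j < L" for j
  proof -
    have "u = 0" if u: "u \<in> gr j" for u
    proof -
      obtain p where p: "\<And>k. p k \<in> forms (j - a k)" "u = (\<Sum>k<b. scale (p k) (g k))"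
        using rep[OF u] by blast
      have "p k = 0" if "k < b" for k
        using L[OF that] \<open>j < L\<close> by (intro forms_negative[OF _ p(1)]) simp
      then show ?thesis by (simp add: p(2))
    qed
    then show ?thesis
      using gr_zero by blast
  qed
  then show "\<exists>L. \<forall>j<L. gr j = {0}" by blast
qed

end

section \<open>Linear forms in general position\<close>

definition lin :: "'k \<Rightarrow> ('n::finite, 'k::comm_ring_1) mpoly"
  where "lin c = (\<Sum>x\<in>UNIV. cst (c ^ idx x) * var x)"

lemma lin_forms: "lin c \<in> forms 1"
  unfolding lin_def using forms_mult[OF cst_forms var_forms] by (intro forms_sum) simp

text \<open>Any \<open>n\<close> of these forms span the space of linear forms, by Lagrange interpolation.\<close>

lemma var_eq_sum_lin:
  fixes T :: "'k::field set"
  assumes T: "finite T" "card T = CARD('n)"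
  shows "\<exists>\<gamma>. (var x :: ('n::finite, 'k) mpoly) = (\<Sum>c\<in>T. cst (\<gamma> c) * lin c)"
proof -
  \<comment> \<open>The Lagrange basis polynomials for the nodes \<open>T\<close>.\<close>
  define L where "L c = smult (inverse (\<Prod>c'\<in>T - {c}. c - c')) (\<Prod>c'\<in>T - {c}. [:- c', 1:])" for c
  have L: "poly (L c) z = (if z = c then 1 else 0)" if "c \<in> T" "z \<in> T" for c z
  proof (cases "z = c")
    case True
    have "(\<Prod>c'\<in>T - {c}. c - c') \<noteq> 0"
      using T by auto
    then show ?thesis
      using True by (simp add: L_def poly_prod)
  next
    case False
    then have "(\<Prod>c'\<in>T - {c}. z - c') = 0"
      using T that by (intro prod_zero) auto
    then show ?thesis
      using False by (simp add: L_def poly_prod)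
  qed
  have degL: "degree (L c) < CARD('n)" if "c \<in> T" for c
  proof -
    have "degree (L c) \<le> degree (\<Prod>c'\<in>T - {c}. [:- c', 1:])"
      unfolding L_def by (rule degree_smult_le)
    also have "\<dots> \<le> (\<Sum>c'\<in>T - {c}. degree [:- c', 1:])"
      using T by (intro degree_prod_sum_le[unfolded o_def]) auto
    also have "\<dots> = card (T - {c})"
      by simp
    also have "\<dots> < CARD('n)"
      using T that by (metis card_Diff1_less)
    finally show ?thesis .
  qed
  have interp: "(\<Sum>c\<in>T. smult (c ^ k) (L c)) = monom 1 k" if k: "k < CARD('n)" for k
  proof (rule ccontr)
    define D where "D = (\<Sum>c\<in>T. smult (c ^ k) (L c)) - monom 1 k"
    assume "\<not> ?thesis"
    then have "D \<noteq> 0" by (simp add: D_def)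
    have "degree D < CARD('n)"
      unfolding D_def using degL k
      by (intro degree_diff_less degree_sum_less) (auto simp: degree_monom_eq intro: le_less_trans[OF degree_smult_le])
    moreover have "T \<subseteq> {z. poly D z = 0}"
    proof
      fix z assume z: "z \<in> T"
      have "(\<Sum>c\<in>T. c ^ k * poly (L c) z) = (\<Sum>c\<in>T. if z = c then c ^ k else 0)"
        using z by (intro sum.cong) (auto simp: L)
      then show "z \<in> {z. poly D z = 0}"
        using z T by (simp add: D_def poly_sum poly_monom)
    qed
    then have "card T \<le> card {z. poly D z = 0}"
      by (intro card_mono poly_roots_finite \<open>D \<noteq> 0\<close>)
    moreover have "card {z. poly D z = 0} \<le> degree D"
      by (rule card_poly_roots_bound[OF \<open>D \<noteq> 0\<close>])
    ultimately show False
      using T by simp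
  qed
  have coeff: "(\<Sum>c\<in>T. coeff (L c) (idx x) * c ^ idx y) = (if y = x then 1 else 0)" for x y :: 'n
  proof -
    have "(\<Sum>c\<in>T. coeff (L c) (idx x) * c ^ idx y) = coeff (\<Sum>c\<in>T. smult (c ^ idx y) (L c)) (idx x)"
      by (simp add: coeff_sum mult.commute)
    also have "\<dots> = coeff (monom 1 (idx y)) (idx x)"
      using interp[OF idx_less[of y]] by simp
    finally show ?thesis
      by simp
  qed
  have "(\<Sum>c\<in>T. cst (coeff (L c) (idx x)) * lin c :: ('n, 'k) mpoly)
      = (\<Sum>c\<in>T. \<Sum>y\<in>UNIV. cst (coeff (L c) (idx x) * c ^ idx y) * var y)"
    unfolding lin_def sum_distrib_left cst_mult mult.assoc ..
  also have "\<dots> = (\<Sum>y\<in>UNIV. \<Sum>c\<in>T. cst (coeff (L c) (idx x) * c ^ idx y) * var y)"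
    by (rule sum.swap)
  also have "\<dots> = (\<Sum>y\<in>UNIV. (\<Sum>c\<in>T. cst (coeff (L c) (idx x) * c ^ idx y)) * var y)"
    by (simp add: sum_distrib_right)
  also have "\<dots> = (\<Sum>y\<in>UNIV. cst (\<Sum>c\<in>T. coeff (L c) (idx x) * c ^ idx y) * var y)"
    by (simp only: cst_sum)
  also have "\<dots> = var x"
    by (simp add: coeff if_distrib[of cst] if_distrib[of "\<lambda>p. p * _"] cong: if_cong)
  finally show ?thesis
    by metis
qed

lemma forms_power: "p \<in> forms j \<Longrightarrow> p ^ e \<in> forms (int e * j)"
  for p :: "('n::finite, 'k::comm_semiring_1) mpoly"
proof (induction e)
  case (Suc e)
  then show ?case
    using forms_mult[of p j "p ^ e" "int e * j"] by (simp add: algebra_simps)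
qed simp

lemma (in pregraded_module) inj_mod_power:
  assumes f: "f \<in> forms 1" and inj: "\<forall>j\<ge>J. inj_mod f 1 B j"
  shows "j \<ge> J \<Longrightarrow> inj_mod (f ^ e) (int e) B j"
proof (induction e)
  case (Suc e)
  show ?case
    unfolding inj_mod_def
  proof (intro ballI impI)
    fix u assume u: "u \<in> gr j" and fu: "scale (f ^ Suc e) u \<in> B (j + int (Suc e))"
    have "f ^ e \<in> forms (int e)"
      using forms_power[OF f] by simp
    then have "scale (f ^ e) u \<in> gr (j + int e)"
      using gr_scale[OF _ u, of "f ^ e" "int e"] by (simp add: add.commute)
    moreover have "scale f (scale (f ^ e) u) \<in> B (j + int e + 1)"
      using fu by (simp add: algebra_simps)
    ultimately have "scale (f ^ e) u \<in> B (j + int e)"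
      using inj Suc.prems by (auto simp: inj_mod_def)
    then show "u \<in> B j"
      using Suc u by (auto simp: inj_mod_def)
  qed
qed (simp add: inj_mod_def)

text \<open>If \<open>\<ell>\<^sub>c u\<close> lies in a submodule for \<open>n\<close> values of \<open>c\<close>, then so do all \<open>x u\<close>.\<close>

lemma (in pregraded_module) var_scale_mem_if_lin_scale_mem:
  assumes B: "submod B" and T: "finite T" "card T = CARD('n)"
    and mem: "\<And>c. c \<in> T \<Longrightarrow> scale (lin c) u \<in> B j"
  shows "X x u \<in> B j"
proof -
  obtain \<gamma> where "(var x :: ('n, 'k) mpoly) = (\<Sum>c\<in>T. cst (\<gamma> c) * lin c)"
    using var_eq_sum_lin[OF T] by blast
  then have "X x u = (\<Sum>c\<in>T. scale (cst (\<gamma> c)) (scale (lin c) u))"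
    by (simp add: scale_sum_left)
  then show ?thesis
    using submodD(3)[OF B cst_forms mem] by (auto intro!: graded_sub_sum[OF submod_graded_sub[OF B]])
qed

context decomposed_module
begin

definition add_cyclic :: "'m \<Rightarrow> int \<Rightarrow> (int \<Rightarrow> 'm set) \<Rightarrow> int \<Rightarrow> 'm set"
  where "add_cyclic u j B i = {scale p u + b | p b. p \<in> forms (i - j) \<and> b \<in> B i}"

lemma submod_add_cyclic:
  assumes B: "submod B" and u: "u \<in> gr j"
  shows "submod (add_cyclic u j B)" "B i \<subseteq> add_cyclic u j B i" "u \<in> add_cyclic u j B j"
proof -
  note b = graded_subD[OF submod_graded_sub[OF B]]
  show sub: "B i \<subseteq> add_cyclic u j B i" for i
  proof
    fix v assume "v \<in> B i"
    then show "v \<in> add_cyclic u j B i"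
      unfolding add_cyclic_def by (intro CollectI exI[of _ 0] exI[of _ v]) simp
  qed
  show "u \<in> add_cyclic u j B j"
    unfolding add_cyclic_def by (intro CollectI exI[of _ 1] exI[of _ 0]) (simp add: b)
  show "submod (add_cyclic u j B)"
    unfolding submod_def
  proof (intro conjI allI ballI subsetI)
    fix i
    show "0 \<in> add_cyclic u j B i"
      using sub b(1) by blast
    fix v assume "v \<in> add_cyclic u j B i"
    then obtain p a where v: "v = scale p u + a" "p \<in> forms (i - j)" "a \<in> B i"
      by (auto simp: add_cyclic_def)
    show "v \<in> gr i"
      using gr_scale[OF v(2) u] submodD(2)[OF B v(3)] v(1) graded_subD(5)[OF gr_sub] by simp
    show "v - w \<in> add_cyclic u j B i" if "w \<in> add_cyclic u j B i" for w
    proof -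
      obtain q c where w: "w = scale q u + c" "q \<in> forms (i - j)" "c \<in> B i"
        using \<open>w \<in> _\<close> by (auto simp: add_cyclic_def)
      show ?thesis
        unfolding add_cyclic_def v(1) w(1) using forms_diff[OF v(2) w(2)] b(2)[OF v(3) w(3)]
        by (intro CollectI exI[of _ "p - q"] exI[of _ "a - c"]) (simp add: scale_left_diff_distrib)
    qed
  next
    fix i l v and q :: "('n, 'k) mpoly" assume q: "q \<in> forms i" and "v \<in> add_cyclic u j B l"
    then obtain p a where v: "v = scale p u + a" "p \<in> forms (l - j)" "a \<in> B l"
      by (auto simp: add_cyclic_def)
    show "scale q v \<in> add_cyclic u j B (i + l)"
      unfolding add_cyclic_def v(1) using forms_mult[OF q v(2)] submodD(3)[OF B q v(3)]
      by (intro CollectI exI[of _ "q * p"] exI[of _ "scale q a"]) (simp add: scale_right_distrib algebra_simps)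
  qed
qed

text \<open>All but finitely many \<open>\<ell>\<^sub>c\<close> are injective on \<open>M/B\<close> in high degrees. The proof is by Noetherian
  induction on \<open>B\<close>. Either \<open>M/B\<close> has a socle element, which only affects one degree, or one adjoins
  an element killed by as many of the \<open>\<ell>\<^sub>c\<close> as possible; all other \<open>\<ell>\<^sub>c\<close> are injective on the
  submodule that it generates in \<open>M/B\<close>. Choosing a maximal set of killing forms plays the role of
  choosing a maximal annihilator, that is, an associated prime.\<close>

theorem lin_generically_injective:
  assumes acc: "K.acc UNIV C"
  shows "submod B \<Longrightarrow> \<exists>\<Gamma> J. finite \<Gamma> \<and> (\<forall>c. c \<notin> \<Gamma> \<longrightarrow> (\<forall>j\<ge>J. inj_mod (lin c) 1 B j))"
proof -
  define r where "r = {(B', B). submod B \<and> submod B' \<and> (\<forall>j. B j \<subseteq> B' j) \<and> B \<noteq> B'}"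
  have "wf r"
    unfolding wf_iff_no_infinite_down_chain
  proof
    assume "\<exists>F. \<forall>q. (F (Suc q), F q) \<in> r"
    then obtain F where F: "\<And>q. (F (Suc q), F q) \<in> r" by blast
    then obtain n where "\<forall>q\<ge>n. F q = F n"
      using submod_chain_stabilizes[OF acc, of F] by (auto simp: r_def)
    then have "F (Suc n) = F n" by (metis le_Suc_eq order_refl)
    then show False
      using F[of n] by (simp add: r_def)
  qed
  then show "submod B \<Longrightarrow> \<exists>\<Gamma> J. finite \<Gamma> \<and> (\<forall>c. c \<notin> \<Gamma> \<longrightarrow> (\<forall>j\<ge>J. inj_mod (lin c) 1 B j))" for B
  proof (induction B rule: wf_induct_rule)
    case (less B)
    note b = graded_subD[OF submod_graded_sub[OF less.prems]]
    have step: "\<exists>\<Gamma> J. finite \<Gamma> \<and> (\<forall>c. c \<notin> \<Gamma> \<longrightarrow> (\<forall>i\<ge>J. inj_mod (lin c) 1 (add_cyclic u j B) i))"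
      if u: "u \<in> gr j" "u \<notin> B j" for u j
    proof (rule less.IH)
      have "B \<noteq> add_cyclic u j B"
        using submod_add_cyclic(3)[OF less.prems u(1)] u(2) by metis
      then show "(add_cyclic u j B, B) \<in> r"
        using submod_add_cyclic(1,2)[OF less.prems u(1)] less.prems by (auto simp: r_def)
      show "submod (add_cyclic u j B)"
        using submod_add_cyclic(1)[OF less.prems u(1)] .
    qed
    define killers where "killers u j = {c. scale (lin c) u \<in> B (j + 1)}" for u j
    consider (full) "\<And>j. gr j \<subseteq> B j" | (socle) u j where "u \<in> gr j" "u \<notin> B j" "\<And>x. X x u \<in> B (j + 1)"
      | (nosocle) u j where "u \<in> gr j" "u \<notin> B j" "\<And>u j. u \<in> gr j \<Longrightarrow> u \<notin> B j \<Longrightarrow> \<exists>x. X x u \<notin> B (j + 1)"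
      by blast
    then show ?case
    proof cases
      case full
      then show ?thesis
        by (intro exI[of _ "{}"] exI[of _ 0]) (auto simp: inj_mod_def)
    next
      case socle
      obtain \<Gamma> J where \<Gamma>: "finite \<Gamma>" "\<And>c i. c \<notin> \<Gamma> \<Longrightarrow> i \<ge> J \<Longrightarrow> inj_mod (lin c) 1 (add_cyclic u j B) i"
        using step[OF socle(1,2)] by blast
      have eq: "add_cyclic u j B i \<subseteq> B i" if "i > j" for i
      proof
        fix v assume "v \<in> add_cyclic u j B i"
        then obtain p a where v: "v = scale p u + a" "p \<in> forms (i - j)" "a \<in> B i"
          by (auto simp: add_cyclic_def)
        have "1 \<le> i - j"
          using \<open>i > j\<close> by simp
        then obtain g where g: "p = (\<Sum>x\<in>UNIV. var x * g x)" "\<And>x. g x \<in> forms (i - j - 1)"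
          using form_eq_sum_var[OF v(2)] by blast
        have "scale (g x) (X x u) \<in> B (i - j - 1 + (j + 1))" for x
          by (rule submodD(3)[OF less.prems g(2) socle(3)])
        then have "scale (g x) (X x u) \<in> B i" for x
          by simp
        then have "(\<Sum>x\<in>UNIV. scale (g x) (X x u)) \<in> B i"
          by (intro graded_sub_sum[OF submod_graded_sub[OF less.prems]])
        then have "scale p u \<in> B i"
          by (simp add: g(1) scale_sum_left mult.commute)
        then show "v \<in> B i"
          using v b(5) by simp
      qed
      show ?thesis
      proof (intro exI conjI allI impI)
        fix c i assume "c \<notin> \<Gamma>" and i: "max J (j + 1) \<le> i"
        then have "inj_mod (lin c) 1 (add_cyclic u j B) i"
          using \<Gamma>(2) by simp
        then show "inj_mod (lin c) 1 B i"
          using eq[of i] i submod_add_cyclic(2)[OF less.prems socle(1)] by (force simp: inj_mod_def)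
      qed (rule \<Gamma>(1))
    next
      case nosocle
      \<comment> \<open>With \<open>n\<close> killers, \<open>u\<close> would be a socle element.\<close>
      have few: "finite (killers u j) \<and> card (killers u j) < CARD('n)" if u: "u \<in> gr j" "u \<notin> B j" for u j
      proof (rule ccontr)
        assume "\<not> ?thesis"
        then have "infinite (killers u j) \<or> CARD('n) \<le> card (killers u j)"
          by auto
        then obtain T where T: "finite T" "card T = CARD('n)" "T \<subseteq> killers u j"
          using infinite_arbitrarily_large[of "killers u j" "CARD('n)"] obtain_subset_with_card_n[of "CARD('n)" "killers u j"] by metis
        then have "X x u \<in> B (j + 1)" for x
          by (intro var_scale_mem_if_lin_scale_mem[OF less.prems T(1,2)]) (auto simp: killers_def)
        then show False
          using nosocle(3)[OF u] by blast
      qed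
      obtain u j where u: "u \<in> gr j" "u \<notin> B j"
        and max: "\<And>v i. v \<in> gr i \<Longrightarrow> v \<notin> B i \<Longrightarrow> card (killers v i) \<le> card (killers u j)"
      proof -
        let ?P = "\<lambda>(u, j). u \<in> gr j \<and> u \<notin> B j"
        have "\<exists>z. ?P z \<and> (\<forall>y. ?P y \<longrightarrow> (\<lambda>(u, j). card (killers u j)) y \<le> (\<lambda>(u, j). card (killers u j)) z)"
          using nosocle few by (intro ex_has_greatest_nat[of ?P "(u, j)" _ "CARD('n)"]) (auto intro: less_imp_le)
        then obtain u j where "?P (u, j)" and "\<forall>y. ?P y \<longrightarrow> (\<lambda>(u, j). card (killers u j)) y \<le> card (killers u j)"
          by auto
        then show thesis
          using that[of u j] by auto
      qed
      obtain \<Gamma> J where \<Gamma>: "finite \<Gamma>" "\<And>c i. c \<notin> \<Gamma> \<Longrightarrow> i \<ge> J \<Longrightarrow> inj_mod (lin c) 1 (add_cyclic u j B) i"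
        using step[OF u] by blast
      show ?thesis
      proof (intro exI conjI allI impI)
        show "finite (\<Gamma> \<union> killers u j)"
          using \<Gamma>(1) few[OF u] by simp
        fix c i assume c: "c \<notin> \<Gamma> \<union> killers u j" and i: "J \<le> i"
        show "inj_mod (lin c) 1 B i"
          unfolding inj_mod_def
        proof (intro ballI impI)
          fix v assume v: "v \<in> gr i" "scale (lin c) v \<in> B (i + 1)"
          then have "v \<in> add_cyclic u j B i"
            using \<Gamma>(2)[of c i] c i submod_add_cyclic(2)[OF less.prems u(1)] by (auto simp: inj_mod_def)
          then obtain p a where pa: "v = scale p u + a" "p \<in> forms (i - j)" "a \<in> B i"
            by (auto simp: add_cyclic_def)
          have pu: "scale p u \<in> gr i"
            using gr_scale[OF pa(2) u(1)] by simp
          have "scale (lin c) a \<in> B (1 + i)"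
            by (rule submodD(3)[OF less.prems lin_forms pa(3)])
          with v(2) have "scale (lin c) (scale p u + a) - scale (lin c) a \<in> B (i + 1)"
            unfolding pa(1) by (intro b(2)) (simp_all add: add.commute)
          then have c_kills: "c \<in> killers (scale p u) i"
            by (simp add: killers_def scale_right_distrib)
          \<comment> \<open>Now \<open>p u\<close> has more killers than \<open>u\<close>, namely also \<open>c\<close>, so it must be zero in \<open>M/B\<close>.\<close>
          have "killers u j \<subseteq> killers (scale p u) i"
          proof
            fix c' assume "c' \<in> killers u j"
            then have "scale (lin c') u \<in> B (j + 1)"
              by (simp add: killers_def)
            from submodD(3)[OF less.prems pa(2) this] have "scale p (scale (lin c') u) \<in> B (i + 1)"
              by (simp del: scale_scale)
            then show "c' \<in> killers (scale p u) i"
              by (simp add: killers_def mult.commute)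
          qed
          then have "insert c (killers u j) \<subseteq> killers (scale p u) i"
            using c_kills by blast
          moreover have "card (insert c (killers u j)) = Suc (card (killers u j))"
            using c few[OF u] by simp
          ultimately have "scale p u \<in> B i"
            using few[OF pu] max[OF pu] by (metis Suc_n_not_le_n card_mono le_trans)
          then show "v \<in> B i"
            using pa b(5) by simp
        qed
      qed
    qed
  qed
qed

corollary finite_bad_values:
  assumes "K.acc UNIV C" "submod B"
  shows "finite {c. \<not> (\<exists>J. \<forall>j\<ge>J. inj_mod (lin c ^ e) (int e) B j)}"
proof -
  obtain \<Gamma> J where \<Gamma>: "finite \<Gamma>" "\<And>c. c \<notin> \<Gamma> \<Longrightarrow> \<forall>j\<ge>J. inj_mod (lin c) 1 B j"
    using lin_generically_injective[OF assms] by blast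
  have "{c. \<not> (\<exists>J. \<forall>j\<ge>J. inj_mod (lin c ^ e) (int e) B j)} \<subseteq> \<Gamma>"
    using inj_mod_power[OF lin_forms \<Gamma>(2)] by blast
  then show ?thesis
    using \<Gamma>(1) finite_subset by blast
qed

end

lemma (in pregraded_module) seqsub_cong:
  "(\<And>k. k < i \<Longrightarrow> f k = g k) \<Longrightarrow> (\<And>k. k < i \<Longrightarrow> d k = e k) \<Longrightarrow> seqsub f d i = seqsub g e i"
  by (induction i) auto

text \<open>Powers of \<open>n\<close> independent linear forms generate an ideal that contains all forms of high
  degree. One exponent is raised at a time: \<open>\<ell>\<^sup>e\<close> times a high-degree element is rewritten once more
  with the old exponents.\<close>

lemma (in pregraded_module) powers_cofinite:
  assumes gens: "\<And>j. j > r \<Longrightarrow> acyclic_mod (\<lambda>_. {0}) 0 j" and c: "inj_on c {..<CARD('n)}"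
  shows "(\<And>k. k < CARD('n) \<Longrightarrow> e k \<ge> 1) \<Longrightarrow>
    \<exists>J. \<forall>j\<ge>J. gr j \<subseteq> seqsub (\<lambda>k. lin (c k) ^ e k) e CARD('n) j"
proof (induction "\<Sum>k<CARD('n). e k" arbitrary: e rule: less_induct)
  case (less e)
  let ?n = "CARD('n)"
  show ?case
  proof (cases "\<exists>i<?n. e i \<ge> 2")
    case False
    then have e1: "e k = 1" if "k < ?n" for k
      using less.prems[OF that] that by (metis One_nat_def Suc_1 Suc_leI le_antisym not_less)
    show ?thesis
    proof (intro exI allI impI subsetI)
      fix j u assume j: "r + 1 \<le> j" and u: "u \<in> gr j"
      obtain v where v: "\<And>x. v x \<in> gr (j - 1)" "u = (\<Sum>x\<in>UNIV. X x (v x))"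
        using gens[of j] j u unfolding koszul_exact_0_iff[OF gr_sub submod_graded_sub[OF submod_zero]] by auto
      have card: "finite (c ` {..<?n})" "card (c ` {..<?n}) = ?n"
        using c by (simp_all add: card_image)
      have "\<forall>x. \<exists>\<gamma>. (var x :: ('n, 'k) mpoly) = (\<Sum>z\<in>c ` {..<?n}. cst (\<gamma> z) * lin z)"
        using var_eq_sum_lin[OF card] by blast
      then obtain \<gamma> where \<gamma>: "\<And>x. (var x :: ('n, 'k) mpoly) = (\<Sum>z\<in>c ` {..<?n}. cst (\<gamma> x z) * lin z)"
        by metis
      have "u = (\<Sum>x\<in>UNIV. \<Sum>k<?n. scale (lin (c k)) (scale (cst (\<gamma> x (c k))) (v x)))"
        unfolding v(2)
      proof (rule sum.cong[OF refl])
        fix x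
        have "X x (v x) = (\<Sum>k<?n. scale (cst (\<gamma> x (c k)) * lin (c k)) (v x))"
          by (subst \<gamma>) (simp only: scale_sum_left sum.reindex[OF c] o_def)
        then show "X x (v x) = (\<Sum>k<?n. scale (lin (c k)) (scale (cst (\<gamma> x (c k))) (v x)))"
          by (simp add: mult.commute)
      qed
      also have "\<dots> = (\<Sum>k<?n. scale (lin (c k) ^ e k) (\<Sum>x\<in>UNIV. scale (cst (\<gamma> x (c k))) (v x)))"
        by (subst sum.swap) (simp add: scale_sum_right e1)
      finally show "u \<in> seqsub (\<lambda>k. lin (c k) ^ e k) e ?n j"
        unfolding seqsub_iff using e1 gr_scale[OF cst_forms v(1)]
        by (intro exI[of _ "\<lambda>k. \<Sum>x\<in>UNIV. scale (cst (\<gamma> x (c k))) (v x)"]) (auto intro: graded_sub_sum[OF gr_sub])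
    qed
  next
    case True
    then obtain i where i: "i < ?n" "e i \<ge> 2" by blast
    define e' where "e' = e(i := e i - 1)"
    have "(\<Sum>k<?n. e' k) < (\<Sum>k<?n. e k)"
      using i by (intro sum_strict_mono_ex1) (auto simp: e'_def)
    moreover have "e' k \<ge> 1" if "k < ?n" for k
      using less.prems[OF that] i by (auto simp: e'_def)
    ultimately obtain J where J: "\<And>j. j \<ge> J \<Longrightarrow> gr j \<subseteq> seqsub (\<lambda>k. lin (c k) ^ e' k) e' ?n j"
      using less.hyps[of e'] by blast
    show ?thesis
    proof (intro exI allI impI subsetI)
      fix j u assume j: "J + int (e i) \<le> j" and u: "u \<in> gr j"
      have "u \<in> seqsub (\<lambda>k. lin (c k) ^ e' k) e' ?n j"
        using J[of j] j u by auto
      then obtain v where v: "\<And>k. k < ?n \<Longrightarrow> v k \<in> gr (j - int (e' k))"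
        and uv: "u = (\<Sum>k<?n. scale (lin (c k) ^ e' k) (v k))"
        unfolding seqsub_iff by blast
      have "v i \<in> seqsub (\<lambda>k. lin (c k) ^ e' k) e' ?n (j - int (e' i))"
        using J[of "j - int (e' i)"] j v[OF i(1)] i(2) by (auto simp: e'_def)
      then obtain w where w: "\<And>k. k < ?n \<Longrightarrow> w k \<in> gr (j - int (e' i) - int (e' k))"
        and vw: "v i = (\<Sum>k<?n. scale (lin (c k) ^ e' k) (w k))"
        unfolding seqsub_iff by blast
      let ?l = "lin (c i) :: ('n, 'k) mpoly"
      \<comment> \<open>Substituting \<open>vw\<close> into \<open>uv\<close> produces the coefficient \<open>\<ell> ^ (2 (e i - 1))\<close> in front of \<open>w i\<close>; it
        is divisible by \<open>\<ell> ^ e i\<close> because \<open>e i \<ge> 2\<close>.\<close>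
      define y where "y k = (if k = i then scale (?l ^ (e i - 2)) (w i) else v k + scale (?l ^ e' i) (w k))" for k
      have rest: "(\<Sum>k\<in>{..<?n} - {i}. scale (lin (c k) ^ e k) (y k))
          = (\<Sum>k\<in>{..<?n} - {i}. scale (lin (c k) ^ e' k) (v k)) +
            scale (?l ^ e' i) (\<Sum>k\<in>{..<?n} - {i}. scale (lin (c k) ^ e' k) (w k))"
        unfolding scale_sum_right sum.distrib[symmetric]
        by (rule sum.cong) (auto simp: y_def e'_def scale_right_distrib mult.commute)
      have "e' i + e' i = e i + (e i - 2)"
        using i(2) by (simp add: e'_def)
      then have "?l ^ e' i * ?l ^ e' i = ?l ^ e i * ?l ^ (e i - 2)"
        by (simp only: power_add[symmetric])
      then have top: "scale (?l ^ e i) (y i) = scale (?l ^ e' i) (scale (?l ^ e' i) (w i))"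
        by (simp add: y_def)
      have "u = scale (?l ^ e' i) (v i) + (\<Sum>k\<in>{..<?n} - {i}. scale (lin (c k) ^ e' k) (v k))"
        unfolding uv using i(1) by (subst sum.remove[of _ i]) auto
      also have "v i = scale (?l ^ e' i) (w i) + (\<Sum>k\<in>{..<?n} - {i}. scale (lin (c k) ^ e' k) (w k))"
        unfolding vw using i(1) by (subst sum.remove[of _ i]) auto
      finally have "u = scale (?l ^ e i) (y i) + (\<Sum>k\<in>{..<?n} - {i}. scale (lin (c k) ^ e k) (y k))"
        unfolding rest top scale_right_distrib by (simp only: ac_simps)
      also have "\<dots> = (\<Sum>k<?n. scale (lin (c k) ^ e k) (y k))"
        using i(1) by (subst (2) sum.remove[of _ i]) auto
      finally have "u = (\<Sum>k<?n. scale (lin (c k) ^ e k) (y k))" .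
      moreover have "y k \<in> gr (j - int (e k))" if k: "k < ?n" for k
      proof (cases "k = i")
        case True
        have "scale (?l ^ (e i - 2)) (w i) \<in> gr (int (e i - 2) * 1 + (j - int (e' i) - int (e' i)))"
          by (rule gr_scale[OF forms_power[OF lin_forms] w[OF i(1)]])
        moreover have "int (e i - 2) * 1 + (j - int (e' i) - int (e' i)) = j - int (e i)"
          using i(2) by (simp add: e'_def)
        ultimately have "scale (?l ^ (e i - 2)) (w i) \<in> gr (j - int (e i))"
          by (simp only:)
        then show ?thesis
          using True by (simp add: y_def)
      next
        case False
        have "scale (?l ^ e' i) (w k) \<in> gr (int (e' i) * 1 + (j - int (e' i) - int (e' k)))"
          by (rule gr_scale[OF forms_power[OF lin_forms] w[OF k]])
        then show ?thesis
          using False v[OF k] graded_subD(5)[OF gr_sub] by (simp add: y_def e'_def)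
      qed
      ultimately show "u \<in> seqsub (\<lambda>k. lin (c k) ^ e k) e ?n j"
        unfolding seqsub_iff by blast
    qed
  qed
qed

text \<open>Vanishing of a graded piece of \<open>M/B\<close> is injectivity of the zero form, which makes the results
  on kernels applicable.\<close>

lemma (in pregraded_module) full_above_regularity:
  assumes B: "submod B" and reg: "reg_le B s" and fin: "\<forall>j\<ge>J. gr j \<subseteq> B j" and j: "j > s"
  shows "gr j \<subseteq> B j"
proof -
  have iff: "inj_mod 0 1 B j \<longleftrightarrow> gr j \<subseteq> B j" for j
    using graded_subD(1)[OF submod_graded_sub[OF B]] by (auto simp: inj_mod_def)
  have "\<forall>j>s. inj_mod 0 1 B j"
    using reg_le_adjoin(1)[OF B forms_zero _ reg, of 1 J] fin iff by simp
  then show ?thesis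
    using j iff by blast
qed

section \<open>Polynomial functions of the coefficients and open conditions\<close>

lemma mpoly_eval_superset:
  assumes "finite A" "Poly_Mapping.keys P \<subseteq> A"
  shows "mpoly_eval v P =
    (\<Sum>t\<in>A. Poly_Mapping.lookup P t * (\<Prod>x\<in>Poly_Mapping.keys t. v x ^ Poly_Mapping.lookup t x))"
  unfolding mpoly_eval_def using assms by (intro sum.mono_neutral_left) (auto simp: in_keys_iff)

lemma mpoly_eval_add: "mpoly_eval v (P + Q) = mpoly_eval v P + mpoly_eval v Q"
proof -
  let ?A = "Poly_Mapping.keys P \<union> Poly_Mapping.keys Q"
  have "mpoly_eval v (P + Q) = (\<Sum>t\<in>?A. Poly_Mapping.lookup (P + Q) t * (\<Prod>x\<in>Poly_Mapping.keys t. v x ^ Poly_Mapping.lookup t x))"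
    by (rule mpoly_eval_superset) (auto simp: keys_add)
  then show ?thesis
    by (simp add: mpoly_eval_superset[of ?A P] mpoly_eval_superset[of ?A Q] lookup_add distrib_right sum.distrib)
qed

lemma mpoly_eval_zero [simp]: "mpoly_eval v 0 = 0"
  by (simp add: mpoly_eval_def)

lemma mpoly_eval_single: "mpoly_eval v (Poly_Mapping.single t c) = c * (\<Prod>x\<in>Poly_Mapping.keys t. v x ^ Poly_Mapping.lookup t x)"
  by (subst mpoly_eval_superset[of "{t}"]) auto

lemma mpoly_eval_sum: "mpoly_eval v (sum P A) = (\<Sum>a\<in>A. mpoly_eval v (P a))"
  by (induction A rule: infinite_finite_induct) (simp_all add: mpoly_eval_add)

lemma prod_keys_add:
  fixes v :: "'x \<Rightarrow> 'k::comm_semiring_1" and s t :: "'x \<Rightarrow>\<^sub>0 nat"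
  shows "(\<Prod>x\<in>Poly_Mapping.keys (s + t). v x ^ Poly_Mapping.lookup (s + t) x) =
    (\<Prod>x\<in>Poly_Mapping.keys s. v x ^ Poly_Mapping.lookup s x) * (\<Prod>x\<in>Poly_Mapping.keys t. v x ^ Poly_Mapping.lookup t x)"
proof -
  let ?A = "Poly_Mapping.keys s \<union> Poly_Mapping.keys t"
  have *: "(\<Prod>x\<in>Poly_Mapping.keys r. v x ^ Poly_Mapping.lookup r x) = (\<Prod>x\<in>?A. v x ^ Poly_Mapping.lookup r x)"
    if "Poly_Mapping.keys r \<subseteq> ?A" for r
    using that by (intro prod.mono_neutral_left) (auto simp: in_keys_iff)
  show ?thesis
    by (subst (1 2 3) *) (auto simp: lookup_add power_add prod.distrib keys_add)
qed

lemma mpoly_eval_mult: "mpoly_eval v (P * Q) = mpoly_eval v P * mpoly_eval v Q"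
proof -
  have "P * Q = (\<Sum>s\<in>Poly_Mapping.keys P. \<Sum>t\<in>Poly_Mapping.keys Q.
      Poly_Mapping.single (s + t) (Poly_Mapping.lookup P s * Poly_Mapping.lookup Q t))"
    by (subst (1) mpoly_eq_sum_single[of P], subst (1) mpoly_eq_sum_single[of Q])
      (simp add: sum_product mult_single)
  then have "mpoly_eval v (P * Q) = (\<Sum>s\<in>Poly_Mapping.keys P. \<Sum>t\<in>Poly_Mapping.keys Q.
      Poly_Mapping.lookup P s * Poly_Mapping.lookup Q t *
      ((\<Prod>x\<in>Poly_Mapping.keys s. v x ^ Poly_Mapping.lookup s x) * (\<Prod>x\<in>Poly_Mapping.keys t. v x ^ Poly_Mapping.lookup t x)))"
    by (simp only: mpoly_eval_sum mpoly_eval_single prod_keys_add)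
  then show ?thesis
    by (simp only: mpoly_eval_def sum_product ac_simps)
qed

lemma mpoly_vars_add: "mpoly_vars (P + Q) \<subseteq> mpoly_vars P \<union> mpoly_vars Q"
  using keys_add[of P Q] by (auto simp: mpoly_vars_def)

lemma mpoly_vars_mult: "mpoly_vars (P * Q) \<subseteq> mpoly_vars P \<union> mpoly_vars Q"
  for P Q :: "('x, 'k::comm_semiring_1) mpoly"
proof
  fix x assume "x \<in> mpoly_vars (P * Q)"
  then obtain r where "r \<in> Poly_Mapping.keys (P * Q)" "x \<in> Poly_Mapping.keys r"
    by (auto simp: mpoly_vars_def)
  then obtain s t where "s \<in> Poly_Mapping.keys P" "t \<in> Poly_Mapping.keys Q" "x \<in> Poly_Mapping.keys (s + t)"
    using keys_mult[of P Q] by auto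
  then show "x \<in> mpoly_vars P \<union> mpoly_vars Q"
    using keys_add[of s t] by (auto simp: mpoly_vars_def)
qed

definition points :: "nat \<Rightarrow> (nat \<Rightarrow> nat) \<Rightarrow> (nat \<Rightarrow> ('n, 'k::zero) mpoly) set"
  where "points m d = {f. \<forall>i<m. f i \<in> forms (int (d i))}"

text \<open>Agreement with a polynomial is only required at the points: a function such as \<open>\<phi> (scale (f l) y)\<close>
  also depends on the coefficients of \<open>f l\<close> in other degrees, which vanish at the points.\<close>

definition polyfun :: "nat \<Rightarrow> (nat \<Rightarrow> nat) \<Rightarrow> ((nat \<Rightarrow> ('n, 'k::field) mpoly) \<Rightarrow> 'k) \<Rightarrow> bool"
  where "polyfun m d \<Phi> \<longleftrightarrow> (\<exists>P. mpoly_vars P \<subseteq> form_coords m d \<and>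
    (\<forall>f\<in>points m d. \<Phi> f = mpoly_eval (\<lambda>(i, t). Poly_Mapping.lookup (f i) t) P))"

lemma polyfun_cong: "polyfun m d \<Phi> \<Longrightarrow> (\<And>f. f \<in> points m d \<Longrightarrow> \<Psi> f = \<Phi> f) \<Longrightarrow> polyfun m d \<Psi>"
  by (auto simp: polyfun_def)

lemma polyfun_const: "polyfun m d (\<lambda>_. c)"
  unfolding polyfun_def
  by (intro exI[of _ "Poly_Mapping.single 0 c"]) (auto simp: mpoly_eval_single mpoly_vars_def split: if_splits)

lemma polyfun_coord:
  assumes "i < m" "mdeg t = d i"
  shows "polyfun m d (\<lambda>f. Poly_Mapping.lookup (f i) t)"
  unfolding polyfun_def using assms
  by (intro exI[of _ "var (i, t)"]) (auto simp: var_def mpoly_eval_single mpoly_vars_def form_coords_def split: if_splits)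

lemma polyfun_add: "polyfun m d \<Phi> \<Longrightarrow> polyfun m d \<Psi> \<Longrightarrow> polyfun m d (\<lambda>f. \<Phi> f + \<Psi> f)"
  unfolding polyfun_def
proof (elim exE conjE)
  fix P Q assume "mpoly_vars P \<subseteq> form_coords m d" "mpoly_vars Q \<subseteq> form_coords m d"
    and "\<forall>f\<in>points m d. \<Phi> f = mpoly_eval (\<lambda>(i, t). Poly_Mapping.lookup (f i) t) P"
    "\<forall>f\<in>points m d. \<Psi> f = mpoly_eval (\<lambda>(i, t). Poly_Mapping.lookup (f i) t) Q"
  then show "\<exists>P. mpoly_vars P \<subseteq> form_coords m d \<and>
      (\<forall>f\<in>points m d. \<Phi> f + \<Psi> f = mpoly_eval (\<lambda>(i, t). Poly_Mapping.lookup (f i) t) P)"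
    using mpoly_vars_add[of P Q] by (intro exI[of _ "P + Q"]) (auto simp: mpoly_eval_add)
qed

lemma polyfun_mult: "polyfun m d \<Phi> \<Longrightarrow> polyfun m d \<Psi> \<Longrightarrow> polyfun m d (\<lambda>f. \<Phi> f * \<Psi> f)"
  unfolding polyfun_def
proof (elim exE conjE)
  fix P Q assume "mpoly_vars P \<subseteq> form_coords m d" "mpoly_vars Q \<subseteq> form_coords m d"
    and "\<forall>f\<in>points m d. \<Phi> f = mpoly_eval (\<lambda>(i, t). Poly_Mapping.lookup (f i) t) P"
    "\<forall>f\<in>points m d. \<Psi> f = mpoly_eval (\<lambda>(i, t). Poly_Mapping.lookup (f i) t) Q"
  then show "\<exists>P. mpoly_vars P \<subseteq> form_coords m d \<and>
      (\<forall>f\<in>points m d. \<Phi> f * \<Psi> f = mpoly_eval (\<lambda>(i, t). Poly_Mapping.lookup (f i) t) P)"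
    using mpoly_vars_mult[of P Q] by (intro exI[of _ "P * Q"]) (auto simp: mpoly_eval_mult)
qed

lemma polyfun_sum: "(\<And>a. a \<in> A \<Longrightarrow> polyfun m d (\<Phi> a)) \<Longrightarrow> polyfun m d (\<lambda>f. \<Sum>a\<in>A. \<Phi> a f)"
  by (induction A rule: infinite_finite_induct) (auto intro: polyfun_const polyfun_add)

lemma polyfun_prod: "(\<And>a. a \<in> A \<Longrightarrow> polyfun m d (\<Phi> a)) \<Longrightarrow> polyfun m d (\<lambda>f. \<Prod>a\<in>A. \<Phi> a f)"
  by (induction A rule: infinite_finite_induct) (auto intro: polyfun_const polyfun_mult)

lemma polyfun_det:
  assumes "\<And>i j. i < N \<Longrightarrow> j < N \<Longrightarrow> polyfun m d (\<lambda>f. \<Phi> f i j)"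
  shows "polyfun m d (\<lambda>f. det (mat N N (\<lambda>(i, j). \<Phi> f i j)))"
proof -
  have "polyfun m d (\<lambda>f. \<Sum>p\<in>{p. p permutes {0..<N}}. signof p * (\<Prod>i = 0..<N. \<Phi> f i (p i)))"
  proof (intro polyfun_sum polyfun_mult polyfun_const polyfun_prod)
    fix p i assume "p \<in> {p. p permutes {0..<N}}" "i \<in> {0..<N}"
    then show "polyfun m d (\<lambda>f. \<Phi> f i (p i))"
      using permutes_in_image[of p "{0..<N}" i] by (intro assms) auto
  qed
  then show ?thesis
  proof (rule polyfun_cong)
    fix f
    have "(\<Prod>i = 0..<N. mat N N (\<lambda>(i, j). \<Phi> f i j) $$ (i, p i)) = (\<Prod>i = 0..<N. \<Phi> f i (p i))"
      if "p permutes {0..<N}" for p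
      using permutes_in_image[OF that] by (intro prod.cong) auto
    then show "det (mat N N (\<lambda>(i, j). \<Phi> f i j))
        = (\<Sum>p\<in>{p. p permutes {0..<N}}. signof p * (\<Prod>i = 0..<N. \<Phi> f i (p i)))"
      by (simp add: det_def)
  qed
qed

text \<open>A linear injection of a finite-dimensional space into itself is onto.\<close>

lemma (in vector_space) injective_endo_surjective:
  assumes T: "Vector_Spaces.linear scale scale T" and S: "subspace S" "finite G" "S \<subseteq> span G"
    and TS: "T ` S \<subseteq> S" and inj: "\<And>v. v \<in> S \<Longrightarrow> T v = 0 \<Longrightarrow> v = 0" and y: "y \<in> S"
  shows "y \<in> T ` S"
proof -
  interpret T: Vector_Spaces.linear scale scale T by (rule T)
  interpret P: vector_space_pair scale scale by unfold_locales
  obtain B where B: "B \<subseteq> S" "independent B" "S \<subseteq> span B"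
    using maximal_independent_subset by blast
  have spanB: "span B = S"
    using B span_minimal[OF B(1) S(1)] by blast
  have fin: "finite B"
    using independent_span_bound[OF S(2) B(2)] B(1) S(3) by blast
  have injB: "inj_on T (span B)"
  proof (rule inj_onI)
    fix u v assume uv: "u \<in> span B" "v \<in> span B" "T u = T v"
    then have "T (u - v) = 0" "u - v \<in> S"
      using subspace_diff[OF S(1)] by (auto simp: T.diff spanB)
    then show "u = v"
      using inj by fastforce
  qed
  have ind: "independent (T ` B)"
    using P.linear_independent_injective_image T B(2) injB by (metis P.linear_inj_on_span_independent_image)
  have card: "card (T ` B) = card B"
    using inj_on_subset[OF injB span_superset] by (rule card_image)
  have "y \<in> span (T ` B)"
  proof (rule ccontr)
    assume no: "y \<notin> span (T ` B)"
    then have "independent (insert y (T ` B))"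
      using ind by (rule independent_insertI)
    moreover have "insert y (T ` B) \<subseteq> span B"
      using y TS B(1) by (auto simp: spanB)
    ultimately have "card (insert y (T ` B)) \<le> card B"
      using independent_span_bound[OF fin] by blast
    moreover have "y \<notin> T ` B"
      using no span_base by blast
    ultimately show False
      using fin card by simp
  qed
  then show ?thesis
    using T.span_image[of B] spanB by auto
qed

text \<open>Exactness of \<open>U \<rightarrow> V \<rightarrow> W\<close> at \<open>V\<close> is an open condition for complexes that depend polynomially
  on a parameter: a splitting \<open>A \<circ> \<alpha> + \<beta> \<circ> B = id\<close> of the exact complex at one point defines an
  endomorphism \<open>A' \<circ> \<alpha> + \<beta> \<circ> B'\<close> of \<open>V\<close> at every point. It maps the kernel of \<open>B'\<close> into the image of \<open>A'\<close>,
  and wherever its determinant does not vanish it is onto the kernel, which is finite-dimensional.\<close>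

lemma exactness_is_open:
  fixes su :: "'k::field \<Rightarrow> 'u::ab_group_add \<Rightarrow> 'u" and sv :: "'k \<Rightarrow> 'v::ab_group_add \<Rightarrow> 'v"
    and sw :: "'k \<Rightarrow> 'w::ab_group_add \<Rightarrow> 'w"
    and A :: "(nat \<Rightarrow> ('n, 'k) mpoly) \<Rightarrow> 'u \<Rightarrow> 'v" and B :: "(nat \<Rightarrow> ('n, 'k) mpoly) \<Rightarrow> 'v \<Rightarrow> 'w"
  assumes linA: "\<And>f. Vector_Spaces.linear su sv (A f)" and linB: "\<And>f. Vector_Spaces.linear sv sw (B f)"
    and U: "module.subspace su U" and V: "module.subspace sv V" "finite G" "V \<subseteq> module.span sv G"
    and AV: "\<And>f u. f \<in> points m d \<Longrightarrow> u \<in> U \<Longrightarrow> A f u \<in> V"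
    and BA: "\<And>f u. f \<in> points m d \<Longrightarrow> u \<in> U \<Longrightarrow> B f (A f u) = 0"
    and polyA: "\<And>\<phi> u. Vector_Spaces.linear sv (*) \<phi> \<Longrightarrow> u \<in> U \<Longrightarrow> polyfun m d (\<lambda>f. \<phi> (A f u))"
    and polyB: "\<And>\<psi> v. Vector_Spaces.linear sw (*) \<psi> \<Longrightarrow> v \<in> V \<Longrightarrow> polyfun m d (\<lambda>f. \<psi> (B f v))"
    and f0: "f0 \<in> points m d" and exact: "\<And>v. v \<in> V \<Longrightarrow> B f0 v = 0 \<Longrightarrow> v \<in> A f0 ` U"
  shows "\<exists>\<Phi>. polyfun m d \<Phi> \<and> \<Phi> f0 \<noteq> 0 \<and>
    (\<forall>f\<in>points m d. \<Phi> f \<noteq> 0 \<longrightarrow> (\<forall>v\<in>V. B f v = 0 \<longrightarrow> v \<in> A f ` U))"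
proof -
  have "vector_space su" "vector_space sv" "vector_space sw"
    using linA[of f0] linB[of f0] by (auto simp: Vector_Spaces.linear_def)
  then interpret u: vector_space su + v: vector_space sv + w: vector_space sw .
  interpret A0: Vector_Spaces.linear su sv "A f0" by (rule linA)
  interpret B0: Vector_Spaces.linear sv sw "B f0" by (rule linB)
  interpret k: vector_space "(*) :: 'k \<Rightarrow> 'k \<Rightarrow> 'k"
    by unfold_locales (simp_all add: algebra_simps)
  interpret uv: vector_space_pair su sv by unfold_locales
  interpret vw: vector_space_pair sv sw by unfold_locales
  interpret vk: vector_space_pair sv "(*) :: 'k \<Rightarrow> 'k \<Rightarrow> 'k" by unfold_locales
  obtain \<alpha> where \<alpha>: "range \<alpha> \<subseteq> U" "Vector_Spaces.linear sv su \<alpha>" "\<And>v. v \<in> A f0 ` U \<Longrightarrow> A f0 (\<alpha> v) = v"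
    using uv.linear_exists_right_inverse_on[OF linA U] by blast
  obtain \<beta> where \<beta>: "range \<beta> \<subseteq> V" "Vector_Spaces.linear sw sv \<beta>" "\<And>w. w \<in> B f0 ` V \<Longrightarrow> B f0 (\<beta> w) = w"
    using vw.linear_exists_right_inverse_on[OF linB V(1)] by blast
  interpret \<alpha>: Vector_Spaces.linear sv su \<alpha> by (rule \<alpha>)
  interpret \<beta>: Vector_Spaces.linear sw sv \<beta> by (rule \<beta>)
  \<comment> \<open>The right inverse \<open>\<alpha>\<close> is only meaningful on the image of \<open>A f0\<close>, hence the projection
    \<open>v - \<beta> (B f0 v)\<close> onto the kernel of \<open>B f0\<close>.\<close>
  define \<Psi> where "\<Psi> f v = A f (\<alpha> (v - \<beta> (B f0 v))) + \<beta> (B f v)" for f v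
  have \<Psi>_lin: "Vector_Spaces.linear sv sv (\<Psi> f)" for f
  proof -
    interpret Af: Vector_Spaces.linear su sv "A f" by (rule linA)
    interpret Bf: Vector_Spaces.linear sv sw "B f" by (rule linB)
    have sv_diff: "sv c (v - w) = sv c v - sv c w" for c v w
      using v.scale_right_distrib[of c "v - w" w] by (simp add: eq_diff_eq)
    show ?thesis
      by unfold_locales
        (simp_all add: sv_diff \<Psi>_def Af.add Af.scale Bf.add Bf.scale B0.add B0.scale \<alpha>.diff \<alpha>.add \<alpha>.scale
          \<beta>.add \<beta>.scale Af.diff v.scale_right_distrib algebra_simps)
  qed
  have \<Psi>0: "\<Psi> f0 v = v" if v: "v \<in> V" for v
  proof -
    have "v - \<beta> (B f0 v) \<in> V"
      using v \<beta>(1) by (intro v.subspace_diff[OF V(1)]) auto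
    moreover have "B f0 (v - \<beta> (B f0 v)) = 0"
      using \<beta>(3) v by (simp add: B0.diff)
    ultimately have "A f0 (\<alpha> (v - \<beta> (B f0 v))) = v - \<beta> (B f0 v)"
      using exact \<alpha>(3) by blast
    then show ?thesis
      by (simp add: \<Psi>_def)
  qed
  have \<Psi>V: "\<Psi> f v \<in> V" if "f \<in> points m d" for f v
    unfolding \<Psi>_def using that \<alpha>(1) \<beta>(1) AV by (intro v.subspace_add[OF V(1)]) auto
  obtain Bs where Bs: "Bs \<subseteq> V" "v.independent Bs" "V \<subseteq> v.span Bs"
    using v.maximal_independent_subset by blast
  have finBs: "finite Bs"
    using v.independent_span_bound[OF V(2) Bs(2)] Bs(1) V(3) by blast
  define N where "N = card Bs"
  obtain e where e: "bij_betw e {..<N} Bs"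
    using ex_bij_betw_nat_finite[OF finBs] by (auto simp: N_def atLeast0LessThan)
  have eV: "e i \<in> V" if "i < N" for i
    using e Bs(1) that by (auto simp: bij_betw_def)
  define \<phi> where "\<phi> i = vk.construct Bs (\<lambda>b. if b = e i then 1 else 0)" for i
  have \<phi>_lin: "Vector_Spaces.linear sv (*) (\<phi> i)" for i
    unfolding \<phi>_def by (rule vk.linear_construct[OF Bs(2)])
  have \<phi>_e: "\<phi> i (e j) = (if i = j then 1 else 0)" if "i < N" "j < N" for i j
  proof -
    have "e j \<in> Bs" "e j = e i \<longleftrightarrow> i = j"
      using e that by (auto simp: bij_betw_def inj_on_def)
    then show ?thesis
      by (simp add: \<phi>_def vk.construct_basis[OF Bs(2)])
  qed
  have expand: "v = (\<Sum>j<N. sv (\<phi> j v) (e j))" if v: "v \<in> V" for v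
  proof -
    obtain c where "v = (\<Sum>b\<in>Bs. sv (c b) b)"
      using v Bs(3) v.span_finite[OF finBs] by blast
    then have c: "v = (\<Sum>j<N. sv (c (e j)) (e j))"
      using sum.reindex_bij_betw[OF e, of "\<lambda>b. sv (c b) b"] by simp
    have "\<phi> i v = c (e i)" if i: "i < N" for i
    proof -
      interpret \<phi>: Vector_Spaces.linear sv "(*)" "\<phi> i" by (rule \<phi>_lin)
      have "\<phi> i v = (\<Sum>j<N. c (e j) * \<phi> i (e j))"
        by (subst c) (simp add: \<phi>.sum \<phi>.scale)
      also have "\<dots> = (\<Sum>j<N. if i = j then c (e j) else 0)"
        using \<phi>_e[OF i] by (intro sum.cong) auto
      finally show ?thesis using i by simp
    qed
    then show ?thesis
      by (subst c) simp
  qed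
  define \<Phi> where "\<Phi> f = det (mat N N (\<lambda>(i, j). \<phi> i (\<Psi> f (e j))))" for f
  have "polyfun m d \<Phi>"
    unfolding \<Phi>_def
  proof (rule polyfun_det)
    fix i j assume ij: "i < N" "j < N"
    interpret \<phi>: Vector_Spaces.linear sv "(*)" "\<phi> i" by (rule \<phi>_lin)
    have "Vector_Spaces.linear sw (*) (\<phi> i \<circ> \<beta>)"
      by (rule Vector_Spaces.linear_compose[OF \<beta>(2) \<phi>_lin])
    then have "polyfun m d (\<lambda>f. (\<phi> i \<circ> \<beta>) (B f (e j)))"
      by (rule polyB) (rule eV[OF ij(2)])
    moreover have "polyfun m d (\<lambda>f. \<phi> i (A f (\<alpha> (e j - \<beta> (B f0 (e j))))))"
      using \<alpha>(1) by (intro polyA \<phi>_lin) auto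
    ultimately show "polyfun m d (\<lambda>f. \<phi> i (\<Psi> f (e j)))"
      unfolding \<Psi>_def by (simp add: \<phi>.add polyfun_add)
  qed
  moreover have "\<Phi> f0 \<noteq> 0"
  proof -
    have "mat N N (\<lambda>(i, j). \<phi> i (\<Psi> f0 (e j))) = 1\<^sub>m N"
      by (rule eq_matI) (auto simp: \<Psi>0 eV \<phi>_e)
    then show ?thesis by (simp add: \<Phi>_def)
  qed
  moreover have "v \<in> A f ` U" if f: "f \<in> points m d" and \<Phi>: "\<Phi> f \<noteq> 0" and v: "v \<in> V" and Bv: "B f v = 0" for f v
  proof -
    interpret Bf: Vector_Spaces.linear sv sw "B f" by (rule linB)
    interpret \<Psi>: Vector_Spaces.linear sv sv "\<Psi> f" by (rule \<Psi>_lin)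
    define S where "S = {v \<in> V. B f v = 0}"
    have inj: "v = 0" if v: "v \<in> V" and \<Psi>v: "\<Psi> f v = 0" for v
    proof -
      let ?M = "mat N N (\<lambda>(i, j). \<phi> i (\<Psi> f (e j)))"
      let ?c = "vec N (\<lambda>j. \<phi> j v)"
      have "?M *\<^sub>v ?c = 0\<^sub>v N"
      proof (rule eq_vecI)
        fix i assume "i < dim_vec (0\<^sub>v N :: 'k vec)"
        then have i: "i < N" by simp
        interpret \<phi>: Vector_Spaces.linear sv "(*)" "\<phi> i" by (rule \<phi>_lin)
        have "\<phi> i (\<Psi> f v) = (\<Sum>j<N. \<phi> j v * \<phi> i (\<Psi> f (e j)))"
          by (subst expand[OF v]) (simp add: \<Psi>.sum \<Psi>.scale \<phi>.sum \<phi>.scale)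
        then show "(?M *\<^sub>v ?c) $ i = 0\<^sub>v N $ i"
          using i \<Psi>v by (simp add: scalar_prod_def atLeast0LessThan mult.commute \<phi>.zero)
      qed simp
      moreover have "?M \<in> carrier_mat N N" "?c \<in> carrier_vec N"
        by simp_all
      ultimately have "?c = 0\<^sub>v N"
        using \<Phi> det_0_iff_vec_prod_zero_field[of ?M N] unfolding \<Phi>_def by blast
      then have "\<phi> j v = 0" if "j < N" for j
        using that by (metis index_vec index_zero_vec(1))
      then show ?thesis
        by (subst expand[OF v]) simp
    qed
    have "v \<in> \<Psi> f ` S"
    proof (rule v.injective_endo_surjective[OF \<Psi>_lin _ V(2)])
      show "v.subspace S"
        unfolding S_def v.subspace_def
        using v.subspace_add[OF V(1)] v.subspace_scale[OF V(1)] v.subspace_0[OF V(1)]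
        by (auto simp: Bf.add Bf.scale Bf.zero)
      show "S \<subseteq> v.span G"
        using V(3) by (auto simp: S_def)
      show "\<Psi> f ` S \<subseteq> S"
      proof
        fix y assume "y \<in> \<Psi> f ` S"
        then obtain z where z: "z \<in> V" "B f z = 0" "y = \<Psi> f z" by (auto simp: S_def)
        have "\<alpha> (z - \<beta> (B f0 z)) \<in> U"
          using \<alpha>(1) by auto
        then show "y \<in> S"
          using AV[OF f] z(2) BA[OF f] unfolding S_def z(3) by (simp add: \<Psi>_def \<beta>.zero)
      qed
      show "\<And>v. v \<in> S \<Longrightarrow> \<Psi> f v = 0 \<Longrightarrow> v = 0"
        using inj by (simp add: S_def)
      show "v \<in> S"
        using v Bv by (simp add: S_def)
    qed
    then obtain z where z: "B f z = 0" "v = \<Psi> f z" by (auto simp: S_def)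
    then have "v = A f (\<alpha> (z - \<beta> (B f0 z)))"
      by (simp add: \<Psi>_def \<beta>.zero)
    then show ?thesis
      using \<alpha>(1) by auto
  qed
  ultimately show ?thesis by blast
qed

lemma vector_space_fun: "vector_space s \<Longrightarrow> vector_space (\<lambda>c v i. s c (v i))"
  unfolding vector_space_def by (simp add: fun_eq_iff)

text \<open>Only the first \<open>m\<close> forms vary; the fixed forms \<open>G\<close> continue the sequence until the quotient
  vanishes in high degrees, as the criterion for bounded regularity requires.\<close>

definition extend :: "nat \<Rightarrow> (nat \<Rightarrow> 'a) \<Rightarrow> (nat \<Rightarrow> 'a) \<Rightarrow> nat \<Rightarrow> 'a"
  where "extend m G f k = (if k < m then f k else G k)"

context pregraded_module
begin

abbreviation kscale :: "'k \<Rightarrow> 'm \<Rightarrow> 'm"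
  where "kscale c \<equiv> scale (cst c)"

lemma polyfun_scale:
  assumes \<phi>: "Vector_Spaces.linear kscale (*) \<phi>"
  shows "polyfun m d (\<lambda>f. \<phi> (scale (extend m G f l) y))"
proof (cases "l < m")
  case False
  then show ?thesis
    by (simp add: extend_def polyfun_const)
next
  case True
  interpret \<phi>: Vector_Spaces.linear kscale "(*)" \<phi> by (rule \<phi>)
  let ?T = "{t :: 'n \<Rightarrow>\<^sub>0 nat. mdeg t = d l}"
  have "polyfun m d (\<lambda>f. \<Sum>t\<in>?T. Poly_Mapping.lookup (f l) t * \<phi> (scale (Poly_Mapping.single t 1) y))"
    using True by (intro polyfun_sum polyfun_mult polyfun_const polyfun_coord) auto
  then show ?thesis
  proof (rule polyfun_cong)
    fix f :: "nat \<Rightarrow> ('n, 'k) mpoly" assume "f \<in> points m d"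
    then have "f l \<in> forms (int (d l))"
      using True by (simp add: points_def)
    then have keys: "Poly_Mapping.keys (f l) \<subseteq> ?T"
      by (auto simp: forms_def)
    have "f l = (\<Sum>t\<in>?T. Poly_Mapping.single t (Poly_Mapping.lookup (f l) t))"
      by (subst mpoly_eq_sum_single)
        (use keys in \<open>auto intro!: sum.mono_neutral_left simp: finite_mdeg_eq in_keys_iff\<close>)
    also have "\<dots> = (\<Sum>t\<in>?T. cst (Poly_Mapping.lookup (f l) t) * Poly_Mapping.single t 1)"
      by (simp add: cst_def mult_single)
    finally have "scale (f l) y = (\<Sum>t\<in>?T. kscale (Poly_Mapping.lookup (f l) t) (scale (Poly_Mapping.single t 1) y))"
      by (metis (no_types, lifting) scale_scale scale_sum_left sum.cong)
    then show "\<phi> (scale (extend m G f l) y) = (\<Sum>t\<in>?T. Poly_Mapping.lookup (f l) t * \<phi> (scale (Poly_Mapping.single t 1) y))"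
      using True by (simp add: extend_def \<phi>.sum \<phi>.scale del: scale_scale)
  qed
qed

text \<open>Exactness, in one degree, of the Koszul complex on the forms \<open>f\<^sub>0, \<dots>, f\<^bsub>i-1\<^esub>\<close> in homological degree
  one. Injectivity of \<open>f\<^sub>i\<close> modulo \<open>B\<^sub>i\<close> refers to a submodule that varies with \<open>f\<close>; here the spaces are
  fixed and only the maps between them vary.\<close>

definition relations_trivial_at :: "(nat \<Rightarrow> ('n, 'k) mpoly) \<Rightarrow> (nat \<Rightarrow> nat) \<Rightarrow> nat \<Rightarrow> int \<Rightarrow> bool"
  where "relations_trivial_at f d i j \<longleftrightarrow>
    (\<forall>v. (\<forall>k<i. v k \<in> gr (j - int (d k))) \<longrightarrow> (\<Sum>k<i. scale (f k) (v k)) = 0 \<longrightarrow>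
      (\<exists>w. (\<forall>k<i. \<forall>l<i. w k l \<in> gr (j - int (d k) - int (d l))) \<and>
        (\<forall>k<i. v k = (\<Sum>l<i. scale (f l) (w k l - w l k)))))"

lemma gr_kscale: "u \<in> gr j \<Longrightarrow> kscale c u \<in> gr j"
  using gr_scale[OF cst_forms, of u j c] by simp

lemma subspace_gr: "K.subspace (gr j)"
  unfolding K.subspace_def by (auto simp: gr_zero gr_kscale intro: graded_subD(5)[OF gr_sub])

lemma finite_dimensional_tuples:
  fixes i :: nat and e :: "nat \<Rightarrow> int"
  assumes fin: "\<And>j. \<exists>G. finite G \<and> G \<subseteq> gr j \<and> gr j \<subseteq> K.span G"
  defines "fk \<equiv> (\<lambda>c v k. kscale c (v k)) :: 'k \<Rightarrow> (nat \<Rightarrow> 'm) \<Rightarrow> nat \<Rightarrow> 'm"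
  defines "V \<equiv> {v. (\<forall>k<i. v k \<in> gr (e k)) \<and> (\<forall>k\<ge>i. v k = 0)}"
  shows "module.subspace fk V" "\<exists>G. finite G \<and> V \<subseteq> module.span fk G"
proof -
  interpret F: vector_space fk
    unfolding fk_def by (rule vector_space_fun) (rule K.vector_space_axioms)
  show "F.subspace V"
    unfolding F.subspace_def V_def
    by (auto simp: fk_def gr_zero gr_kscale intro: graded_subD(5)[OF gr_sub])
  have "\<forall>k. \<exists>G. finite G \<and> gr (e k) \<subseteq> K.span G"
    using fin by blast
  from choice[OF this] obtain G where G: "\<And>k. finite (G k)" "\<And>k. gr (e k) \<subseteq> K.span (G k)"
    by blast
  define inj where "inj k z = (\<lambda>l. if l = k then z else 0)" for k :: nat and z :: 'm
  have inj_lin: "Vector_Spaces.linear kscale fk (inj k)" for k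
    by unfold_locales (auto simp: inj_def fk_def fun_eq_iff)
  have "V \<subseteq> F.span (\<Union>k<i. inj k ` G k)"
  proof
    fix v assume v: "v \<in> V"
    have "v = (\<Sum>k<i. inj k (v k))"
    proof
      fix l
      have "(\<Sum>k<i. inj k (v k) l) = (if l < i then v l else 0)"
        by (simp add: inj_def)
      then show "v l = (\<Sum>k<i. inj k (v k)) l"
        using v by (simp add: sum_fun_apply V_def)
    qed
    moreover have "inj k (v k) \<in> F.span (\<Union>k<i. inj k ` G k)" if "k < i" for k
    proof -
      interpret L: Vector_Spaces.linear kscale fk "inj k" by (rule inj_lin)
      have "v k \<in> K.span (G k)"
        using v G(2) that by (auto simp: V_def)
      then have "inj k (v k) \<in> F.span (inj k ` G k)"
        using L.span_image[of "G k"] by blast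
      then show ?thesis
        using F.span_mono[of "inj k ` G k" "\<Union>k<i. inj k ` G k"] that by blast
    qed
    ultimately show "v \<in> F.span (\<Union>k<i. inj k ` G k)"
      using F.span_sum[of "{..<i}" "\<lambda>k. inj k (v k)"] by (metis (no_types, lifting) lessThan_iff)
  qed
  then show "\<exists>G. finite G \<and> V \<subseteq> F.span G"
    using G(1) by (intro exI[of _ "\<Union>k<i. inj k ` G k"]) simp
qed

text \<open>The trivial relations and the evaluation of a relation form a complex for all \<open>f\<close>, to which
  \<open>exactness_is_open\<close> applies.\<close>

lemma relations_trivial_open:
  assumes fin: "\<And>j. \<exists>G. finite G \<and> G \<subseteq> gr j \<and> gr j \<subseteq> K.span G"
    and d: "\<And>k. k < m \<Longrightarrow> d' k = d k" and G: "\<And>k. m \<le> k \<Longrightarrow> k < i \<Longrightarrow> G k \<in> forms (int (d' k))"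
    and f0: "f0 \<in> points m d" and triv: "relations_trivial_at (extend m G f0) d' i j"
  shows "\<exists>\<Phi>. polyfun m d \<Phi> \<and> \<Phi> f0 \<noteq> 0 \<and>
    (\<forall>f\<in>points m d. \<Phi> f \<noteq> 0 \<longrightarrow> relations_trivial_at (extend m G f) d' i j)"
proof -
  define su where "su = (\<lambda>c (w :: nat \<times> nat \<Rightarrow> 'm) p. kscale c (w p))"
  define sv where "sv = (\<lambda>c (v :: nat \<Rightarrow> 'm) k. kscale c (v k))"
  define A where "A f w k = (if k < i then \<Sum>l<i. scale (extend m G f l) (w (k, l) - w (l, k)) else 0)"
    for f and w :: "nat \<times> nat \<Rightarrow> 'm" and k
  define B where "B f v = (\<Sum>k<i. scale (extend m G f k) (v k))" for f and v :: "nat \<Rightarrow> 'm"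
  define U where "U = {w. \<forall>k<i. \<forall>l<i. w (k, l) \<in> gr (j - int (d' k) - int (d' l))}"
  define V where "V = {v. (\<forall>k<i. v k \<in> gr (j - int (d' k))) \<and> (\<forall>k\<ge>i. v k = 0)}"
  have vs: "vector_space su" "vector_space sv"
    unfolding su_def sv_def using K.vector_space_axioms by (auto intro: vector_space_fun)
  interpret su: vector_space su + sv: vector_space sv by (fact vs)+
  have F: "extend m G f k \<in> forms (int (d' k))" if "f \<in> points m d" "k < i" for f k
    using that d G by (auto simp: extend_def points_def)
  have V: "sv.subspace V" "\<exists>G. finite G \<and> V \<subseteq> sv.span G"
    unfolding V_def sv_def
    by (rule finite_dimensional_tuples(1)[OF fin], rule finite_dimensional_tuples(2)[OF fin])
  have triv_iff: "relations_trivial_at (extend m G f) d' i j \<longleftrightarrow> (\<forall>v\<in>V. B f v = 0 \<longrightarrow> v \<in> A f ` U)" for f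
  proof
    assume R: "relations_trivial_at (extend m G f) d' i j"
    show "\<forall>v\<in>V. B f v = 0 \<longrightarrow> v \<in> A f ` U"
    proof (intro ballI impI)
      fix v assume v: "v \<in> V" "B f v = 0"
      then obtain w where w: "\<forall>k<i. \<forall>l<i. w k l \<in> gr (j - int (d' k) - int (d' l))"
        "\<forall>k<i. v k = (\<Sum>l<i. scale (extend m G f l) (w k l - w l k))"
        using R unfolding relations_trivial_at_def V_def B_def by blast
      have "v = A f (\<lambda>(k, l). w k l)"
        using v(1) w(2) by (auto simp: A_def V_def fun_eq_iff)
      moreover have "(\<lambda>(k, l). w k l) \<in> U"
        using w(1) by (simp add: U_def)
      ultimately show "v \<in> A f ` U" by blast
    qed
  next
    assume E: "\<forall>v\<in>V. B f v = 0 \<longrightarrow> v \<in> A f ` U"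
    show "relations_trivial_at (extend m G f) d' i j"
      unfolding relations_trivial_at_def
    proof (intro allI impI)
      fix v assume v: "\<forall>k<i. v k \<in> gr (j - int (d' k))" "(\<Sum>k<i. scale (extend m G f k) (v k)) = 0"
      define v' where "v' k = (if k < i then v k else 0)" for k
      have "v' \<in> V" "B f v' = 0"
        using v by (auto simp: v'_def V_def B_def)
      then obtain w where w: "w \<in> U" "v' = A f w"
        using E by blast
      have "v k = (\<Sum>l<i. scale (extend m G f l) (w (k, l) - w (l, k)))" if "k < i" for k
        using fun_cong[OF w(2), of k] that by (simp add: v'_def A_def)
      then show "\<exists>w. (\<forall>k<i. \<forall>l<i. w k l \<in> gr (j - int (d' k) - int (d' l))) \<and>
          (\<forall>k<i. v k = (\<Sum>l<i. scale (extend m G f l) (w k l - w l k)))"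
        using w(1) by (intro exI[of _ "\<lambda>k l. w (k, l)"]) (simp add: U_def)
    qed
  qed
  obtain Gs where Gs: "finite Gs" "V \<subseteq> sv.span Gs"
    using V(2) by blast
  have "\<exists>\<Phi>. polyfun m d \<Phi> \<and> \<Phi> f0 \<noteq> 0 \<and>
    (\<forall>f\<in>points m d. \<Phi> f \<noteq> 0 \<longrightarrow> (\<forall>v\<in>V. B f v = 0 \<longrightarrow> v \<in> A f ` U))"
  proof (rule exactness_is_open[where su = su and sv = sv and sw = kscale, OF _ _ _ V(1) Gs])
    show "Vector_Spaces.linear su sv (A f)" for f
      by unfold_locales
        (auto simp: su_def sv_def A_def fun_eq_iff scale_right_distrib scale_right_diff_distrib sum.distrib
          sum_subtractf scale_sum_right mult.commute)
    show "Vector_Spaces.linear sv kscale (B f)" for f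
      by unfold_locales (auto simp: sv_def B_def scale_right_distrib sum.distrib scale_sum_right mult.commute)
    show "su.subspace U"
      unfolding su.subspace_def U_def
      by (auto simp: su_def gr_zero gr_kscale intro: graded_subD(5)[OF gr_sub])
    show "A f u \<in> V" if f: "f \<in> points m d" and u: "u \<in> U" for f u
    proof -
      have "scale (extend m G f l) (u (k, l) - u (l, k)) \<in> gr (j - int (d' k))" if "k < i" "l < i" for k l
      proof -
        have "u (k, l) - u (l, k) \<in> gr (j - int (d' k) - int (d' l))"
          using u that by (intro gr_diff) (auto simp: U_def algebra_simps)
        from gr_scale[OF F[OF f that(2)] this] show ?thesis by simp
      qed
      then show ?thesis
        by (auto simp: V_def A_def intro!: graded_sub_sum[OF gr_sub])
    qed
    show "B f (A f u) = 0" if "f \<in> points m d" "u \<in> U" for f u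
    proof -
      let ?g = "\<lambda>k l. scale (extend m G f k * extend m G f l) (u (k, l))"
      have "B f (A f u) = (\<Sum>k<i. \<Sum>l<i. ?g k l - ?g l k)"
        by (simp add: B_def A_def scale_sum_right scale_right_diff_distrib mult.commute)
      also have "\<dots> = (\<Sum>k<i. \<Sum>l<i. ?g k l) - (\<Sum>k<i. \<Sum>l<i. ?g l k)"
        by (simp only: sum_subtractf)
      also have "(\<Sum>k<i. \<Sum>l<i. ?g l k) = (\<Sum>k<i. \<Sum>l<i. ?g k l)"
        by (rule sum.swap)
      finally show ?thesis by simp
    qed
    show "polyfun m d (\<lambda>f. \<phi> (A f u))" if \<phi>: "Vector_Spaces.linear sv (*) \<phi>" and u: "u \<in> U" for \<phi> u
    proof -
      interpret \<phi>: Vector_Spaces.linear sv "(*)" \<phi> by (rule \<phi>)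
      define inj where "inj k z = (\<lambda>l. if l = k then z else 0)" for k :: nat and z :: 'm
      have "Vector_Spaces.linear kscale sv (inj k)" for k
        by unfold_locales (auto simp: inj_def sv_def fun_eq_iff)
      then have lin: "Vector_Spaces.linear kscale (*) (\<phi> \<circ> inj k)" for k
        by (rule Vector_Spaces.linear_compose[OF _ \<phi>])
      have "A f u = (\<Sum>k<i. \<Sum>l<i. inj k (scale (extend m G f l) (u (k, l) - u (l, k))))" for f
      proof
        fix k'
        have "(\<Sum>l<i. inj k (scale (extend m G f l) (u (k, l) - u (l, k))) k') =
            (if k' = k then \<Sum>l<i. scale (extend m G f l) (u (k, l) - u (l, k)) else 0)" for k
          by (simp add: inj_def)
        then show "A f u k' = (\<Sum>k<i. \<Sum>l<i. inj k (scale (extend m G f l) (u (k, l) - u (l, k)))) k'"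
          by (simp add: A_def sum_fun_apply)
      qed
      then have "\<phi> (A f u) = (\<Sum>k<i. \<Sum>l<i. (\<phi> \<circ> inj k) (scale (extend m G f l) (u (k, l) - u (l, k))))" for f
        by (simp add: \<phi>.sum)
      then show ?thesis
        using polyfun_scale[OF lin] by (simp only: polyfun_sum)
    qed
    show "polyfun m d (\<lambda>f. \<psi> (B f v))" if \<psi>: "Vector_Spaces.linear kscale (*) \<psi>" and v: "v \<in> V" for \<psi> v
    proof -
      interpret \<psi>: Vector_Spaces.linear kscale "(*)" \<psi> by (rule \<psi>)
      show ?thesis
        unfolding B_def \<psi>.sum by (intro polyfun_sum polyfun_scale \<psi>)
    qed
    show "f0 \<in> points m d" by (rule f0)
    show "v \<in> A f0 ` U" if "v \<in> V" "B f0 v = 0" for v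
      using triv that unfolding triv_iff by blast
  qed
  then show ?thesis
    by (simp only: triv_iff)
qed

text \<open>The case of a complex \<open>U \<rightarrow> gr j \<rightarrow> 0\<close>: being onto is an open condition.\<close>

lemma full_piece_open:
  assumes fin: "\<And>j. \<exists>G. finite G \<and> G \<subseteq> gr j \<and> gr j \<subseteq> K.span G"
    and d: "\<And>k. k < m \<Longrightarrow> d' k = d k" and G: "\<And>k. m \<le> k \<Longrightarrow> k < i \<Longrightarrow> G k \<in> forms (int (d' k))"
    and f0: "f0 \<in> points m d" and full: "gr j \<subseteq> seqsub (extend m G f0) d' i j"
  shows "\<exists>\<Phi>. polyfun m d \<Phi> \<and> \<Phi> f0 \<noteq> 0 \<and>
    (\<forall>f\<in>points m d. \<Phi> f \<noteq> 0 \<longrightarrow> gr j \<subseteq> seqsub (extend m G f) d' i j)"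
proof -
  define su where "su = (\<lambda>c (v :: nat \<Rightarrow> 'm) k. kscale c (v k))"
  define A where "A f v = (\<Sum>k<i. scale (extend m G f k) (v k))" for f and v :: "nat \<Rightarrow> 'm"
  define B where "B f v = (0 :: 'm)" for f :: "nat \<Rightarrow> ('n, 'k) mpoly" and v :: 'm
  define U where "U = {v. (\<forall>k<i. v k \<in> gr (j - int (d' k))) \<and> (\<forall>k\<ge>i. v k = 0)}"
  have "vector_space su"
    unfolding su_def using K.vector_space_axioms by (auto intro: vector_space_fun)
  then interpret su: vector_space su .
  have F: "extend m G f k \<in> forms (int (d' k))" if "f \<in> points m d" "k < i" for f k
    using that d G by (auto simp: extend_def points_def)
  have mem_iff: "u \<in> seqsub (extend m G f) d' i j \<longleftrightarrow> u \<in> A f ` U" for f u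
  proof
    assume "u \<in> seqsub (extend m G f) d' i j"
    then obtain v where v: "\<forall>k<i. v k \<in> gr (j - int (d' k))" "u = (\<Sum>k<i. scale (extend m G f k) (v k))"
      unfolding seqsub_iff by blast
    then have "u = A f (\<lambda>k. if k < i then v k else 0)" "(\<lambda>k. if k < i then v k else 0) \<in> U"
      by (auto simp: A_def U_def)
    then show "u \<in> A f ` U" by blast
  next
    assume "u \<in> A f ` U"
    then show "u \<in> seqsub (extend m G f) d' i j"
      unfolding seqsub_iff by (auto simp: A_def U_def)
  qed
  obtain Gs where Gs: "finite Gs" "gr j \<subseteq> K.span Gs"
    using fin by blast
  have "\<exists>\<Phi>. polyfun m d \<Phi> \<and> \<Phi> f0 \<noteq> 0 \<and>
    (\<forall>f\<in>points m d. \<Phi> f \<noteq> 0 \<longrightarrow> (\<forall>v\<in>gr j. B f v = 0 \<longrightarrow> v \<in> A f ` U))"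
  proof (rule exactness_is_open[where su = su and sv = kscale and sw = kscale, OF _ _ _ subspace_gr Gs])
    show "Vector_Spaces.linear su kscale (A f)" for f
      by unfold_locales (auto simp: su_def A_def scale_right_distrib sum.distrib scale_sum_right mult.commute)
    show "Vector_Spaces.linear kscale kscale (B f)" for f
      by unfold_locales (auto simp: B_def)
    show "su.subspace U"
      unfolding su.subspace_def U_def
      by (auto simp: su_def gr_zero gr_kscale intro: graded_subD(5)[OF gr_sub])
    show "A f u \<in> gr j" if f: "f \<in> points m d" and u: "u \<in> U" for f u
    proof -
      have "scale (extend m G f k) (u k) \<in> gr j" if "k < i" for k
        using gr_scale[OF F[OF f that], of "u k" "j - int (d' k)"] u that by (simp add: U_def)
      then show ?thesis
        by (auto simp: A_def intro!: graded_sub_sum[OF gr_sub])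
    qed
    show "polyfun m d (\<lambda>f. \<phi> (A f u))" if \<phi>: "Vector_Spaces.linear kscale (*) \<phi>" for \<phi> u
    proof -
      interpret \<phi>: Vector_Spaces.linear kscale "(*)" \<phi> by (rule \<phi>)
      show ?thesis
        unfolding A_def \<phi>.sum by (intro polyfun_sum polyfun_scale \<phi>)
    qed
    show "polyfun m d (\<lambda>f. \<psi> (B f v))" for \<psi> v
      by (simp add: B_def polyfun_const)
    show "f0 \<in> points m d" by (rule f0)
    show "v \<in> A f0 ` U" if "v \<in> gr j" for v
      using full that mem_iff by blast
  qed (simp add: B_def)
  then show ?thesis
    using mem_iff by (auto simp: B_def subset_iff)
qed

lemma inj_mod_if_relations_trivial_at:
  assumes "relations_trivial_at f d (Suc i) (j + int (d i))"
  shows "inj_mod (f i) (int (d i)) (seqsub f d i) j"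
  using assms unfolding relations_trivial_at_def by (intro inj_mod_if_relations_trivial) blast

text \<open>The conclusion of the criterion for bounded regularity holds on a Zariski-open neighbourhood of
  any point that, after adding fixed forms, becomes filter-regular with quotient of finite length.\<close>

theorem filter_regular_is_open:
  assumes fin: "\<And>j. \<exists>G. finite G \<and> G \<subseteq> gr j \<and> gr j \<subseteq> K.span G"
    and dd: "\<And>k. k < m \<Longrightarrow> d' k = d k" and d: "\<And>k. k < e \<Longrightarrow> d' k \<ge> 1" and me: "m \<le> e"
    and g: "\<And>k. k < e \<Longrightarrow> g k \<in> forms (int (d' k))"
    and reg: "reg_le (\<lambda>_. {0}) r"
    and inj: "\<And>i. i < e \<Longrightarrow> \<exists>J. \<forall>j\<ge>J. inj_mod (g i) (int (d' i)) (seqsub g d' i) j"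
    and cof: "\<exists>J. \<forall>j\<ge>J. gr j \<subseteq> seqsub g d' e j"
  shows "\<exists>\<Phi>. polyfun m d \<Phi> \<and> \<Phi> g \<noteq> 0 \<and> (\<forall>f\<in>points m d. \<Phi> f \<noteq> 0 \<longrightarrow>
    (\<forall>i\<le>m. reg_le (seqsub f d i) (shift r d i)) \<and>
    (\<forall>i<m. \<forall>j>shift r d i. inj_mod (f i) (int (d i)) (seqsub f d i) j))"
proof -
  have gg: "extend m g g = g"
    by (auto simp: extend_def)
  have "g k \<in> forms (int (d k))" if "k < m" for k
    using g[of k] dd[OF that] that me by simp
  then have g_pt: "g \<in> points m d"
    by (simp add: points_def)
  have reg_g: "reg_le (seqsub g d' e) (shift r d' e)"
    using reg_le_seqsub(1)[of e g d' r e] g d reg inj by blast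
  have inj_g: "inj_mod (g i) (int (d' i)) (seqsub g d' i) j" if "i < e" "j > shift r d' i" for i j
    using reg_le_seqsub(2)[of e g d' r i j] g d reg inj that by blast
  have sub: "submod (seqsub g d' e)"
    using g by (rule submod_seqsub)
  have triv: "relations_trivial_at g d' (Suc i) (shift r d' i + 1 + int (d' i))" if "i < e" for i
    unfolding relations_trivial_at_def
  proof (intro allI impI)
    fix v assume v: "\<forall>k<Suc i. v k \<in> gr (shift r d' i + 1 + int (d' i) - int (d' k))"
      "(\<Sum>k<Suc i. scale (g k) (v k)) = 0"
    show "\<exists>w. (\<forall>k<Suc i. \<forall>l<Suc i. w k l \<in> gr (shift r d' i + 1 + int (d' i) - int (d' k) - int (d' l))) \<and>
        (\<forall>k<Suc i. v k = (\<Sum>l<Suc i. scale (g l) (w k l - w l k)))"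
      by (rule relations_trivial[where e = e and r = r]) (use that v g d inj_g in auto)
  qed
  have "\<exists>\<Phi>. polyfun m d \<Phi> \<and> \<Phi> g \<noteq> 0 \<and> (\<forall>f\<in>points m d. \<Phi> f \<noteq> 0 \<longrightarrow>
      relations_trivial_at (extend m g f) d' (Suc i) (shift r d' i + 1 + int (d' i)))" if "i < e" for i
    using that g dd by (intro relations_trivial_open[OF fin _ _ g_pt]) (auto simp: gg triv)
  then obtain \<Phi> where \<Phi>: "\<And>i. i < e \<Longrightarrow> polyfun m d (\<Phi> i)" "\<And>i. i < e \<Longrightarrow> \<Phi> i g \<noteq> 0"
    "\<And>i f. i < e \<Longrightarrow> f \<in> points m d \<Longrightarrow> \<Phi> i f \<noteq> 0 \<Longrightarrow>
      relations_trivial_at (extend m g f) d' (Suc i) (shift r d' i + 1 + int (d' i))"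
    by metis
  obtain J where J: "\<forall>j\<ge>J. gr j \<subseteq> seqsub g d' e j"
    using cof by blast
  have "gr (shift r d' e + 1) \<subseteq> seqsub g d' e (shift r d' e + 1)"
    by (rule full_above_regularity[OF sub reg_g J]) simp
  then have "\<exists>\<Phi>. polyfun m d \<Phi> \<and> \<Phi> g \<noteq> 0 \<and>
      (\<forall>f\<in>points m d. \<Phi> f \<noteq> 0 \<longrightarrow> gr (shift r d' e + 1) \<subseteq> seqsub (extend m g f) d' e (shift r d' e + 1))"
    using g dd by (intro full_piece_open[OF fin _ _ g_pt]) (auto simp: gg)
  then obtain \<Phi>' where \<Phi>': "polyfun m d \<Phi>'" "\<Phi>' g \<noteq> 0"
    "\<And>f. f \<in> points m d \<Longrightarrow> \<Phi>' f \<noteq> 0 \<Longrightarrow> gr (shift r d' e + 1) \<subseteq> seqsub (extend m g f) d' e (shift r d' e + 1)"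
    by blast
  show ?thesis
  proof (intro exI conjI ballI impI)
    show "polyfun m d (\<lambda>f. \<Phi>' f * (\<Prod>i<e. \<Phi> i f))"
      using \<Phi> \<Phi>' by (intro polyfun_mult polyfun_prod) auto
    show "\<Phi>' g * (\<Prod>i<e. \<Phi> i g) \<noteq> 0"
      using \<Phi> \<Phi>' by simp
    fix f assume f: "f \<in> points m d" and "\<Phi>' f * (\<Prod>i<e. \<Phi> i f) \<noteq> 0"
    then have nz: "\<Phi>' f \<noteq> 0" "\<And>i. i < e \<Longrightarrow> \<Phi> i f \<noteq> 0"
      by auto
    let ?h = "extend m g f"
    have h: "?h k \<in> forms (int (d' k))" if "k < e" for k
      using that f g dd by (auto simp: extend_def points_def)
    have inj_h: "inj_mod (?h i) (int (d' i)) (seqsub ?h d' i) (shift r d' i + 1)" if "i < e" for i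
      by (rule inj_mod_if_relations_trivial_at) (rule \<Phi>(3)[OF that f nz(2)[OF that]])
    note last = \<Phi>'(3)[OF f nz(1)]
    have eq: "seqsub ?h d' i = seqsub f d i" "shift r d' i = shift r d i" if "i \<le> m" for i
      using that dd by (auto simp: extend_def shift_def intro!: seqsub_cong sum.cong)
    show "\<forall>i\<le>m. reg_le (seqsub f d i) (shift r d i)"
    proof (intro allI impI)
      fix i assume i: "i \<le> m"
      then have "reg_le (seqsub ?h d' i) (shift r d' i)"
        using reg_le_seqsub_criterion(1)[of e ?h d' r i] h d reg inj_h last me by simp
      then show "reg_le (seqsub f d i) (shift r d i)"
        using eq[OF i] by simp
    qed
    show "\<forall>i<m. \<forall>j>shift r d i. inj_mod (f i) (int (d i)) (seqsub f d i) j"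
    proof (intro allI impI)
      fix i j assume ij: "i < m" "shift r d i < j"
      then have "inj_mod (?h i) (int (d' i)) (seqsub ?h d' i) j"
        using reg_le_seqsub_criterion(2)[of e ?h d' r i j] h d reg inj_h last me eq(2)[of i] by simp
      then show "inj_mod (f i) (int (d i)) (seqsub f d i) j"
        using eq[of i] dd[of i] ij by (simp add: extend_def)
    qed
  qed
qed

end

section \<open>Graded free resolutions\<close>

lemma graded_module_pregraded: "graded_module scale gr \<Longrightarrow> pregraded_module scale gr"
  by (simp add: graded_module_def graded_module_axioms_def pregraded_module_def pregraded_module_axioms_def)

lemma decomposed_graded_module:
  assumes "graded_module scale gr"
  shows "\<exists>comp. decomposed_module scale gr UNIV comp"
proof -
  interpret graded_module scale gr by (rule assms)
  interpret pregraded_module scale gr by (rule graded_module_pregraded[OF assms])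
  let ?D = "\<lambda>x c. (\<forall>j. c j \<in> gr j) \<and> finite {j. c j \<noteq> 0} \<and> x = (\<Sum>j\<in>{j. c j \<noteq> 0}. c j)"
  define dec where "dec x = (THE c. ?D x c)" for x
  have dec: "?D x (dec x)" for x
    unfolding dec_def by (rule theI'[OF gr_direct_sum])
  have uniq: "dec x = c" if "\<And>j. c j \<in> gr j" "finite J" "\<And>j. j \<notin> J \<Longrightarrow> c j = 0" "x = (\<Sum>j\<in>J. c j)" for x c J
  proof -
    have sub: "{j. c j \<noteq> 0} \<subseteq> J"
      using that(3) by blast
    have "?D x c"
      using that finite_subset[OF sub] sum.mono_neutral_left[OF that(2) sub, of c] by auto
    then show ?thesis
      using gr_direct_sum dec by blast
  qed
  show ?thesis
  proof (intro exI[of _ "\<lambda>j x. dec x j"], unfold_locales)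
    show "dec u j \<in> gr j" for u j
      using dec[of u] by blast
    show "dec u j = (if i = j then u else 0)" if "u \<in> gr i" for u i j
    proof -
      have "dec u = (\<lambda>j. if i = j then u else 0)"
        by (rule uniq[of _ "{i}"]) (use that gr_zero in auto)
      then show ?thesis by simp
    qed
    show "\<exists>J. finite J \<and> (\<forall>j. j \<notin> J \<longrightarrow> dec u j = 0) \<and> u = (\<Sum>j\<in>J. dec u j)" for u
      using dec[of u] by (intro exI[of _ "{j. dec u j \<noteq> 0}"]) auto
    show "dec (u - v) j = dec u j - dec v j" for u v j
    proof -
      let ?J = "{j. dec u j \<noteq> 0} \<union> {j. dec v j \<noteq> 0}"
      have fin: "finite ?J"
        using dec[of u] dec[of v] by blast
      have "u = (\<Sum>j\<in>?J. dec u j)" "v = (\<Sum>j\<in>?J. dec v j)"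
        using dec[of u] dec[of v] fin
        by (metis (mono_tags, lifting) mem_Collect_eq DiffE Un_upper1 sum.mono_neutral_left,
            metis (mono_tags, lifting) mem_Collect_eq DiffE Un_upper2 sum.mono_neutral_left)
      then have "u - v = (\<Sum>j\<in>?J. dec u j - dec v j)"
        by (simp add: sum_subtractf)
      then have "dec (u - v) = (\<lambda>j. dec u j - dec v j)"
        using dec[of u] dec[of v] fin by (intro uniq[of _ ?J]) (auto intro: gr_diff)
      then show ?thesis by simp
    qed
  qed auto
qed

definition free_carrier :: "nat \<Rightarrow> (nat \<Rightarrow> ('n, 'k::zero) mpoly) set"
  where "free_carrier b = {v. \<forall>k\<ge>b. v k = 0}"

definition free_comp :: "(nat \<Rightarrow> int) \<Rightarrow> int \<Rightarrow> (nat \<Rightarrow> ('n, 'k::zero) mpoly) \<Rightarrow> nat \<Rightarrow> ('n, 'k) mpoly"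
  where "free_comp a j v = (\<lambda>k. hpart (j - a k) (v k))"

lemma hpart_diff: "hpart j (p - q) = hpart j p - hpart j q"
  for p q :: "('n, 'k::ab_group_add) mpoly"
  by (rule poly_mapping_eqI) (simp add: lookup_hpart lookup_minus)

lemma decomposed_free:
  "decomposed_module fscale (free_gr b a) (free_carrier b :: (nat \<Rightarrow> ('n::finite, 'k::field) mpoly) set) (free_comp a)"
proof (intro decomposed_module.intro decomposed_module_axioms.intro pregraded_free)
  fix u v :: "nat \<Rightarrow> ('n, 'k) mpoly" and p :: "('n, 'k) mpoly" and i j
  show "u \<in> free_gr b a j \<Longrightarrow> u \<in> free_carrier b"
    by (simp add: free_gr_def free_carrier_def)
  show "u \<in> free_carrier b \<Longrightarrow> v \<in> free_carrier b \<Longrightarrow> u - v \<in> free_carrier b"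
    "u \<in> free_carrier b \<Longrightarrow> fscale p u \<in> free_carrier b"
    by (simp_all add: free_carrier_def)
  show "u \<in> free_carrier b \<Longrightarrow> free_comp a j u \<in> free_gr b a j"
    by (simp add: free_carrier_def free_comp_def free_gr_def)
  show "free_comp a j (u - v) = free_comp a j u - free_comp a j v"
    by (rule ext) (simp add: free_comp_def hpart_diff)
  show "free_comp a j u = (if i = j then u else 0)" if "u \<in> free_gr b a i"
  proof
    fix k
    show "free_comp a j u k = (if i = j then u else 0) k"
      using that hpart_of_forms[of "u k" "i - a k" "j - a k"] by (simp add: free_comp_def free_gr_def)
  qed
  show "\<exists>J. finite J \<and> (\<forall>j. j \<notin> J \<longrightarrow> free_comp a j u = 0) \<and> u = (\<Sum>j\<in>J. free_comp a j u)"
    if u: "u \<in> free_carrier b"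
  proof -
    define J where "J = (\<Union>k<b. (\<lambda>i. i + a k) ` degs (u k))"
    have J: "i + a k \<in> J" if "i \<in> degs (u k)" for i k
    proof -
      have "k < b"
        using u that by (cases "k < b") (auto simp: free_carrier_def degs_def)
      then show ?thesis
        using that by (auto simp: J_def)
    qed
    have fin: "finite J"
      by (simp add: J_def)
    show ?thesis
    proof (intro exI conjI allI impI)
      show "finite J" by (rule fin)
      show "free_comp a j u = 0" if "j \<notin> J" for j
      proof
        fix k
        have "j - a k \<notin> degs (u k)"
          using that J[of "j - a k" k] by auto
        then show "free_comp a j u k = 0 k"
          by (simp add: free_comp_def hpart_eq_0)
      qed
      show "u = (\<Sum>j\<in>J. free_comp a j u)"
      proof
        fix k
        have "u k = (\<Sum>i\<in>(\<lambda>j. j - a k) ` J. hpart i (u k))"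
          using fin J by (intro mpoly_eq_sum_hpart) (force simp: image_iff)+
        also have "\<dots> = (\<Sum>j\<in>J. hpart (j - a k) (u k))"
          by (subst sum.reindex) (auto simp: inj_on_def)
        finally show "u k = (\<Sum>j\<in>J. free_comp a j u) k"
          by (simp add: sum_fun_apply free_comp_def)
      qed
    qed
  qed
qed

lemma decomposed_poly: "decomposed_module (*) forms (UNIV :: ('n::finite, 'k::field) mpoly set) hpart"
proof (intro decomposed_module.intro decomposed_module_axioms.intro poly.pregraded_module_axioms)
  fix u v :: "('n, 'k) mpoly" and i j
  show "hpart j (u - v) = hpart j u - hpart j v"
    by (rule hpart_diff)
  show "u \<in> forms i \<Longrightarrow> hpart j u = (if i = j then u else 0)"
    by (rule hpart_of_forms)
  show "\<exists>J. finite J \<and> (\<forall>j. j \<notin> J \<longrightarrow> hpart j u = 0) \<and> u = (\<Sum>j\<in>J. hpart j u)"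
    using mpoly_eq_sum_hpart[OF finite_degs order_refl, of u] by (intro exI[of _ "degs u"]) (auto simp: hpart_eq_0)
qed auto

lemma acc_poly: "poly.K.acc UNIV (UNIV :: ('n::finite, 'k::field) mpoly set)"
proof (rule poly.acc_if_finitely_generated)
  show "UNIV \<subseteq> poly.span {1 :: ('n, 'k) mpoly}"
  proof
    fix p :: "('n, 'k) mpoly"
    have "p * 1 \<in> poly.span {1}"
      by (intro poly.span_scale poly.span_base) simp
    then show "p \<in> poly.span {1}" by simp
  qed
qed simp

lemma acc_free:
  "operator_space.acc (\<lambda>c. fscale (cst c)) (\<lambda>x. fscale (var x)) UNIV (free_carrier b :: (nat \<Rightarrow> ('n::finite, 'k::field) mpoly) set)"
proof -
  interpret pregraded_module fscale "free_gr b (\<lambda>_. 0) :: int \<Rightarrow> (nat \<Rightarrow> ('n, 'k) mpoly) set"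
    by (rule pregraded_free)
  define E where "E k = (\<lambda>l. if l = k then 1 else 0 :: ('n, 'k) mpoly)" for k :: nat
  show ?thesis
  proof (rule acc_if_finitely_generated)
    show "finite (E ` {..<b})" by simp
    show "free_carrier b \<subseteq> span (E ` {..<b})"
    proof
      fix v :: "nat \<Rightarrow> ('n, 'k) mpoly" assume v: "v \<in> free_carrier b"
      have "v = (\<Sum>k<b. fscale (v k) (E k))"
      proof
        fix l
        have "(\<Sum>k<b. fscale (v k) (E k) l) = (if l < b then v l else 0)"
          by (simp add: E_def if_distrib cong: if_cong)
        then show "v l = (\<Sum>k<b. fscale (v k) (E k)) l"
          using v by (simp add: sum_fun_apply free_carrier_def)
      qed
      also have "\<dots> \<in> span (E ` {..<b})"
        by (intro span_sum span_scale span_base) simp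
      finally show "v \<in> span (E ` {..<b})" .
    qed
  qed
qed

text \<open>The map from a free module given by the images of its basis elements.\<close>

definition psum :: "('r \<Rightarrow> 'm \<Rightarrow> 'm::ab_group_add) \<Rightarrow> nat \<Rightarrow> (nat \<Rightarrow> 'm) \<Rightarrow> (nat \<Rightarrow> 'r) \<Rightarrow> 'm"
  where "psum scale n e v = (\<Sum>k<n. scale (v k) (e k))"

context pregraded_module
begin

lemma psum_add: "psum scale n e (u + v) = psum scale n e u + psum scale n e v"
  by (simp add: psum_def scale_left_distrib sum.distrib)

lemma psum_diff: "psum scale n e (u - v) = psum scale n e u - psum scale n e v"
  by (simp add: psum_def scale_left_diff_distrib sum_subtractf)

lemma psum_fscale: "psum scale n e (fscale p v) = scale p (psum scale n e v)"
  by (simp add: psum_def scale_sum_right)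

lemma psum_sum: "psum scale n e (\<Sum>i\<in>I. f i) = (\<Sum>i\<in>I. psum scale n e (f i))"
  by (simp add: psum_def sum_fun_apply scale_sum_left sum.swap[of _ _ I])

lemma psum_zero: "psum scale n e 0 = 0"
  by (simp add: psum_def)

lemma psum_gr:
  assumes "\<And>k. k < n \<Longrightarrow> e k \<in> gr (a k)" "v \<in> free_gr b a j"
  shows "psum scale n e v \<in> gr j"
  unfolding psum_def
proof (rule graded_sub_sum[OF gr_sub])
  fix k assume "k \<in> {..<n}"
  then have "scale (v k) (e k) \<in> gr (j - a k + a k)"
    using assms by (intro gr_scale) (auto simp: free_gr_def)
  then show "scale (v k) (e k) \<in> gr j" by simp
qed

end

context decomposed_module
begin

lemma comp_psum:
  assumes e: "\<And>k. k < n \<Longrightarrow> e k \<in> gr (a k)" and v: "v \<in> free_carrier n"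
  shows "comp j (psum scale n e v) = psum scale n e (free_comp a j v)"
proof -
  interpret F: decomposed_module fscale "free_gr n a" "free_carrier n" "free_comp a"
    by (rule decomposed_free)
  obtain J where J: "finite J" "\<And>j. j \<notin> J \<Longrightarrow> free_comp a j v = 0" "v = (\<Sum>j\<in>J. free_comp a j v)"
    using F.comp_exhaust[OF v] by blast
  have mem: "psum scale n e (free_comp a i v) \<in> gr i" for i
    by (rule psum_gr[OF e F.comp_gr[OF v]])
  have "psum scale n e v = (\<Sum>i\<in>J. psum scale n e (free_comp a i v))"
    by (subst J(3)) (rule psum_sum)
  then have "comp j (psum scale n e v) = (\<Sum>i\<in>J. comp j (psum scale n e (free_comp a i v)))"
    using gr_C[OF mem] by (simp add: comp_sum)
  also have "\<dots> = (\<Sum>i\<in>J. if j = i then psum scale n e (free_comp a i v) else 0)"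
    by (rule sum.cong) (auto simp: comp_of_gr[OF mem])
  also have "\<dots> = psum scale n e (free_comp a j v)"
    using J(1,2) by (auto simp: psum_zero)
  finally show ?thesis .
qed

text \<open>The kernel is the graded submodule of syzygies in a Noetherian graded free module.\<close>

lemma kernel_finitely_generated:
  assumes e: "\<And>k. k < n \<Longrightarrow> e k \<in> gr (a k)"
  shows "\<exists>n' a' g. (\<forall>k<n'. g k \<in> free_gr n a (a' k)) \<and>
    {v \<in> free_carrier n. psum scale n e v = 0} = psum fscale n' g ` free_carrier n'"
proof -
  interpret F: decomposed_module fscale "free_gr n a" "free_carrier n" "free_comp a"
    by (rule decomposed_free)
  define Z where "Z j = {v \<in> free_gr n a j. psum scale n e v = 0}" for j
  have Z: "F.submod Z"
    unfolding F.submod_def Z_def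
    by (auto simp: F.gr_zero F.gr_diff F.gr_scale psum_zero psum_diff psum_fscale)
  have "{v \<in> free_carrier n. psum scale n e v = 0} = F.tot Z"
  proof (intro subset_antisym subsetI)
    fix v assume v: "v \<in> {v \<in> free_carrier n. psum scale n e v = 0}"
    then have "psum scale n e (free_comp a j v) = 0" for j
      using comp_psum[of n e a v j, OF e] by (simp add: comp_0)
    then show "v \<in> F.tot Z"
      using v by (auto simp: F.tot_def Z_def intro: F.comp_gr)
  next
    fix v assume v: "v \<in> F.tot Z"
    then have vC: "v \<in> free_carrier n" and z: "\<And>j. psum scale n e (free_comp a j v) = 0"
      by (auto simp: F.tot_def Z_def)
    obtain J where "v = (\<Sum>j\<in>J. free_comp a j v)"
      using F.comp_exhaust[OF vC] by blast
    then have "psum scale n e v = (\<Sum>j\<in>J. psum scale n e (free_comp a j v))"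
      using psum_sum by metis
    then show "v \<in> {v \<in> free_carrier n. psum scale n e v = 0}"
      using vC by (simp add: z)
  qed
  moreover obtain n' :: nat and a' g where g: "\<And>k. k < n' \<Longrightarrow> g k \<in> Z (a' k)"
    and tot: "F.tot Z = {\<Sum>k<n'. fscale (p k) (g k) | p. True}"
    by (rule F.submod_finite_generators[OF acc_free Z]) (rule that)
  have "{\<Sum>k<n'. fscale (p k) (g k) | p. True} = psum fscale n' g ` free_carrier n'"
  proof (intro subset_antisym subsetI)
    fix u assume "u \<in> {\<Sum>k<n'. fscale (p k) (g k) | p. True}"
    then obtain p where p: "u = (\<Sum>k<n'. fscale (p k) (g k))" by blast
    then have "u = psum fscale n' g (\<lambda>k. if k < n' then p k else 0)"
      by (simp add: psum_def)
    then show "u \<in> psum fscale n' g ` free_carrier n'"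
      by (auto simp: free_carrier_def)
  qed (auto simp: psum_def)
  ultimately show ?thesis
    using g tot by (intro exI[of _ n'] exI[of _ a'] exI[of _ g]) (auto simp: Z_def)
qed

end

text \<open>Free resolutions in terms of functions instead of vectors and matrices: \<open>g p k\<close> is the image
  in \<open>F p\<close> of the basis element number \<open>k\<close> of \<open>F (p + 1)\<close>.\<close>

definition fun_resolution ::
    "(('n::finite, 'k::field) mpoly \<Rightarrow> 'm::ab_group_add \<Rightarrow> 'm) \<Rightarrow> (int \<Rightarrow> 'm set) \<Rightarrow> 'm set \<Rightarrow>
     (nat \<Rightarrow> nat) \<Rightarrow> (nat \<Rightarrow> nat \<Rightarrow> int) \<Rightarrow> (nat \<Rightarrow> nat \<Rightarrow> nat \<Rightarrow> ('n, 'k) mpoly) \<Rightarrow> (nat \<Rightarrow> 'm) \<Rightarrow> bool"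
  where "fun_resolution scale gr N b a g e \<longleftrightarrow>
    (\<forall>k<b 0. e k \<in> gr (a 0 k)) \<and>
    (\<forall>p. \<forall>k<b (Suc p). g p k \<in> free_gr (b p) (a p) (a (Suc p) k)) \<and>
    psum scale (b 0) e ` free_carrier (b 0) = N \<and>
    {v \<in> free_carrier (b 0). psum scale (b 0) e v = 0} = psum fscale (b 1) (g 0) ` free_carrier (b 1) \<and>
    (\<forall>p. {v \<in> free_carrier (b (Suc p)). psum fscale (b (Suc p)) (g p) v = 0}
      = psum fscale (b (Suc (Suc p))) (g (Suc p)) ` free_carrier (b (Suc (Suc p))))"

theorem (in decomposed_module) fun_resolution_exists:
  assumes acc: "K.acc UNIV C" and B: "submod B"
  shows "\<exists>b a g e. fun_resolution scale gr (tot B) b a g e"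
proof -
  obtain b0 :: nat and a0 e where e: "\<And>k. k < b0 \<Longrightarrow> e k \<in> B (a0 k)"
    and tot: "tot B = {\<Sum>k<b0. scale (p k) (e k) | p. True}"
    by (rule submod_finite_generators[OF acc B]) (rule that)
  have eg: "e k \<in> gr (a0 k)" if "k < b0" for k
    using e[OF that] submodD(2)[OF B] by blast
  have N: "psum scale b0 e ` free_carrier b0 = tot B"
  proof (intro subset_antisym subsetI)
    fix u assume "u \<in> tot B"
    then obtain p where p: "u = (\<Sum>k<b0. scale (p k) (e k))"
      unfolding tot by blast
    then have "u = psum scale b0 e (\<lambda>k. if k < b0 then p k else 0)"
      by (simp add: psum_def)
    then show "u \<in> psum scale b0 e ` free_carrier b0"
      by (auto simp: free_carrier_def)
  qed (auto simp: psum_def tot)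
  obtain n1 a1 g1 where 1: "\<forall>k<n1. g1 k \<in> free_gr b0 a0 (a1 k)"
    "{v \<in> free_carrier b0. psum scale b0 e v = 0} = psum fscale n1 g1 ` free_carrier n1"
    using kernel_finitely_generated[of b0 e a0, OF eg] by blast
  \<comment> \<open>The recursion produces the rank, the degrees and the differential of the next free module;
    \<open>?P\<close> records that the differential is homogeneous for some grading of its target.\<close>
  let ?P = "\<lambda>(p :: nat) (n, a, g). (\<exists>n0 a0. \<forall>k<n. g k \<in> free_gr n0 a0 (a k))"
  let ?Q = "\<lambda>(p :: nat) (n, a, g) (n', a', g'). (\<forall>k<n'. g' k \<in> free_gr n a (a' k)) \<and>
    {v \<in> free_carrier n. psum fscale n g v = 0} = psum fscale n' g' ` free_carrier n'"
  have "\<exists>s. \<forall>p. (?P p (s p) \<and> (p = 0 \<longrightarrow> s p = (n1, a1, g1))) \<and> ?Q p (s p) (s (Suc p))"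
  proof (rule dependent_nat_choice)
    show "\<exists>x. ?P 0 x \<and> (0 = 0 \<longrightarrow> x = (n1, a1, g1))"
      using 1(1) by (intro exI[of _ "(n1, a1, g1)"]) auto
    fix x p assume "?P p x \<and> (p = 0 \<longrightarrow> x = (n1, a1, g1))"
    then obtain n a g n0 a0 where x: "x = (n, a, g)" "\<forall>k<n. g k \<in> free_gr n0 a0 (a k)"
      by (cases x) auto
    interpret F: decomposed_module fscale "free_gr n0 a0" "free_carrier n0" "free_comp a0"
      by (rule decomposed_free)
    obtain n' a' g' where "\<forall>k<n'. g' k \<in> free_gr n a (a' k)"
      "{v \<in> free_carrier n. psum fscale n g v = 0} = psum fscale n' g' ` free_carrier n'"
      using F.kernel_finitely_generated[of n g a] x(2) by blast
    then show "\<exists>y. (?P (Suc p) y \<and> (Suc p = 0 \<longrightarrow> y = (n1, a1, g1))) \<and> ?Q p x y"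
      using x by (intro exI[of _ "(n', a', g')"]) auto
  qed
  then obtain s where s': "\<forall>p. (?P p (s p) \<and> (p = 0 \<longrightarrow> s p = (n1, a1, g1))) \<and> ?Q p (s p) (s (Suc p))"
    by (rule exE)
  note s = s'[THEN spec, THEN conjunct2] mp[OF s'[THEN spec, of 0, THEN conjunct1, THEN conjunct2] refl]
  define b where "b p = (case p of 0 \<Rightarrow> b0 | Suc q \<Rightarrow> fst (s q))" for p
  define a where "a p = (case p of 0 \<Rightarrow> a0 | Suc q \<Rightarrow> fst (snd (s q)))" for p
  define g where "g p = snd (snd (s p))" for p
  have s_eq: "s p = (b (Suc p), a (Suc p), g p)" for p
    by (simp add: b_def a_def g_def)
  have step: "(\<forall>k<b (Suc (Suc p)). g (Suc p) k \<in> free_gr (b (Suc p)) (a (Suc p)) (a (Suc (Suc p)) k)) \<and>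
    {v \<in> free_carrier (b (Suc p)). psum fscale (b (Suc p)) (g p) v = 0}
      = psum fscale (b (Suc (Suc p))) (g (Suc p)) ` free_carrier (b (Suc (Suc p)))" for p
    using s(1)[of p] unfolding s_eq by simp
  have s0: "b 0 = b0" "a 0 = a0" "b 1 = n1" "a 1 = a1" "g 0 = g1"
    using s(2) by (simp_all add: b_def a_def g_def)
  have "g p k \<in> free_gr (b p) (a p) (a (Suc p) k)" if "k < b (Suc p)" for p k
  proof (cases p)
    case 0
    then show ?thesis using that 1(1) s0 by simp
  next
    case (Suc q)
    then show ?thesis using that step[of q] by simp
  qed
  then have "fun_resolution scale gr (tot B) b a g e"
    unfolding fun_resolution_def using eg N 1(2) step by (simp add: s0 s0(3)[unfolded One_nat_def])
  then show ?thesis by blast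
qed

text \<open>The translation between resolutions by functions and resolutions by vectors and matrices.\<close>

definition fun_of_vec :: "'r::zero vec \<Rightarrow> nat \<Rightarrow> 'r"
  where "fun_of_vec v k = (if k < dim_vec v then v $ k else 0)"

lemma fun_of_vec_vec: "v \<in> free_carrier n \<Longrightarrow> fun_of_vec (vec n v) = v"
  by (auto simp: fun_of_vec_def free_carrier_def fun_eq_iff)

lemma vec_fun_of_vec: "v \<in> carrier_vec n \<Longrightarrow> vec n (fun_of_vec v) = v"
  by (rule eq_vecI) (auto simp: fun_of_vec_def)

lemma fun_of_vec_carrier: "v \<in> carrier_vec n \<Longrightarrow> fun_of_vec v \<in> free_carrier n"
  by (auto simp: fun_of_vec_def free_carrier_def)

lemma carrier_vec_eq_image: "carrier_vec n = vec n ` (free_carrier n :: (nat \<Rightarrow> ('n, 'k::zero) mpoly) set)"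
proof (intro subset_antisym subsetI)
  fix x :: "('n, 'k) mpoly vec" assume "x \<in> carrier_vec n"
  then show "x \<in> vec n ` free_carrier n"
    by (intro image_eqI[of _ _ "fun_of_vec x"]) (simp_all add: vec_fun_of_vec fun_of_vec_carrier)
qed auto

lemma augmentation_vec: "augmentation scale e (vec n v) = psum scale n e v"
  by (simp add: augmentation_def psum_def)

lemma mult_mat_vec_psum:
  assumes "D \<in> carrier_mat m n" "\<And>l k. l < m \<Longrightarrow> k < n \<Longrightarrow> g k l = D $$ (l, k)"
  shows "D *\<^sub>v vec n v = vec m (psum fscale n g v)"
  using assms by (intro eq_vecI) (auto simp: scalar_prod_def psum_def sum_fun_apply atLeast0LessThan mult.commute)

lemma vec_eq_iff_free: "u \<in> free_carrier n \<Longrightarrow> v \<in> free_carrier n \<Longrightarrow> vec n u = vec n v \<longleftrightarrow> u = v"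
  by (metis fun_of_vec_vec)

lemma resolution_translation:
  fixes g :: "nat \<Rightarrow> nat \<Rightarrow> nat \<Rightarrow> ('n::finite, 'k::field) mpoly"
  assumes D: "\<And>p. D p \<in> carrier_mat (b p) (b (Suc p))"
    and gD: "\<And>p l k. l < b p \<Longrightarrow> k < b (Suc p) \<Longrightarrow> g p k l = D p $$ (l, k)"
    and g0: "\<And>p l k. l \<ge> b p \<Longrightarrow> k < b (Suc p) \<Longrightarrow> g p k l = 0"
  shows "graded_free_resolution scale gr N b a D e \<longleftrightarrow> fun_resolution scale gr N b a g e"
proof -
  have gC: "psum fscale (b (Suc p)) (g p) v \<in> free_carrier (b p)" for p v
    using g0 by (auto simp: psum_def sum_fun_apply free_carrier_def intro!: sum.neutral)
  have Dg: "D p *\<^sub>v vec (b (Suc p)) v = vec (b p) (psum fscale (b (Suc p)) (g p) v)" for p v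
    by (rule mult_mat_vec_psum[OF D gD])
  have hom: "(\<forall>l<b p. \<forall>k<b (Suc p). D p $$ (l, k) \<in> forms (a (Suc p) k - a p l)) \<longleftrightarrow>
      (\<forall>k<b (Suc p). g p k \<in> free_gr (b p) (a p) (a (Suc p) k))" for p
    unfolding free_gr_def mem_Collect_eq using gD[of _ p] g0[of p]
    by (metis forms_zero not_less)
  have aug: "augmentation scale e ` carrier_vec (b 0) = psum scale (b 0) e ` free_carrier (b 0)"
    unfolding carrier_vec_eq_image image_image augmentation_vec ..
  have im: "(\<lambda>w. D p *\<^sub>v w) ` carrier_vec (b (Suc p))
      = vec (b p) ` (psum fscale (b (Suc p)) (g p) ` free_carrier (b (Suc p)))" for p
    unfolding carrier_vec_eq_image image_image Dg ..
  have img_eq: "vec n ` S = vec n ` T \<longleftrightarrow> S = T" if "S \<subseteq> free_carrier n" "T \<subseteq> free_carrier n" for n S T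
    using that by (metis (no_types, lifting) fun_of_vec_vec image_cong image_image image_ident subsetD)
  have ker0: "{v \<in> carrier_vec (b 0). augmentation scale e v = 0} = vec (b 0) ` {v \<in> free_carrier (b 0). psum scale (b 0) e v = 0}"
    unfolding carrier_vec_eq_image by (auto simp: augmentation_vec)
  have zero: "0\<^sub>v n = vec n (0 :: nat \<Rightarrow> ('n, 'k) mpoly)" for n
    by (rule eq_vecI) auto
  have ker: "{v \<in> carrier_vec (b (Suc p)). D p *\<^sub>v v = 0\<^sub>v (b p)}
      = vec (b (Suc p)) ` {v \<in> free_carrier (b (Suc p)). psum fscale (b (Suc p)) (g p) v = 0}" for p
  proof -
    have "vec (b p) (psum fscale (b (Suc p)) (g p) v) = 0\<^sub>v (b p) \<longleftrightarrow> psum fscale (b (Suc p)) (g p) v = 0" for v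
      unfolding zero by (rule vec_eq_iff_free[OF gC]) (simp add: free_carrier_def)
    then show ?thesis
      unfolding carrier_vec_eq_image by (auto simp: Dg)
  qed
  have sub: "psum fscale (b (Suc p)) (g p) ` S \<subseteq> free_carrier (b p)" "{v \<in> free_carrier n. P v} \<subseteq> free_carrier n" for p S n P
    using gC by auto
  show ?thesis
    unfolding graded_free_resolution_def fun_resolution_def hom aug ker0 ker im img_eq[OF sub(2) sub(1)] One_nat_def
    using D im[of 0] img_eq[OF sub(2) sub(1)] by (auto simp: )
qed

section \<open>Tor is Koszul homology\<close>

context koszul_ops
begin

text \<open>If the first homology of \<open>A\<close> vanishes, then that of \<open>A/C\<close> is the kernel of \<open>C/\<mm>C \<rightarrow> A/\<mm>A\<close>, that is,
  \<open>(C \<inter> \<mm>A)/\<mm>C\<close>.\<close>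

lemma koszul_exact_1_iff:
  assumes A: "graded_sub X A" and C: "graded_sub X C" and CA: "\<And>j. C j \<subseteq> A j"
    and free: "koszul_exact X A (\<lambda>_. {0}) (Suc 0) j"
  shows "koszul_exact X A C (Suc 0) j \<longleftrightarrow>
    (\<forall>v. (\<forall>x. v x \<in> A (j - 1)) \<longrightarrow> (\<Sum>x\<in>UNIV. X x (v x)) \<in> C j \<longrightarrow>
      (\<exists>w. (\<forall>x. w x \<in> C (j - 1)) \<and> (\<Sum>x\<in>UNIV. X x (v x)) = (\<Sum>x\<in>UNIV. X x (w x))))"
proof -
  define ch where "ch v S = (if card S = 1 then v (the_elem S) else 0)" for v :: "'n \<Rightarrow> 'a" and S :: "'n set"
  have ch_deg: "in_degree (Suc 0) (ch v)" for v
    by (simp add: ch_def in_degree_def)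
  have ch_mem: "ch v \<in> kchains D j" if "graded_sub X D" "\<And>x. v x \<in> D (j - 1)" for v D
    using that graded_subD(1)[OF that(1)] by (auto simp: ch_def kchains_def)
  have ch_bd: "bd X (ch v) {} = (\<Sum>x\<in>UNIV. X x (v x))" for v
    by (simp add: bd_def ch_def)
  have bd_eq: "bd X c {} = (\<Sum>x\<in>UNIV. X x (c {x}))" for c
    by (simp add: bd_def)
  have bd_mem: "bd X c \<in> kchains D j \<longleftrightarrow> bd X c {} \<in> D j" if "graded_sub X D" "in_degree (Suc 0) c" for c D
  proof
    assume "bd X c \<in> kchains D j"
    then show "bd X c {} \<in> D j"
      by (auto simp: kchains_def dest: spec[of _ "{}"])
  next
    assume D0: "bd X c {} \<in> D j"
    show "bd X c \<in> kchains D j"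
      unfolding kchains_def
    proof (intro CollectI allI)
      fix S :: "'n set"
      show "bd X c S \<in> D (j - int (card S))"
      proof (cases "S = {}")
        case False
        then have "card S \<noteq> 0" by simp
        then have "bd X c S = 0"
          using in_degree_bd[OF that(2)] by (simp add: in_degree_def del: card_0_eq)
        then show ?thesis by (simp add: graded_subD(1)[OF that(1)])
      qed (simp add: D0)
    qed
  qed
  show ?thesis
  proof (intro iffI allI impI)
    fix v assume E: "koszul_exact X A C (Suc 0) j" and v: "\<forall>x. v x \<in> A (j - 1)" "(\<Sum>x\<in>UNIV. X x (v x)) \<in> C j"
    have "bd X (ch v) \<in> kchains C j"
      using v(2) by (simp add: bd_mem[OF C ch_deg] ch_bd)
    then obtain z where z: "ch v - bd X z \<in> kchains C j"
      using koszul_exactD[OF E ch_mem[OF A] ch_deg] v(1) by blast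
    define w where "w x = (ch v - bd X z) {x}" for x
    have "w x \<in> C (j - 1)" for x
      using z by (auto simp: w_def kchains_def dest: spec[of _ "{x}"])
    moreover have "(\<Sum>x\<in>UNIV. X x (w x)) = bd X (ch v - bd X z) {}"
      unfolding bd_eq w_def ..
    ultimately show "\<exists>w. (\<forall>x. w x \<in> C (j - 1)) \<and> (\<Sum>x\<in>UNIV. X x (v x)) = (\<Sum>x\<in>UNIV. X x (w x))"
      by (intro exI[of _ w]) (simp add: bd_diff ch_bd)
  next
    assume R: "\<forall>v. (\<forall>x. v x \<in> A (j - 1)) \<longrightarrow> (\<Sum>x\<in>UNIV. X x (v x)) \<in> C j \<longrightarrow>
      (\<exists>w. (\<forall>x. w x \<in> C (j - 1)) \<and> (\<Sum>x\<in>UNIV. X x (v x)) = (\<Sum>x\<in>UNIV. X x (w x)))"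
    show "koszul_exact X A C (Suc 0) j"
      unfolding koszul_exact_def
    proof (intro ballI impI)
      fix c assume c: "c \<in> kchains A j" "in_degree (Suc 0) c" "bd X c \<in> kchains C j"
      have "c {x} \<in> A (j - 1)" for x
        using c(1) by (auto simp: kchains_def dest: spec[of _ "{x}"])
      moreover have "(\<Sum>x\<in>UNIV. X x (c {x})) \<in> C j"
        using c(3) by (simp add: bd_mem[OF C c(2)] bd_eq)
      ultimately obtain w where w: "\<And>x. w x \<in> C (j - 1)" "(\<Sum>x\<in>UNIV. X x (c {x})) = (\<Sum>x\<in>UNIV. X x (w x))"
        using R[rule_format, of "\<lambda>x. c {x}"] by blast
      have wC: "ch w \<in> kchains C j"
        using w(1) by (rule ch_mem[OF C])
      have deg: "in_degree (Suc 0) (c - ch w)"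
        using c(2) ch_deg by (rule in_degree_diff)
      have "bd X (c - ch w) {} = 0"
        using w(2) by (simp add: bd_diff ch_bd bd_eq[of c])
      moreover have "graded_sub X (\<lambda>_. {0})"
        by (simp add: graded_sub_def)
      ultimately have "bd X (c - ch w) \<in> kchains (\<lambda>_. {0}) j"
        using bd_mem[OF _ deg] by blast
      then obtain z where z: "z \<in> kchains A j" "in_degree (Suc (Suc 0)) z" "c - ch w - bd X z \<in> kchains (\<lambda>_. {0}) j"
        using koszul_exactD[OF free kchains_diff[OF A c(1) kchains_mono[OF CA wC]] deg] by blast
      then have "c - ch w - bd X z = 0"
        by (auto simp: kchains_def fun_eq_iff)
      moreover have "c - bd X z = (c - ch w - bd X z) + ch w"
        by simp
      ultimately have "c - bd X z = ch w"
        by (simp only: add_0)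
      then show "\<exists>w\<in>kchains A j. in_degree (Suc (Suc 0)) w \<and> c - bd X w \<in> kchains C j"
        using z wC by (intro bexI[of _ z]) simp_all
    qed
  qed
qed

end

abbreviation fvar :: "'n::finite \<Rightarrow> (nat \<Rightarrow> ('n, 'k::field) mpoly) \<Rightarrow> nat \<Rightarrow> ('n, 'k) mpoly"
  where "fvar x \<equiv> fscale (var x)"

text \<open>An element of a graded free module is the sum of a constant vector and an element of
  \<open>\<mm> F\<close>.\<close>

definition const_part :: "(nat \<Rightarrow> ('n, 'k::field) mpoly) \<Rightarrow> nat \<Rightarrow> 'k"
  where "const_part v = (\<lambda>k. const_coeff (v k))"

definition const_lift :: "(nat \<Rightarrow> 'k) \<Rightarrow> nat \<Rightarrow> ('n, 'k::field) mpoly"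
  where "const_lift z = (\<lambda>k. cst (z k))"

definition const_vecs :: "nat \<Rightarrow> (nat \<Rightarrow> int) \<Rightarrow> int \<Rightarrow> (nat \<Rightarrow> 'k::zero) set"
  where "const_vecs b a j = {z. \<forall>k. z k \<noteq> 0 \<longrightarrow> k < b \<and> a k = j}"

lemma const_part_lift [simp]: "const_part (const_lift z) = z"
  by (simp add: const_part_def const_lift_def)

lemma const_part_diff: "const_part (u - v) = const_part u - const_part v"
  for u v :: "nat \<Rightarrow> ('n, 'k::field) mpoly"
  by (simp add: const_part_def const_coeff_def fun_eq_iff lookup_minus)

lemma const_part_add: "const_part (u + v) = const_part u + const_part v"
  for u v :: "nat \<Rightarrow> ('n, 'k::field) mpoly"
  by (simp add: const_part_def const_coeff_add fun_eq_iff)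

lemma const_part_irrelevant: "const_part (\<Sum>x\<in>UNIV. fvar x (w x)) = 0"
  by (simp add: const_part_def sum_fun_apply const_coeff_sum fun_eq_iff)

lemma const_lift_mem:
  assumes z: "z \<in> const_vecs b a j"
  shows "const_lift z \<in> (free_gr b a j :: (nat \<Rightarrow> ('n, 'k::field) mpoly) set)"
proof -
  have "(cst (z k) :: ('n, 'k) mpoly) \<in> forms (j - a k)" for k
    using z by (cases "z k = 0") (auto simp: const_vecs_def)
  moreover have "k \<ge> b \<Longrightarrow> z k = 0" for k
    using z by (force simp: const_vecs_def)
  ultimately show ?thesis
    by (simp add: free_gr_def const_lift_def)
qed

lemma const_part_mem: "v \<in> free_gr b a j \<Longrightarrow> const_part v \<in> const_vecs b a j"
proof -
  assume v: "v \<in> free_gr b a j"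
  have "k < b \<and> a k = j" if "const_coeff (v k) \<noteq> 0" for k
  proof -
    have "k < b"
      using v that by (cases "k < b") (auto simp: free_gr_def)
    moreover have "j - a k = 0"
      using v that const_coeff_forms[of "v k" "j - a k"] by (auto simp: free_gr_def)
    ultimately show ?thesis by simp
  qed
  then show ?thesis
    by (simp add: const_vecs_def const_part_def)
qed

lemma free_irrelevant:
  fixes v :: "nat \<Rightarrow> ('n::finite, 'k::field) mpoly"
  assumes v: "v \<in> free_gr b a j" and "const_part v = 0"
  obtains w where "\<And>x. w x \<in> free_gr b a (j - 1)" "v = (\<Sum>x\<in>UNIV. fvar x (w x))"
proof -
  have "\<forall>k. \<exists>g. v k = (\<Sum>x\<in>UNIV. var x * g x) \<and> (\<forall>x. g x \<in> forms (j - 1 - a k)) \<and> (k \<ge> b \<longrightarrow> (\<forall>x. g x = 0))"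
  proof
    fix k
    obtain g where g: "v k = cst (const_coeff (v k)) + (\<Sum>x\<in>UNIV. var x * g x)"
      using form_in_irrelevant_ideal by blast
    have c0: "const_coeff (v k) = 0"
      using fun_cong[OF assms(2), of k] by (simp add: const_part_def)
    have "v k = hpart (j - a k) (v k)"
      using v hpart_of_forms[of "v k" "j - a k" "j - a k"] by (simp add: free_gr_def)
    also have "\<dots> = hpart (j - a k) (\<Sum>x\<in>UNIV. var x * g x)"
      using g c0 by simp
    also have "\<dots> = (\<Sum>x\<in>UNIV. var x * hpart (j - 1 - a k) (g x))"
      by (simp add: hpart_sum hpart_var_mult diff_diff_eq add.commute)
    finally have eq: "v k = (\<Sum>x\<in>UNIV. var x * hpart (j - 1 - a k) (g x))" .
    show "\<exists>g. v k = (\<Sum>x\<in>UNIV. var x * g x) \<and> (\<forall>x. g x \<in> forms (j - 1 - a k)) \<and> (k \<ge> b \<longrightarrow> (\<forall>x. g x = 0))"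
    proof (cases "k \<ge> b")
      case True
      then show ?thesis
        using v by (intro exI[of _ "\<lambda>_. 0"]) (simp add: free_gr_def)
    next
      case False
      then show ?thesis
        using eq by (intro exI[of _ "\<lambda>x. hpart (j - 1 - a k) (g x)"]) simp
    qed
  qed
  from choice[OF this] obtain g where g: "\<And>k. v k = (\<Sum>x\<in>UNIV. var x * g k x)"
    "\<And>k x. g k x \<in> forms (j - 1 - a k)" "\<And>k x. k \<ge> b \<Longrightarrow> g k x = 0"
    by blast
  show thesis
  proof (rule that)
    show "(\<lambda>k. g k x) \<in> free_gr b a (j - 1)" for x
      using g(2,3) by (simp add: free_gr_def)
    show "v = (\<Sum>x\<in>UNIV. fvar x (\<lambda>k. g k x))"
      by (rule ext) (simp add: sum_fun_apply g(1))
  qed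
qed

locale resolved_module = decomposed_module scale gr C comp
  for scale :: "('n::finite, 'k::field) mpoly \<Rightarrow> 'm::ab_group_add \<Rightarrow> 'm" and gr and C and comp +
  fixes B :: "int \<Rightarrow> 'm set" and b :: "nat \<Rightarrow> nat" and a :: "nat \<Rightarrow> nat \<Rightarrow> int"
    and g :: "nat \<Rightarrow> nat \<Rightarrow> nat \<Rightarrow> ('n, 'k) mpoly" and e :: "nat \<Rightarrow> 'm"
  assumes B: "submod B" and res: "fun_resolution scale gr (tot B) b a g e"
begin

abbreviation F :: "nat \<Rightarrow> int \<Rightarrow> (nat \<Rightarrow> ('n, 'k) mpoly) set"
  where "F p \<equiv> free_gr (b p) (a p)"

abbreviation dd :: "nat \<Rightarrow> (nat \<Rightarrow> ('n, 'k) mpoly) \<Rightarrow> nat \<Rightarrow> ('n, 'k) mpoly"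
  where "dd p \<equiv> psum fscale (b (Suc p)) (g p)"

abbreviation aug :: "(nat \<Rightarrow> ('n, 'k) mpoly) \<Rightarrow> 'm"
  where "aug \<equiv> psum scale (b 0) e"

text \<open>The syzygy module inside \<open>F p\<close>.\<close>

definition Z :: "nat \<Rightarrow> int \<Rightarrow> (nat \<Rightarrow> ('n, 'k) mpoly) set"
  where "Z p j = {v \<in> F p j. case p of 0 \<Rightarrow> aug v = 0 | Suc q \<Rightarrow> dd q v = 0}"

lemma e_gr: "k < b 0 \<Longrightarrow> e k \<in> gr (a 0 k)"
  and g_gr: "k < b (Suc p) \<Longrightarrow> g p k \<in> F p (a (Suc p) k)"
  using res by (auto simp: fun_resolution_def)

lemma pre_F: "pregraded_module fscale (F p)"
  by (rule pregraded_free)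

lemma koszul_F: "koszul_ops (fvar :: 'n \<Rightarrow> (nat \<Rightarrow> ('n, 'k) mpoly) \<Rightarrow> _)"
proof -
  interpret P: pregraded_module fscale "F 0" by (rule pre_F)
  show ?thesis by (rule P.koszul_ops_axioms)
qed

lemma sub_F: "graded_sub fvar (F p)"
proof -
  interpret P: pregraded_module fscale "F p" by (rule pre_F)
  show ?thesis by (rule P.gr_sub)
qed

lemma dd_gr: "v \<in> F (Suc p) j \<Longrightarrow> dd p v \<in> F p j"
proof -
  interpret P: pregraded_module fscale "F p" by (rule pre_F)
  show "v \<in> F (Suc p) j \<Longrightarrow> dd p v \<in> F p j"
    by (rule P.psum_gr[OF g_gr])
qed

lemma dd_add: "dd p (u + v) = dd p u + dd p v"
  and dd_diff: "dd p (u - v) = dd p u - dd p v"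
  and dd_fscale: "dd p (fscale r u) = fscale r (dd p u)"
  and dd_sum: "dd p (\<Sum>i\<in>I. f i) = (\<Sum>i\<in>I. dd p (f i))"
proof -
  interpret P: pregraded_module fscale "F p" by (rule pre_F)
  show "dd p (u + v) = dd p u + dd p v" "dd p (u - v) = dd p u - dd p v" "dd p (fscale r u) = fscale r (dd p u)"
    "dd p (\<Sum>i\<in>I. f i) = (\<Sum>i\<in>I. dd p (f i))"
    by (rule P.psum_add P.psum_diff P.psum_fscale P.psum_sum)+
qed

lemma sub_Z: "graded_sub fvar (Z p)"
proof -
  interpret P: pregraded_module fscale "F p" by (rule pre_F)
  show ?thesis
  proof (cases p)
    case 0
    then show ?thesis
      using graded_subD[OF P.gr_sub]
      by (auto simp: graded_sub_def Z_def psum_zero psum_diff psum_fscale)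
  next
    case (Suc q)
    interpret Q: pregraded_module fscale "F q" by (rule pre_F)
    show ?thesis
      using graded_subD[OF P.gr_sub] Suc
      by (auto simp: graded_sub_def Z_def Q.psum_zero Q.psum_diff Q.psum_fscale)
  qed
qed

lemma Z_subset: "Z p j \<subseteq> F p j"
  by (auto simp: Z_def)

lemma free_gr_carrier: "v \<in> free_gr n c j \<Longrightarrow> v \<in> free_carrier n"
  by (simp add: free_gr_def free_carrier_def)

lemma dd_image: "dd p ` F (Suc p) j = Z p j"
proof -
  interpret P: decomposed_module fscale "F p" "free_carrier (b p)" "free_comp (a p)"
    by (rule decomposed_free)
  interpret Q: decomposed_module fscale "F (Suc p)" "free_carrier (b (Suc p))" "free_comp (a (Suc p))"
    by (rule decomposed_free)
  have exact: "{v \<in> free_carrier (b p). case p of 0 \<Rightarrow> aug v = 0 | Suc q \<Rightarrow> dd q v = 0} = dd p ` free_carrier (b (Suc p))"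
    using res by (cases p) (simp_all add: fun_resolution_def)
  show ?thesis
  proof (intro subset_antisym subsetI)
    fix v assume "v \<in> dd p ` F (Suc p) j"
    then obtain w where w: "v = dd p w" "w \<in> F (Suc p) j" by blast
    have "v \<in> dd p ` free_carrier (b (Suc p))"
      using w free_gr_carrier by blast
    then show "v \<in> Z p j"
      using dd_gr[OF w(2)] w(1) unfolding exact[symmetric] Z_def by blast
  next
    fix v assume v: "v \<in> Z p j"
    then have vF: "v \<in> F p j"
      using Z_subset by blast
    have "v \<in> {v \<in> free_carrier (b p). case p of 0 \<Rightarrow> aug v = 0 | Suc q \<Rightarrow> dd q v = 0}"
      using v free_gr_carrier[OF vF] by (simp add: Z_def)
    then obtain w where w: "w \<in> free_carrier (b (Suc p))" "v = dd p w"
      unfolding exact by blast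
    have "v = free_comp (a p) j v"
      using P.comp_of_gr[OF vF, of j] by simp
    also have "\<dots> = dd p (free_comp (a (Suc p)) j w)"
      unfolding w(2) by (rule P.comp_psum[OF g_gr w(1)])
    finally show "v \<in> dd p ` F (Suc p) j"
      using Q.comp_gr[OF w(1)] by blast
  qed
qed

lemma aug_image: "aug ` F 0 j = B j"
proof -
  interpret Q: decomposed_module fscale "F 0" "free_carrier (b 0)" "free_comp (a 0)"
    by (rule decomposed_free)
  have onto: "aug ` free_carrier (b 0) = tot B"
    using res by (simp add: fun_resolution_def)
  show ?thesis
  proof (intro subset_antisym subsetI)
    fix u assume "u \<in> aug ` F 0 j"
    then obtain w where w: "u = aug w" "w \<in> F 0 j" by blast
    have "u \<in> gr j"
      unfolding w(1) by (rule psum_gr[OF e_gr w(2)])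
    moreover have "u \<in> tot B"
      using w(1) onto free_gr_carrier[OF w(2)] by blast
    ultimately show "u \<in> B j"
      using tot_iff_gr[OF B] by blast
  next
    fix u assume u: "u \<in> B j"
    then have ug: "u \<in> gr j"
      using submodD(2)[OF B] by blast
    then have "u \<in> tot B"
      using tot_iff_gr[OF B] u by blast
    then obtain w where w: "w \<in> free_carrier (b 0)" "u = aug w"
      unfolding onto[symmetric] by blast
    have "u = comp j u"
      using comp_of_gr[OF ug, of j] by simp
    also have "\<dots> = aug (free_comp (a 0) j w)"
      unfolding w(2) by (rule comp_psum[OF e_gr w(1)])
    finally show "u \<in> aug ` F 0 j"
      using Q.comp_gr[OF w(1)] by blast
  qed
qed

text \<open>Dimension shifting along the resolution: \<open>H\<^bsub>i+1\<^esub>(F p / Z p) = H\<^sub>i(Z p)\<close> for \<open>i \<ge> 1\<close>, because free modules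
  have no higher homology, and \<open>Z p\<close> is isomorphic to \<open>F (p + 1) / Z (p + 1)\<close>.\<close>

lemma exact_B_iff: "koszul_exact X B (\<lambda>_. {0}) i j \<longleftrightarrow> koszul_exact fvar (F 0) (Z 0) i j"
  by (rule koszul_exact_iso[symmetric, OF koszul_F koszul_ops_axioms sub_F, where \<pi> = aug])
    (auto simp: psum_add psum_fscale aug_image Z_def)

lemma exact_Z_iff: "koszul_exact fvar (Z p) (\<lambda>_. {0}) i j \<longleftrightarrow> koszul_exact fvar (F (Suc p)) (Z (Suc p)) i j"
  by (rule koszul_exact_iso[symmetric, OF koszul_F koszul_F sub_F, where \<pi> = "dd p"])
    (auto simp: dd_add dd_fscale dd_image Z_def)

lemma exact_shift:
  "koszul_exact fvar (F p) (Z p) (Suc (Suc i)) j \<longleftrightarrow> koszul_exact fvar (F (Suc p)) (Z (Suc p)) (Suc i) j"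
proof -
  interpret KF: koszul_ops "fvar :: 'n \<Rightarrow> (nat \<Rightarrow> ('n, 'k) mpoly) \<Rightarrow> _" by (rule koszul_F)
  have zero: "graded_sub fvar (\<lambda>_. {0 :: nat \<Rightarrow> ('n, 'k) mpoly})"
    by (simp add: graded_sub_def)
  have sub0: "{0} \<subseteq> Z p j" for j
    using graded_subD(1)[OF sub_Z] by simp
  show ?thesis
    unfolding exact_Z_iff[symmetric]
    using KF.koszul_exact_submodule[OF sub_F sub_Z zero sub0 Z_subset koszul_exact_free]
      KF.koszul_exact_quotient[OF sub_F sub_Z zero sub0 Z_subset koszul_exact_free] by blast
qed

lemma exact_shift_all:
  "koszul_exact X B (\<lambda>_. {0}) (Suc (p + i)) j \<longleftrightarrow> koszul_exact fvar (F p) (Z p) (Suc i) j"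
proof (induction p arbitrary: i)
  case 0
  then show ?case by (simp only: exact_B_iff add_0)
next
  case (Suc p)
  have "koszul_exact X B (\<lambda>_. {0}) (Suc (p + Suc i)) j \<longleftrightarrow> koszul_exact fvar (F p) (Z p) (Suc (Suc i)) j"
    by (rule Suc.IH)
  then show ?case
    by (simp only: exact_shift add_Suc_right add_Suc)
qed

text \<open>The differential of the complex tensored with \<open>K\<close>.\<close>

definition dbar :: "nat \<Rightarrow> (nat \<Rightarrow> 'k) \<Rightarrow> nat \<Rightarrow> 'k"
  where "dbar p z = const_part (dd p (const_lift z))"

abbreviation T :: "nat \<Rightarrow> int \<Rightarrow> (nat \<Rightarrow> 'k) set"
  where "T p \<equiv> const_vecs (b p) (a p)"

lemma decompose:
  assumes v: "v \<in> F p j"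
  obtains w where "\<And>x. w x \<in> F p (j - 1)" "v = const_lift (const_part v) + (\<Sum>x\<in>UNIV. fvar x (w x))"
proof -
  have "v - const_lift (const_part v) \<in> F p j"
    by (rule graded_subD(2)[OF sub_F v const_lift_mem[OF const_part_mem[OF v]]])
  moreover have "const_part (v - const_lift (const_part v)) = 0"
    by (simp add: const_part_diff)
  ultimately obtain w where "\<And>x. w x \<in> F p (j - 1)" "v - const_lift (const_part v) = (\<Sum>x\<in>UNIV. fvar x (w x))"
    by (rule free_irrelevant) (rule that)
  then show thesis
    by (intro that[of w]) (auto simp: diff_eq_eq add.commute)
qed

lemma const_part_dd:
  assumes v: "v \<in> F (Suc p) j"
  shows "const_part (dd p v) = dbar p (const_part v)"
proof -
  obtain w where "v = const_lift (const_part v) + (\<Sum>x\<in>UNIV. fvar x (w x))"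
    using decompose[OF v] by blast
  then have "dd p v = dd p (const_lift (const_part v) + (\<Sum>x\<in>UNIV. fvar x (w x)))"
    by (rule arg_cong)
  also have "\<dots> = dd p (const_lift (const_part v)) + (\<Sum>x\<in>UNIV. fvar x (dd p (w x)))"
    by (simp only: dd_add dd_sum dd_fscale)
  finally show ?thesis
    by (simp add: dbar_def const_part_add const_part_irrelevant)
qed

text \<open>The homology in degree zero of \<open>F p / Z p\<close> is \<open>F p / (Z p + \<mm> F p)\<close>, the cokernel of \<open>dbar p\<close>.\<close>

lemma exact_0_iff:
  "koszul_exact fvar (F p) (Z p) 0 j \<longleftrightarrow> (\<forall>z\<in>T p j. \<exists>y\<in>T (Suc p) j. z = dbar p y)"
proof -
  interpret KF: koszul_ops "fvar :: 'n \<Rightarrow> (nat \<Rightarrow> ('n, 'k) mpoly) \<Rightarrow> _" by (rule koszul_F)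
  show ?thesis
    unfolding KF.koszul_exact_0_iff[OF sub_F sub_Z]
  proof (intro iffI ballI)
    fix z assume R: "\<forall>u\<in>F p j. \<exists>v. (\<forall>x. v x \<in> F p (j - 1)) \<and> u - (\<Sum>x\<in>UNIV. fvar x (v x)) \<in> Z p j"
      and z: "z \<in> T p j"
    then obtain v where "const_lift z - (\<Sum>x\<in>UNIV. fvar x (v x)) \<in> Z p j"
      using const_lift_mem[OF z] by blast
    then obtain w where w: "w \<in> F (Suc p) j" "const_lift z - (\<Sum>x\<in>UNIV. fvar x (v x)) = dd p w"
      unfolding dd_image[symmetric] by blast
    have "z = const_part (const_lift z - (\<Sum>x\<in>UNIV. fvar x (v x)))"
      unfolding const_part_diff const_part_irrelevant by simp
    also have "\<dots> = dbar p (const_part w)"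
      unfolding w(2) by (rule const_part_dd[OF w(1)])
    finally show "\<exists>y\<in>T (Suc p) j. z = dbar p y"
      using const_part_mem[OF w(1)] by blast
  next
    fix u assume R: "\<forall>z\<in>T p j. \<exists>y\<in>T (Suc p) j. z = dbar p y" and u: "u \<in> F p j"
    then obtain y where y: "y \<in> T (Suc p) j" "const_part u = dbar p y"
      using const_part_mem[OF u] by blast
    have mem: "dd p (const_lift y) \<in> Z p j"
      unfolding dd_image[symmetric] using const_lift_mem[OF y(1)] by blast
    have "u - dd p (const_lift y) \<in> F p j"
      using graded_subD(2)[OF sub_F u] mem Z_subset by blast
    moreover have "const_part (u - dd p (const_lift y)) = 0"
      using y(2) by (simp add: const_part_diff dbar_def)
    ultimately obtain v where v: "\<And>x. v x \<in> F p (j - 1)" "u - dd p (const_lift y) = (\<Sum>x\<in>UNIV. fvar x (v x))"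
      by (rule free_irrelevant) (rule that)
    have "u - (u - dd p (const_lift y)) = dd p (const_lift y)"
      by simp
    then have "u - (\<Sum>x\<in>UNIV. fvar x (v x)) = dd p (const_lift y)"
      by (simp only: v(2))
    then show "\<exists>v. (\<forall>x. v x \<in> F p (j - 1)) \<and> u - (\<Sum>x\<in>UNIV. fvar x (v x)) \<in> Z p j"
      using v(1) mem by (intro exI[of _ v]) simp
  qed
qed

text \<open>The first homology of \<open>F p / Z p\<close> is \<open>(Z p \<inter> \<mm> F p) / \<mm> (Z p)\<close>. The differential maps the elements
  of \<open>F (p + 1)\<close> whose constant part is a cycle of \<open>F \<otimes> K\<close> onto \<open>Z p \<inter> \<mm> F p\<close>, and it maps an element into
  \<open>\<mm> (Z p)\<close> if and only if its constant part is a boundary.\<close>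

lemma exact_1_iff:
  "koszul_exact fvar (F p) (Z p) (Suc 0) j \<longleftrightarrow>
    (\<forall>z\<in>T (Suc p) j. dbar p z = 0 \<longrightarrow> (\<exists>y\<in>T (Suc (Suc p)) j. z = dbar (Suc p) y))"
proof -
  interpret KF: koszul_ops "fvar :: 'n \<Rightarrow> (nat \<Rightarrow> ('n, 'k) mpoly) \<Rightarrow> _" by (rule koszul_F)
  show ?thesis
    unfolding KF.koszul_exact_1_iff[OF sub_F sub_Z Z_subset koszul_exact_free]
  proof (intro iffI ballI impI allI)
    fix z assume R: "\<forall>v. (\<forall>x. v x \<in> F p (j - 1)) \<longrightarrow> (\<Sum>x\<in>UNIV. fvar x (v x)) \<in> Z p j \<longrightarrow>
        (\<exists>w. (\<forall>x. w x \<in> Z p (j - 1)) \<and> (\<Sum>x\<in>UNIV. fvar x (v x)) = (\<Sum>x\<in>UNIV. fvar x (w x)))"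
      and z: "z \<in> T (Suc p) j" "dbar p z = 0"
    have mem: "dd p (const_lift z) \<in> Z p j"
      unfolding dd_image[symmetric] using const_lift_mem[OF z(1)] by blast
    obtain v where v: "\<And>x. v x \<in> F p (j - 1)" "dd p (const_lift z) = (\<Sum>x\<in>UNIV. fvar x (v x))"
      using free_irrelevant[OF subsetD[OF Z_subset mem]] z(2) unfolding dbar_def by blast
    have "(\<Sum>x\<in>UNIV. fvar x (v x)) \<in> Z p j"
      using mem by (simp only: v(2))
    then obtain w where w: "\<And>x. w x \<in> Z p (j - 1)" "dd p (const_lift z) = (\<Sum>x\<in>UNIV. fvar x (w x))"
      using R v(1) unfolding v(2) by blast
    have "\<forall>x. \<exists>y. y \<in> F (Suc p) (j - 1) \<and> w x = dd p y"
      using w(1) unfolding dd_image[symmetric] by blast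
    from choice[OF this] obtain y where y: "\<And>x. y x \<in> F (Suc p) (j - 1)" "\<And>x. w x = dd p (y x)"
      by blast
    define r where "r = const_lift z - (\<Sum>x\<in>UNIV. fvar x (y x))"
    have "(\<Sum>x\<in>UNIV. fvar x (y x)) \<in> F (Suc p) j"
      using graded_subD(3)[OF sub_F y(1)] by (intro graded_sub_sum[OF sub_F]) simp
    then have "r \<in> F (Suc p) j"
      unfolding r_def by (rule graded_subD(2)[OF sub_F const_lift_mem[OF z(1)]])
    moreover have "dd p r = 0"
      by (simp add: r_def dd_diff dd_sum dd_fscale w(2) y(2))
    ultimately have "r \<in> Z (Suc p) j"
      by (simp add: Z_def)
    then obtain q where q: "q \<in> F (Suc (Suc p)) j" "r = dd (Suc p) q"
      unfolding dd_image[symmetric] by blast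
    have "z = const_part r"
      unfolding r_def const_part_diff const_part_irrelevant by simp
    also have "\<dots> = dbar (Suc p) (const_part q)"
      unfolding q(2) by (rule const_part_dd[OF q(1)])
    finally show "\<exists>y\<in>T (Suc (Suc p)) j. z = dbar (Suc p) y"
      using const_part_mem[OF q(1)] by blast
  next
    fix v assume R: "\<forall>z\<in>T (Suc p) j. dbar p z = 0 \<longrightarrow> (\<exists>y\<in>T (Suc (Suc p)) j. z = dbar (Suc p) y)"
      and v: "\<forall>x. v x \<in> F p (j - 1)" "(\<Sum>x\<in>UNIV. fvar x (v x)) \<in> Z p j"
    let ?u = "\<Sum>x\<in>UNIV. fvar x (v x)"
    obtain w where w: "w \<in> F (Suc p) j" "?u = dd p w"
      using v(2) unfolding dd_image[symmetric] by blast
    have "dbar p (const_part w) = 0"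
      using const_part_dd[OF w(1)] const_part_irrelevant[of v] w(2) by simp
    then obtain y where y: "y \<in> T (Suc (Suc p)) j" "const_part w = dbar (Suc p) y"
      using R const_part_mem[OF w(1)] by blast
    have mem: "dd (Suc p) (const_lift y) \<in> Z (Suc p) j"
      unfolding dd_image[symmetric] using const_lift_mem[OF y(1)] by blast
    have "w - dd (Suc p) (const_lift y) \<in> F (Suc p) j"
      using graded_subD(2)[OF sub_F w(1)] mem Z_subset by blast
    moreover have "const_part (w - dd (Suc p) (const_lift y)) = 0"
      using y(2) by (simp add: const_part_diff dbar_def)
    ultimately obtain q where q: "\<And>x. q x \<in> F (Suc p) (j - 1)" "w - dd (Suc p) (const_lift y) = (\<Sum>x\<in>UNIV. fvar x (q x))"
      by (rule free_irrelevant) (rule that)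
    have "dd p (dd (Suc p) (const_lift y)) = 0"
      using mem by (simp add: Z_def)
    then have "?u = dd p (w - dd (Suc p) (const_lift y))"
      by (simp add: w(2) dd_diff)
    also have "\<dots> = (\<Sum>x\<in>UNIV. fvar x (dd p (q x)))"
      by (simp add: q(2) dd_sum dd_fscale)
    finally have "?u = (\<Sum>x\<in>UNIV. fvar x (dd p (q x)))" .
    moreover have "dd p (q x) \<in> Z p (j - 1)" for x
      unfolding dd_image[symmetric] using q(1) by blast
    ultimately show "\<exists>w. (\<forall>x. w x \<in> Z p (j - 1)) \<and> ?u = (\<Sum>x\<in>UNIV. fvar x (w x))"
      by (intro exI[of _ "\<lambda>x. dd p (q x)"]) simp
  qed
qed

end

lemma dbar_mult_mat:
  fixes g :: "nat \<Rightarrow> nat \<Rightarrow> ('n::finite, 'k::field) mpoly"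
  assumes D: "D \<in> carrier_mat m n" and gD: "\<And>l k. l < m \<Longrightarrow> k < n \<Longrightarrow> g k l = D $$ (l, k)"
  shows "map_mat const_coeff D *\<^sub>v vec n z = vec m (const_part (psum fscale n g (const_lift z)))"
proof (rule eq_vecI)
  fix l assume "l < dim_vec (vec m (const_part (psum fscale n g (const_lift z))))"
  then have l: "l < m" by simp
  have cc: "const_coeff (cst c * p) = c * const_coeff p" for c and p :: "('n, 'k) mpoly"
  proof -
    have "cst c * p = Poly_Mapping.map ((*) c) p"
      by (simp add: cst_def mult_map_scale_conv_mult)
    then show ?thesis
      by (simp add: const_coeff_def map.rep_eq when_def)
  qed
  show "(map_mat const_coeff D *\<^sub>v vec n z) $ l = vec m (const_part (psum fscale n g (const_lift z))) $ l"
    using D l gD[OF l] by (simp add: scalar_prod_def const_part_def psum_def sum_fun_apply const_lift_def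
        const_coeff_sum cc atLeast0LessThan mult.commute)
qed (use D in simp)

text \<open>The homology of the complex \<open>F \<otimes> K\<close> is Koszul homology, for every graded free resolution.\<close>

theorem (in decomposed_module) tensor_K_exact_iff:
  assumes B: "submod B" and res: "graded_free_resolution scale gr (tot B) b a D e"
  shows "tensor_K_cycles b a D i j \<subseteq> tensor_K_boundaries b a D i j \<longleftrightarrow> koszul_exact X B (\<lambda>_. {0}) i j"
proof -
  have D: "D p \<in> carrier_mat (b p) (b (Suc p))" for p
    using res by (simp add: graded_free_resolution_def)
  define g where "g p k l = (if l < b p then D p $$ (l, k) else 0)" for p k l
  have gD: "\<And>p l k. l < b p \<Longrightarrow> k < b (Suc p) \<Longrightarrow> g p k l = D p $$ (l, k)"
    and g0: "\<And>p l k. l \<ge> b p \<Longrightarrow> k < b (Suc p) \<Longrightarrow> g p k l = 0"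
    by (simp_all add: g_def)
  have "fun_resolution scale gr (tot B) b a g e"
    using res resolution_translation[of D b g scale gr "tot B" a e, OF D gD g0] by blast
  then interpret R: resolved_module scale gr C comp B b a g e
    by unfold_locales (rule B)
  have comp_eq: "tensor_K_comp b a p j = vec (b p) ` R.T p j" for p
  proof (intro subset_antisym subsetI)
    fix v :: "'k vec" assume v: "v \<in> tensor_K_comp b a p j"
    define z where "z k = (if k < b p then v $ k else 0)" for k
    have "v = vec (b p) z" "z \<in> R.T p j"
      using v by (auto simp: tensor_K_comp_def z_def const_vecs_def)
    then show "v \<in> vec (b p) ` R.T p j" by blast
  qed (auto simp: tensor_K_comp_def const_vecs_def)
  have Dbar: "map_mat const_coeff (D p) *\<^sub>v vec (b (Suc p)) z = vec (b p) (R.dbar p z)" for p z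
    unfolding R.dbar_def by (rule dbar_mult_mat[OF D gD])
  have supp: "l \<ge> b p \<Longrightarrow> R.dbar p z l = 0" for p z l
    using g0 by (auto simp: R.dbar_def const_part_def psum_def sum_fun_apply const_coeff_sum intro!: sum.neutral)
  have zsupp: "l \<ge> b p \<Longrightarrow> z l = 0" if "z \<in> R.T p j" for p l and z :: "nat \<Rightarrow> 'k"
    using that by (force simp: const_vecs_def)
  have vec_eq: "vec n u = vec n v \<longleftrightarrow> u = v" if "\<And>l. l \<ge> n \<Longrightarrow> u l = 0" "\<And>l. l \<ge> n \<Longrightarrow> v l = 0" for n and u v :: "nat \<Rightarrow> 'k"
  proof
    assume eq: "vec n u = vec n v"
    show "u = v"
    proof
      fix l
      show "u l = v l"
        using that[of l] arg_cong[OF eq, of "\<lambda>w. w $ l"] by (cases "l < n") auto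
    qed
  qed simp
  have zero: "0\<^sub>v n = vec n (0 :: nat \<Rightarrow> 'k)" for n
    by (rule eq_vecI) auto
  have bnd: "vec (b p) z \<in> tensor_K_boundaries b a D p j \<longleftrightarrow> (\<exists>y\<in>R.T (Suc p) j. z = R.dbar p y)"
    if z: "z \<in> R.T p j" for p and z :: "nat \<Rightarrow> 'k"
  proof -
    have "vec (b p) z = vec (b p) (R.dbar p y) \<longleftrightarrow> z = R.dbar p y" for y
      by (rule vec_eq[OF zsupp[OF z] supp])
    then show ?thesis
      unfolding tensor_K_boundaries_def comp_eq image_image Dbar by blast
  qed
  show ?thesis
  proof (cases i)
    case 0
    have "tensor_K_cycles b a D 0 j = vec (b 0) ` R.T 0 j"
      by (simp add: tensor_K_cycles_def comp_eq)
    then have "tensor_K_cycles b a D 0 j \<subseteq> tensor_K_boundaries b a D 0 j \<longleftrightarrow>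
        (\<forall>z\<in>R.T 0 j. \<exists>y\<in>R.T (Suc 0) j. z = R.dbar 0 y)"
      using bnd[of _ 0] by (simp add: image_subset_iff)
    then show ?thesis
      using 0 by (simp add: R.exact_B_iff R.exact_0_iff)
  next
    case (Suc p)
    have cyc: "tensor_K_cycles b a D (Suc p) j = vec (b (Suc p)) ` {z \<in> R.T (Suc p) j. R.dbar p z = 0}"
    proof -
      have "vec (b p) (R.dbar p z) = 0\<^sub>v (b p) \<longleftrightarrow> R.dbar p z = 0" for z
        unfolding zero by (rule vec_eq[OF supp]) auto
      then show ?thesis
        unfolding tensor_K_cycles_def by (auto simp: comp_eq Dbar)
    qed
    have "tensor_K_cycles b a D (Suc p) j \<subseteq> tensor_K_boundaries b a D (Suc p) j \<longleftrightarrow>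
        (\<forall>z\<in>R.T (Suc p) j. R.dbar p z = 0 \<longrightarrow> (\<exists>y\<in>R.T (Suc (Suc p)) j. z = R.dbar (Suc p) y))"
      unfolding cyc using bnd[of _ "Suc p"] by (auto simp: image_subset_iff)
    then show ?thesis
      using Suc R.exact_shift_all[of p 0 j] by (simp add: R.exact_1_iff)
  qed
qed

text \<open>The definition of \<open>Tor\<close> asks for some resolution \<open>F\<close> such that \<open>F \<otimes> K\<close> has homology. A resolution
  exists, and each of them computes Koszul homology.\<close>

corollary (in decomposed_module) Tor_K_nonzero_iff:
  assumes acc: "K.acc UNIV C" and B: "submod B"
  shows "Tor_K_nonzero scale gr (tot B) i j \<longleftrightarrow> \<not> koszul_exact X B (\<lambda>_. {0}) i j"
proof
  assume "Tor_K_nonzero scale gr (tot B) i j"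
  then obtain b a D e where "graded_free_resolution scale gr (tot B) b a D e"
    "\<not> tensor_K_cycles b a D i j \<subseteq> tensor_K_boundaries b a D i j"
    unfolding Tor_K_nonzero_def by blast
  then show "\<not> koszul_exact X B (\<lambda>_. {0}) i j"
    using tensor_K_exact_iff[OF B, of b a D e i j] by blast
next
  assume no: "\<not> koszul_exact X B (\<lambda>_. {0}) i j"
  obtain b a g e where fr: "fun_resolution scale gr (tot B) b a g e"
    using fun_resolution_exists[OF acc B] by blast
  define D where "D p = mat (b p) (b (Suc p)) (\<lambda>(l, k). g p k l)" for p
  have "g p k l = 0" if "l \<ge> b p" "k < b (Suc p)" for p l k
    using fr that by (auto simp: fun_resolution_def free_gr_def)
  then have "graded_free_resolution scale gr (tot B) b a D e"
    using resolution_translation[of D b g scale gr "tot B" a e] fr by (auto simp: D_def)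
  then show "Tor_K_nonzero scale gr (tot B) i j"
    using tensor_K_exact_iff[OF B] no unfolding Tor_K_nonzero_def by blast
qed

section \<open>Regularity of a product\<close>

lemma (in pregraded_module) span_subset_if_stable:
  assumes "K.stable UNIV N" "S \<subseteq> N"
  shows "span S \<subseteq> N"
proof -
  have "subspace N"
    using K.stableD[OF assms(1)] stable_scale[OF assms(1)] by (intro subspaceI)
  with assms(2) show ?thesis
    by (rule span_minimal)
qed

text \<open>The ideal contains the homogeneous components of its elements because its generators are
  homogeneous.\<close>

lemma ideal_eq_tot:
  fixes f :: "nat \<Rightarrow> ('n::finite, 'k::field) mpoly"
  assumes f: "\<And>k. k < m \<Longrightarrow> f k \<in> forms (int (d k))"
  shows "Modules.module.span (*) (f ` {..<m}) = decomposed_module.tot UNIV hpart (poly.seqsub f d m)"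
proof -
  interpret R: decomposed_module "(*)" forms "UNIV :: ('n, 'k) mpoly set" hpart
    by (rule decomposed_poly)
  have sub: "poly.submod (poly.seqsub f d m)"
    using f by (rule poly.submod_seqsub)
  show ?thesis
  proof (intro subset_antisym)
    show "poly.span (f ` {..<m}) \<subseteq> R.tot (poly.seqsub f d m)"
    proof (rule poly.span_subset_if_stable[OF R.stable_tot[OF sub]])
      show "f ` {..<m} \<subseteq> R.tot (poly.seqsub f d m)"
      proof
        fix p assume "p \<in> f ` {..<m}"
        then obtain i where i: "i < m" "p = f i" by blast
        have "f i = (\<Sum>k<m. f k * (if k = i then 1 else 0))"
          using i(1) sum.delta[of "{..<m}" i f] by (simp add: if_distrib cong: if_cong)
        then have "p \<in> poly.seqsub f d m (int (d i))"
          unfolding poly.seqsub_iff i(2) by (intro exI[of _ "\<lambda>k. if k = i then 1 else 0"]) auto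
        then show "p \<in> R.tot (poly.seqsub f d m)"
          using R.tot_iff_gr[OF sub f[OF i(1)]] i(2) by blast
      qed
    qed
    show "R.tot (poly.seqsub f d m) \<subseteq> poly.span (f ` {..<m})"
    proof
      fix p assume p: "p \<in> R.tot (poly.seqsub f d m)"
      have "hpart j p \<in> poly.span (f ` {..<m})" for j
      proof -
        have "hpart j p \<in> poly.seqsub f d m j"
          using p by (simp add: R.tot_def)
        then obtain v where "hpart j p = (\<Sum>k<m. f k * v k)"
          unfolding poly.seqsub_iff by blast
        also have "\<dots> = (\<Sum>k<m. v k * f k)"
          by (simp add: mult.commute)
        also have "\<dots> \<in> poly.span (f ` {..<m})"
          by (intro poly.span_sum poly.span_scale poly.span_base) simp
        finally show ?thesis .
      qed
      then have "(\<Sum>j\<in>degs p. hpart j p) \<in> poly.span (f ` {..<m})"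
        by (intro poly.span_sum)
      then show "p \<in> poly.span (f ` {..<m})"
        using mpoly_eq_sum_hpart[OF finite_degs order_refl, of p] by simp
    qed
  qed
qed

lemma ideal_times_module_eq_tot:
  fixes scale :: "('n::finite, 'k::field) mpoly \<Rightarrow> 'm::ab_group_add \<Rightarrow> 'm" and comp :: "int \<Rightarrow> 'm \<Rightarrow> 'm"
  assumes dm: "decomposed_module scale gr UNIV comp"
    and f: "\<And>k. k < m \<Longrightarrow> f k \<in> forms (int (d k))"
  shows "ideal_times_module scale (Modules.module.span (*) (f ` {..<m})) UNIV
    = decomposed_module.tot UNIV comp (pregraded_module.seqsub scale gr f d m)"
proof -
  interpret decomposed_module scale gr UNIV comp by (rule dm)
  define I where "I = Modules.module.span (*) (f ` {..<m})"
  have sub: "submod (seqsub f d m)"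
    using f by (rule submod_seqsub)
  show ?thesis
    unfolding I_def[symmetric] ideal_times_module_def
  proof (intro subset_antisym)
    show "span {scale p x |p x. p \<in> I \<and> x \<in> UNIV} \<subseteq> tot (seqsub f d m)"
    proof (rule span_subset_if_stable[OF stable_tot[OF sub]])
      have "scale (f i) x \<in> tot (seqsub f d m)" if i: "i < m" for i x
      proof -
        have "comp j (scale (f i) x) \<in> seqsub f d m j" for j
        proof -
          have "comp j (scale (f i) x) = scale (f i) (comp (j - int (d i)) x)"
            by (rule comp_scale[OF _ f[OF i]]) simp
          also have "\<dots> = (\<Sum>k<m. scale (f k) (if k = i then comp (j - int (d i)) x else 0))"
            using i by (simp add: if_distrib cong: if_cong)
          finally show ?thesis
            unfolding seqsub_iff
            by (intro exI[of _ "\<lambda>k. if k = i then comp (j - int (d i)) x else 0"]) (auto simp: gr_zero comp_gr)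
        qed
        then show ?thesis by (simp add: tot_def)
      qed
      note gen = this
      have "I \<subseteq> {p. \<forall>x. scale p x \<in> tot (seqsub f d m)}"
        unfolding I_def
      proof (rule poly.span_minimal)
        show "f ` {..<m} \<subseteq> {p. \<forall>x. scale p x \<in> tot (seqsub f d m)}"
          using gen by blast
        note st = stable_tot[OF sub]
        show "poly.subspace {p. \<forall>x. scale p x \<in> tot (seqsub f d m)}"
          unfolding poly.subspace_def using K.stableD(1,2)[OF st] stable_scale[OF st]
          by (simp add: scale_left_distrib flip: scale_scale)
      qed
      then show "{scale p x |p x. p \<in> I \<and> x \<in> UNIV} \<subseteq> tot (seqsub f d m)"
        by blast
    qed
    show "tot (seqsub f d m) \<subseteq> span {scale p x |p x. p \<in> I \<and> x \<in> UNIV}"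
    proof
      fix u assume u: "u \<in> tot (seqsub f d m)"
      have fI: "f k \<in> I" if "k < m" for k
        unfolding I_def using that by (intro poly.span_base) simp
      have "comp j u \<in> span {scale p x |p x. p \<in> I \<and> x \<in> UNIV}" for j
      proof -
        have "comp j u \<in> seqsub f d m j"
          using u by (simp add: tot_def)
        then obtain v where v: "comp j u = (\<Sum>k<m. scale (f k) (v k))"
          unfolding seqsub_iff by blast
        show ?thesis
          unfolding v using fI by (intro span_sum span_base) auto
      qed
      moreover obtain J where "u = (\<Sum>j\<in>J. comp j u)"
        using comp_exhaust[of u] by auto
      ultimately show "u \<in> span {scale p x |p x. p \<in> I \<and> x \<in> UNIV}"
        by (metis (no_types, lifting) span_sum)
    qed
  qed
qed

lemma regularity_le:
  assumes "\<And>i j. Tor_K_nonzero scale gr N i j \<Longrightarrow> j - int i \<le> s"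
  shows "regularity scale gr N \<le> ereal (real_of_int s)"
  unfolding regularity_def
proof (rule SUP_least)
  fix i
  have "tor_top_degree scale gr N i \<le> ereal (real_of_int (s + int i))"
    unfolding tor_top_degree_def
  proof (rule SUP_least)
    fix j assume "j \<in> {j. Tor_K_nonzero scale gr N i j}"
    then have "j \<le> s + int i"
      using assms[of i j] by simp
    then show "ereal (real_of_int j) \<le> ereal (real_of_int (s + int i))"
      unfolding ereal_less_eq of_int_le_iff .
  qed
  then have "tor_top_degree scale gr N i - ereal (real i) \<le> ereal (real_of_int (s + int i)) - ereal (real i)"
    by (intro ereal_minus_mono) auto
  then show "tor_top_degree scale gr N i - ereal (real i) \<le> ereal (real_of_int s)"
    by simp
qed

lemma le_regularity:
  assumes "Tor_K_nonzero scale gr N i j"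
  shows "ereal (real_of_int (j - int i)) \<le> regularity scale gr N"
proof -
  have "ereal (real_of_int j) \<le> tor_top_degree scale gr N i"
    unfolding tor_top_degree_def using assms by (intro SUP_upper) simp
  then have "ereal (real_of_int j) - ereal (real i) \<le> tor_top_degree scale gr N i - ereal (real i)"
    by (intro ereal_minus_mono) auto
  also have "\<dots> \<le> regularity scale gr N"
    unfolding regularity_def by (rule SUP_upper) simp
  finally show ?thesis by simp
qed

lemma regularity_eq_MInf:
  assumes "\<And>i j. \<not> Tor_K_nonzero scale gr N i j"
  shows "regularity scale gr N = - \<infinity>"
proof -
  have "tor_top_degree scale gr N i = - \<infinity>" for i
    unfolding tor_top_degree_def using assms by (metis (no_types, lifting) SUP_empty bot_ereal_def empty_Collect_eq)
  then show ?thesis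
    by (simp add: regularity_def)
qed

lemma koszul_exact_trivial: "koszul_exact X (\<lambda>_. {0}) (\<lambda>_. {0}) i j"
  if "koszul_ops X"
proof -
  interpret koszul_ops X by (rule that)
  have "u = 0" if "u \<in> kchains (\<lambda>_. {0}) j" for u :: "'a set \<Rightarrow> 'b"
    using that by (auto simp: kchains_def fun_eq_iff)
  moreover have "(0 :: 'a set \<Rightarrow> 'b) \<in> kchains (\<lambda>_. {0}) j" "in_degree (Suc i) (0 :: 'a set \<Rightarrow> 'b)"
    by (auto simp: kchains_def in_degree_def)
  ultimately show ?thesis
    unfolding koszul_exact_def by (metis bd_zero diff_zero)
qed

text \<open>Over a finite field some nonzero polynomial vanishes at all points: two powers of a
  coordinate define the same function. A general polynomial condition is then vacuous.\<close>

lemma exists_vanishing_polynomial: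
  assumes "finite (UNIV :: 'k::field set)"
  shows "\<exists>P :: ('x, 'k) mpoly. P \<noteq> 0 \<and> mpoly_vars P \<subseteq> {x} \<and> (\<forall>v. mpoly_eval v P = 0)"
proof -
  have "finite (UNIV :: ('k \<Rightarrow> 'k) set)"
    using finite_PiE[OF assms, of "\<lambda>_. UNIV :: 'k set"] assms by (simp add: PiE_UNIV_domain)
  then have "finite (range (\<lambda>(n :: nat) (c :: 'k). c ^ n))"
    using finite_subset subset_UNIV by blast
  then have "\<not> inj (\<lambda>(n :: nat) (c :: 'k). c ^ n)"
    using finite_imageD infinite_UNIV_nat by blast
  then obtain p q :: nat where pq: "p \<noteq> q" "\<And>c :: 'k. c ^ p = c ^ q"
    unfolding inj_def by (metis (mono_tags, lifting))
  define P :: "('x, 'k) mpoly" where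
    "P = Poly_Mapping.single (Poly_Mapping.single x p) 1 + Poly_Mapping.single (Poly_Mapping.single x q) (- 1)"
  have "Poly_Mapping.single x p \<noteq> Poly_Mapping.single x q"
    using pq(1) by (metis lookup_single_eq)
  then have "Poly_Mapping.lookup P (Poly_Mapping.single x p) = 1"
    by (simp add: P_def lookup_add lookup_single)
  then have "P \<noteq> 0" by auto
  moreover have "mpoly_vars P \<subseteq> {x}"
  proof -
    have "mpoly_vars (Poly_Mapping.single (Poly_Mapping.single x r) c) \<subseteq> {x}" for r :: nat and c :: 'k
      by (auto simp: mpoly_vars_def split: if_splits)
    then show ?thesis
      unfolding P_def by (intro subset_trans[OF mpoly_vars_add] Un_least)
  qed
  moreover have "mpoly_eval v P = 0" for v
  proof -
    have "mpoly_eval v (Poly_Mapping.single (Poly_Mapping.single x r) c) = c * v x ^ r" for r :: nat and c :: 'k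
      by (cases "r = 0") (simp_all add: mpoly_eval_single)
    then show ?thesis
      by (simp add: P_def mpoly_eval_add pq(2)[of "v x"])
  qed
  ultimately show ?thesis by blast
qed

lemma (in decomposed_module) reg_le_zero_iff:
  assumes "K.acc UNIV C" "C = UNIV"
  shows "reg_le (\<lambda>_. {0}) s \<longleftrightarrow> (\<forall>i j. Tor_K_nonzero scale gr UNIV i j \<longrightarrow> j - int i \<le> s)"
proof -
  have "tot gr = UNIV"
    unfolding tot_def using assms(2) comp_gr by blast
  then have "Tor_K_nonzero scale gr UNIV i j \<longleftrightarrow> \<not> acyclic_mod (\<lambda>_. {0}) i j" for i j
    using Tor_K_nonzero_iff[OF assms(1) submod_gr] by simp
  then show ?thesis
    unfolding reg_le_def by (meson not_le)
qed

text \<open>Nakayama's lemma for a module that vanishes in very negative degrees.\<close>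

lemma (in decomposed_module) gr_zero_if_acyclic:
  assumes acc: "K.acc UNIV C" and ac: "\<And>j. acyclic_mod (\<lambda>_. {0}) 0 j"
  shows "gr j = {0}"
proof -
  obtain L where L: "\<And>j. j < L \<Longrightarrow> gr j = {0}"
    using gr_finite_dimensional(2)[OF acc] by blast
  have "gr (L - 1 + int k) = {0}" for k
  proof (induction k)
    case (Suc k)
    have "u = 0" if u: "u \<in> gr (L - 1 + int (Suc k))" for u
    proof -
      obtain v where v: "\<And>x. v x \<in> gr (L - 1 + int (Suc k) - 1)" "u = (\<Sum>x\<in>UNIV. X x (v x))"
        using bspec[OF ac[of "L - 1 + int (Suc k)", unfolded koszul_exact_0_iff[OF gr_sub submod_graded_sub[OF submod_zero]]] u]
        by (simp only: singleton_iff right_minus_eq) blast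
      have "L - 1 + int (Suc k) - 1 = L - 1 + int k"
        by simp
      with v(1) Suc have "v x = 0" for x
        by (metis singletonD)
      then show ?thesis by (simp add: v(2))
    qed
    then show ?case
      using gr_zero by blast
  qed (simp add: L)
  from this[of "nat (j - (L - 1))"] show ?thesis
    using L[of j] by (cases "j < L") auto
qed

text \<open>Powers of linear forms that are filter-regular on two given modules at once.\<close>

lemma exists_filter_regular_powers:
  fixes scale :: "('n::finite, 'k::field) mpoly \<Rightarrow> 'm::ab_group_add \<Rightarrow> 'm"
    and scale' :: "('n, 'k) mpoly \<Rightarrow> 'l::ab_group_add \<Rightarrow> 'l"
    and comp :: "int \<Rightarrow> 'm \<Rightarrow> 'm" and comp' :: "int \<Rightarrow> 'l \<Rightarrow> 'l"
  assumes M: "decomposed_module scale gr UNIV comp" and N: "decomposed_module scale' gr' UNIV comp'"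
    and accM: "operator_space.acc (\<lambda>c. scale (cst c)) (\<lambda>x. scale (var x)) UNIV UNIV"
    and accN: "operator_space.acc (\<lambda>c. scale' (cst c)) (\<lambda>x. scale' (var x)) UNIV UNIV"
    and inf: "infinite (UNIV :: 'k set)"
  obtains c :: "nat \<Rightarrow> 'k" where "inj c"
    "\<And>i. \<exists>J. \<forall>j\<ge>J. pregraded_module.inj_mod scale gr (lin (c i) ^ d i) (int (d i))
      (pregraded_module.seqsub scale gr (\<lambda>k. lin (c k) ^ d k) d i) j"
    "\<And>i. \<exists>J. \<forall>j\<ge>J. pregraded_module.inj_mod scale' gr' (lin (c i) ^ d i) (int (d i))
      (pregraded_module.seqsub scale' gr' (\<lambda>k. lin (c k) ^ d k) d i) j"
proof -
  interpret M: decomposed_module scale gr UNIV comp by (rule M)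
  interpret N: decomposed_module scale' gr' UNIV comp' by (rule N)
  let ?f = "\<lambda>c k. lin (c k) ^ d k :: ('n, 'k) mpoly"
  let ?P = "\<lambda>c i z. z \<notin> c ` {..<i} \<and>
    (\<exists>J. \<forall>j\<ge>J. M.inj_mod (lin z ^ d i) (int (d i)) (M.seqsub (?f c) d i) j) \<and>
    (\<exists>J. \<forall>j\<ge>J. N.inj_mod (lin z ^ d i) (int (d i)) (N.seqsub (?f c) d i) j)"
  have "\<exists>c. \<forall>i. ?P c i (c i)"
  proof (rule dependent_wellorder_choice)
    fix z and c c' :: "nat \<Rightarrow> 'k" and i :: nat
    assume eq: "\<And>k. k < i \<Longrightarrow> c k = c' k"
    have "M.seqsub (?f c) d i = M.seqsub (?f c') d i" "N.seqsub (?f c) d i = N.seqsub (?f c') d i"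
      using eq by (auto intro!: M.seqsub_cong N.seqsub_cong)
    moreover have "c ` {..<i} = c' ` {..<i}"
      using eq by (intro image_cong) auto
    ultimately show "?P c i z = ?P c' i z"
      by simp
  next
    fix i :: nat and c :: "nat \<Rightarrow> 'k"
    have f: "?f c k \<in> forms (int (d k))" for k
      using forms_power[OF lin_forms, of "c k" "d k"] by simp
    have "finite (c ` {..<i} \<union> {z. \<not> (\<exists>J. \<forall>j\<ge>J. M.inj_mod (lin z ^ d i) (int (d i)) (M.seqsub (?f c) d i) j)}
      \<union> {z. \<not> (\<exists>J. \<forall>j\<ge>J. N.inj_mod (lin z ^ d i) (int (d i)) (N.seqsub (?f c) d i) j)})" (is "finite ?Bad")
      using M.finite_bad_values[OF accM M.submod_seqsub[OF f]] N.finite_bad_values[OF accN N.submod_seqsub[OF f]]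
      by simp
    from ex_new_if_finite[OF inf this] obtain z where z: "z \<notin> ?Bad" ..
    have "?P c i z"
    proof (intro conjI)
      show "z \<notin> c ` {..<i}"
        using z by (simp only: Un_iff de_Morgan_disj simp_thms)
      show "\<exists>J. \<forall>j\<ge>J. M.inj_mod (lin z ^ d i) (int (d i)) (M.seqsub (?f c) d i) j"
        by (rule ccontr) (use z in \<open>simp only: Un_iff mem_Collect_eq simp_thms\<close>)
      show "\<exists>J. \<forall>j\<ge>J. N.inj_mod (lin z ^ d i) (int (d i)) (N.seqsub (?f c) d i) j"
        by (rule ccontr) (use z in \<open>simp only: Un_iff mem_Collect_eq simp_thms\<close>)
    qed
    then show "\<exists>z. ?P c i z" ..
  qed
  then obtain c where c: "\<forall>i. ?P c i (c i)" ..
  have "inj c"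
  proof (rule linorder_injI)
    fix k i :: nat assume "k < i"
    then show "c k \<noteq> c i"
      using conjunct1[OF spec[OF c, of i]] by (metis imageI lessThan_iff)
  qed
  then show thesis
  proof (rule that[of c])
    show "\<exists>J. \<forall>j\<ge>J. M.inj_mod (lin (c i) ^ d i) (int (d i)) (M.seqsub (?f c) d i) j" for i
      by (rule conjunct1[OF conjunct2[OF spec[OF c, of i]]])
    show "\<exists>J. \<forall>j\<ge>J. N.inj_mod (lin (c i) ^ d i) (int (d i)) (N.seqsub (?f c) d i) j" for i
      by (rule conjunct2[OF conjunct2[OF spec[OF c, of i]]])
  qed
qed

theorem corollary2p4:
  fixes scale :: "('n::finite, 'k::field) mpoly \<Rightarrow> 'm::ab_group_add \<Rightarrow> 'm"
    and gr :: "int \<Rightarrow> 'm set"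
    and m :: nat
    and d :: "nat \<Rightarrow> nat"
  assumes "graded_module scale gr"
    and "\<exists>G. finite G \<and> Modules.module.span scale G = UNIV"
    and "m \<le> CARD('n)"
    and "\<forall>i < m. 1 \<le> d i"
  shows "\<exists>P :: (nat \<times> ('n \<Rightarrow>\<^sub>0 nat), 'k) mpoly.
    P \<noteq> 0 \<and> mpoly_vars P \<subseteq> form_coords m d \<and>
    (\<forall>f \<in> nonvanishing_locus m d P.
       let I = Modules.module.span (*) (f ` {..<m}) in
       regularity scale gr (ideal_times_module scale I UNIV)
         \<le> regularity scale gr UNIV + regularity (*) forms I)"
proof -
  obtain comp where dm: "decomposed_module scale gr UNIV comp"
    using decomposed_graded_module[OF assms(1)] by blast
  interpret M: decomposed_module scale gr UNIV comp by (rule dm)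
  interpret R: decomposed_module "(*)" forms "UNIV :: ('n, 'k) mpoly set" hpart by (rule decomposed_poly)
  obtain G where "finite G" "M.span G = UNIV"
    using assms(2) by blast
  then have accM: "M.K.acc UNIV UNIV"
    by (intro M.acc_if_finitely_generated[of G]) auto
  have accR: "poly.K.acc UNIV (UNIV :: ('n, 'k) mpoly set)"
    by (rule acc_poly)
  let ?goal = "\<lambda>f. regularity scale gr (ideal_times_module scale (poly.span (f ` {..<m})) UNIV)
      \<le> regularity scale gr UNIV + regularity (*) forms (poly.span (f ` {..<m}))"
  have one: "(1 :: (nat \<times> ('n \<Rightarrow>\<^sub>0 nat), 'k) mpoly) \<noteq> 0" "mpoly_vars (1 :: (nat \<times> ('n \<Rightarrow>\<^sub>0 nat), 'k) mpoly) \<subseteq> form_coords m d"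
    by (auto simp: mpoly_vars_def)
  have product_Tor: "Tor_K_nonzero scale gr (ideal_times_module scale (poly.span (f ` {..<m})) UNIV) i j \<longleftrightarrow>
      \<not> koszul_exact M.X (M.seqsub f d m) (\<lambda>_. {0}) i j" if "f \<in> points m d" for f i j
  proof -
    have f: "f k \<in> forms (int (d k))" if "k < m" for k
      using \<open>f \<in> points m d\<close> that by (simp add: points_def)
    show ?thesis
      using ideal_times_module_eq_tot[OF dm f] M.Tor_K_nonzero_iff[OF accM M.submod_seqsub[OF f]] by simp
  qed
  have vanishing_case: "?goal f" if f: "f \<in> points m d" and zero: "\<And>j. M.seqsub f d m j = {0}" for f
  proof -
    have "M.seqsub f d m = (\<lambda>_. {0})"
      using zero by blast
    then have "\<not> Tor_K_nonzero scale gr (ideal_times_module scale (poly.span (f ` {..<m})) UNIV) i j" for i j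
      using product_Tor[OF f] koszul_exact_trivial[OF M.koszul_ops_axioms] by simp
    then show ?thesis
      by (simp add: regularity_eq_MInf)
  qed
  consider (zero) "m = 0" | (infinite_reg) "regularity scale gr UNIV = \<infinity>"
    | (minf) "regularity scale gr UNIV = - \<infinity>"
    | (finite_field) "m > 0" "finite (UNIV :: 'k set)"
    | (main) \<rho> where "m > 0" "infinite (UNIV :: 'k set)" "regularity scale gr UNIV = ereal \<rho>"
    by (cases "regularity scale gr UNIV") auto
  then have "\<exists>P :: (nat \<times> ('n \<Rightarrow>\<^sub>0 nat), 'k) mpoly. P \<noteq> 0 \<and> mpoly_vars P \<subseteq> form_coords m d \<and>
    (\<forall>f \<in> nonvanishing_locus m d P. ?goal f)"
  proof cases
    case zero
    have "?goal f" if "f \<in> nonvanishing_locus m d 1" for f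
      using zero by (intro vanishing_case) (auto simp: points_def)
    then show ?thesis
      using one by blast
  next
    case infinite_reg
    \<comment> \<open>In the extended reals, the sum on the right-hand side is \<open>\<infinity>\<close> whatever the regularity of \<open>I\<close> is.\<close>
    then have "?goal f" for f :: "nat \<Rightarrow> ('n, 'k) mpoly"
      by simp
    then show ?thesis
      using one by blast
  next
    case minf
    \<comment> \<open>All \<open>Tor\<close> vanish, hence \<open>M = 0\<close> by Nakayama.\<close>
    have "\<not> Tor_K_nonzero scale gr UNIV i j" for i j
      using le_regularity[of scale gr UNIV i j] minf by auto
    then have "M.reg_le (\<lambda>_. {0}) s" for s
      using M.reg_le_zero_iff[OF accM refl] by blast
    then have "M.acyclic_mod (\<lambda>_. {0}) 0 j" for j
      unfolding M.reg_le_def by (metis diff_zero int_ops(1) lt_ex)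
    then have gr0: "gr j = {0}" for j
      by (rule M.gr_zero_if_acyclic[OF accM])
    have "?goal f" if "f \<in> nonvanishing_locus m d 1" for f
    proof (rule vanishing_case)
      show f: "f \<in> points m d"
        using that by (simp add: nonvanishing_locus_def points_def)
      have sub: "M.submod (M.seqsub f d m)"
        using f by (intro M.submod_seqsub) (simp add: points_def)
      show "M.seqsub f d m j = {0}" for j
        using M.submodD(2)[OF sub] gr0 graded_subD(1)[OF M.submod_graded_sub[OF sub]] by blast
    qed
    then show ?thesis
      using one by blast
  next
    case finite_field
    let ?x = "(0 :: nat, Poly_Mapping.single (undefined :: 'n) (d 0))"
    obtain P :: "(nat \<times> ('n \<Rightarrow>\<^sub>0 nat), 'k) mpoly" where P: "P \<noteq> 0" "mpoly_vars P \<subseteq> {?x}" "\<And>v. mpoly_eval v P = 0"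
      using exists_vanishing_polynomial[OF finite_field(2), of ?x] by blast
    have "?x \<in> form_coords m d"
      using finite_field(1) by (simp add: form_coords_def)
    then have "mpoly_vars P \<subseteq> form_coords m d"
      using P(2) by blast
    moreover have "nonvanishing_locus m d P = {}"
      using P(3) by (simp add: nonvanishing_locus_def)
    ultimately show ?thesis
      using P(1) by blast
  next
    case main
    define r where "r = \<lfloor>\<rho>\<rfloor>"
    have regM: "M.reg_le (\<lambda>_. {0}) r"
      unfolding M.reg_le_zero_iff[OF accM refl]
    proof (intro allI impI)
      fix i j assume "Tor_K_nonzero scale gr UNIV i j"
      from le_regularity[OF this] have "real_of_int (j - int i) \<le> \<rho>"
        using main(3) by simp
      then show "j - int i \<le> r"
        unfolding r_def by (simp only: le_floor_iff)
    qed
    have regR: "poly.reg_le (\<lambda>_. {0 :: ('n, 'k) mpoly}) 0"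
      unfolding poly.reg_le_def
    proof (intro allI impI)
      fix i :: nat and j assume j: "j - int i > 0"
      show "poly.acyclic_mod (\<lambda>_. {0 :: ('n, 'k) mpoly}) i j"
      proof (cases i)
        case (Suc q)
        then show ?thesis by (simp add: koszul_exact_poly)
      next
        case 0
        have "\<exists>v. (\<forall>x. v x \<in> forms (j - 1)) \<and> u - (\<Sum>x\<in>UNIV. var x * v x) \<in> {0}"
          if u: "u \<in> forms j" for u :: "('n, 'k) mpoly"
        proof -
          have "1 \<le> j" using j 0 by simp
          then obtain g where "u = (\<Sum>x\<in>UNIV. var x * g x)" "\<And>x. g x \<in> forms (j - 1)"
            using form_eq_sum_var[OF u] by blast
          then show ?thesis by (intro exI[of _ g]) simp
        qed
        then show ?thesis
          unfolding 0 poly.koszul_exact_0_iff[OF poly.gr_sub poly.submod_graded_sub[OF poly.submod_zero]] by blast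
      qed
    qed
    \<comment> \<open>The first \<open>m\<close> forms are continued to \<open>n\<close> forms by linear forms.\<close>
    define d' where "d' k = (if k < m then d k else 1)" for k
    have d': "d' k = d k" if "k < m" for k
      using that by (simp add: d'_def)
    have d'1: "d' k \<ge> 1" for k
      using assms(4) by (simp add: d'_def)
    obtain c :: "nat \<Rightarrow> 'k" where c: "inj c"
      "\<And>i. \<exists>J. \<forall>j\<ge>J. M.inj_mod (lin (c i) ^ d' i) (int (d' i)) (M.seqsub (\<lambda>k. lin (c k) ^ d' k) d' i) j"
      "\<And>i. \<exists>J. \<forall>j\<ge>J. poly.inj_mod (lin (c i) ^ d' i :: ('n, 'k) mpoly) (int (d' i)) (poly.seqsub (\<lambda>k. lin (c k) ^ d' k) d' i) j"
      by (rule exists_filter_regular_powers[OF dm decomposed_poly accM accR main(2), of d']) (rule that)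
    define g where "g k = (lin (c k) ^ d' k :: ('n, 'k) mpoly)" for k
    have g: "g k \<in> forms (int (d' k))" for k
      using forms_power[OF lin_forms, of "c k" "d' k"] by (simp add: g_def)
    have c_inj: "inj_on c {..<CARD('n)}"
      using c(1) by (rule inj_on_subset) simp
    have cofM: "\<exists>J. \<forall>j\<ge>J. gr j \<subseteq> M.seqsub g d' CARD('n) j"
      unfolding g_def by (rule M.powers_cofinite[OF _ c_inj d'1, of r]) (use regM in \<open>simp add: M.reg_le_def\<close>)
    have cofR: "\<exists>J. \<forall>j\<ge>J. (forms j :: ('n, 'k) mpoly set) \<subseteq> poly.seqsub g d' CARD('n) j"
      unfolding g_def by (rule poly.powers_cofinite[OF _ c_inj d'1, of 0]) (use regR in \<open>simp add: poly.reg_le_def\<close>)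
    obtain \<Phi> where \<Phi>: "polyfun m d \<Phi>" "\<Phi> g \<noteq> 0"
      "\<And>f. f \<in> points m d \<Longrightarrow> \<Phi> f \<noteq> 0 \<Longrightarrow> M.reg_le (M.seqsub f d m) (M.shift r d m)"
      using M.filter_regular_is_open[OF M.gr_finite_dimensional(1)[OF accM] d' d'1 assms(3) g regM c(2)[folded g_def] cofM]
      by blast
    obtain \<Psi> where \<Psi>: "polyfun m d \<Psi>" "\<Psi> g \<noteq> 0"
      "\<And>f i j. f \<in> points m d \<Longrightarrow> \<Psi> f \<noteq> 0 \<Longrightarrow> i < m \<Longrightarrow> j > poly.shift 0 d i \<Longrightarrow>
        poly.inj_mod (f i) (int (d i)) (poly.seqsub f d i) j"
      using poly.filter_regular_is_open[OF R.gr_finite_dimensional(1)[OF accR] d' d'1 assms(3) g regR c(3)[folded g_def] cofR]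
      by blast
    obtain P where P: "mpoly_vars P \<subseteq> form_coords m d"
      "\<And>f. f \<in> points m d \<Longrightarrow> \<Phi> f * \<Psi> f = mpoly_eval (\<lambda>(i, t). Poly_Mapping.lookup (f i) t) P"
      using polyfun_mult[OF \<Phi>(1) \<Psi>(1)] unfolding polyfun_def by blast
    have "g i \<in> forms (int (d i))" if "i < m" for i
      using g[of i] unfolding d'[OF that] .
    then have "g \<in> points m d"
      unfolding points_def by blast
    then have "P \<noteq> 0"
      using P(2)[of g] \<Phi>(2) \<Psi>(2) by auto
    moreover have "?goal f" if "f \<in> nonvanishing_locus m d P" for f
    proof -
      have f: "f \<in> points m d" and nz: "\<Phi> f \<noteq> 0" "\<Psi> f \<noteq> 0"
        using that P(2)[of f] by (auto simp: nonvanishing_locus_def points_def)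
      have fk: "f k \<in> forms (int (d k))" if "k < m" for k
        using f that by (simp add: points_def)
      obtain m' where m': "m = Suc m'"
        using main(1) by (cases m) auto
      define D where "D = (\<Sum>k<m. int (d k))"
      have D: "D \<ge> int m"
      proof -
        have "(\<Sum>k<m. (1 :: int)) \<le> D"
          unfolding D_def using assms(4) by (intro sum_mono) auto
        then show ?thesis by simp
      qed
      have shift: "M.shift r d m = r + D - int m"
        by (simp add: M.shift_def D_def sum_subtractf)
      have sub: "M.submod (M.seqsub f d m)"
        using fk by (rule M.submod_seqsub)
      have "regularity scale gr (ideal_times_module scale (poly.span (f ` {..<m})) UNIV) \<le> ereal (real_of_int (r + D - int m'))"
      proof (rule regularity_le, rule ccontr)
        fix i j assume "Tor_K_nonzero scale gr (ideal_times_module scale (poly.span (f ` {..<m})) UNIV) i j"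
          and j: "\<not> j - int i \<le> r + D - int m'"
        then have no: "\<not> koszul_exact M.X (M.seqsub f d m) (\<lambda>_. {0}) i j"
          using product_Tor[OF f] by simp
        have "koszul_exact M.X (M.seqsub f d m) (\<lambda>_. {0}) i j"
        proof (rule M.koszul_exact_submodule[OF M.gr_sub M.submod_graded_sub[OF sub] M.submod_graded_sub[OF M.submod_zero]])
          show "{0} \<subseteq> M.seqsub f d m j" for j
            using graded_subD(1)[OF M.submod_graded_sub[OF sub]] by simp
          show "M.seqsub f d m j \<subseteq> gr j" for j
            using M.submodD(2)[OF sub] by blast
          show "M.acyclic_mod (\<lambda>_. {0}) i j"
            using regM j D m' by (simp add: M.reg_le_def)
          show "M.acyclic_mod (M.seqsub f d m) (Suc i) j"
            using \<Phi>(3)[OF f nz(1)] j m' unfolding M.reg_le_def shift by simp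
        qed
        then show False
          using no by blast
      qed
      \<comment> \<open>This nonvanishing \<open>Tor\<close> bounds the regularity of \<open>I\<close> from below.\<close>
      moreover have "Tor_K_nonzero (*) forms (poly.span (f ` {..<m})) m' D"
      proof -
        have subR: "poly.submod (poly.seqsub f d m)"
          using fk by (rule poly.submod_seqsub)
        have "\<not> koszul_exact poly.X (poly.seqsub f d m) (\<lambda>_. {0}) m' D"
          unfolding D_def m' using fk assms(3,4) \<Psi>(3)[OF f nz(2)] unfolding m'
          by (intro ideal_not_acyclic) auto
        then show ?thesis
          using R.Tor_K_nonzero_iff[OF accR subR] ideal_eq_tot[OF fk] by simp
      qed
      then have "ereal (real_of_int (D - int m')) \<le> regularity (*) forms (poly.span (f ` {..<m}))"
        by (rule le_regularity)
      then have "ereal (real_of_int r) + ereal (real_of_int (D - int m'))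
          \<le> regularity scale gr UNIV + regularity (*) forms (poly.span (f ` {..<m}))"
        unfolding main(3) by (intro add_mono) (simp_all add: r_def)
      ultimately show ?thesis
        by (simp add: algebra_simps)
    qed
    ultimately show ?thesis
      using P(1) by blast
  qed
  then show ?thesis
    by (simp only: Let_def)
qed

end
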